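(* Let $(V,\boldsymbol z)$ be a space of quasi-polynomials of the $(\boldsymbol n,(\lambda_1,\dots,\lambda_N),\boldsymbol m,(z_1,\dots,z_M))$-type. Let $U$ be the complex vector space spanned by all functions $$\hat f_a(u)=\int_{\gamma_a}x^u f(x)\,x^{-N}\prod_{b=1}^M(x-z_b)^{-1}\,dx,\qquad a=1,\dots,M,\ f\in V^\star .$$ Then: (i) $U$, together with $(\lambda_1+1,\dots,\lambda_N+1)$, is a space of quasi-exponentials of the $(\boldsymbol m,(z_1,\dots,z_M),\boldsymbol n,(\lambda_1+1,\dots,\lambda_N+1))$-type. (ii) Let $\tilde D_V=\sum_{i=0}^M\sum_{j=0}^N A_{ij}\,x^i(x\partial_x)^j$, with $A_{ij}\in\mathbb C$, be the special fundamental differential operator of $(V,\boldsymbol z)$. Then $\sum_{i=0}^M\sum_{j=0}^N A_{ij}\,u^j\tau_u^i$ is the special fundamental difference operator of $U$.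
   Context: **Special spaces of quasi-polynomials.** Let $N>1$, $M>1$, $\boldsymbol n=(n_1,\dots,n_N)$ and $\boldsymbol m=(m_1,\dots,m_M)$ vectors of nonnegative integers, $\boldsymbol\lambda=(\lambda_1,\dots,\lambda_N)\in\mathbb C^N$ with $\lambda_i-\lambda_j\notin\mathbb Z$ for $i\ne j$. For $i=1,\dots,N$ let $p_i\in\mathbb C[x]$ be of degree $n_i$ with $p_i(0)\ne0$, and let $V$ be the $N$-dimensional space spanned by the multivalued functions $x^{\lambda_i}p_i(x)$. The exponents of $V$ at $z\in\mathbb C^*$ are the unique integers $e_1<\dots<e_N$ such that for each $i$ some $f\in V$ has a root at $z$ of multiplicity $e_i$; $z$ is singular if $\{e_i\}\ne\{0,\dots,N-1\}$. Let $\boldsymbol z=(z_1,\dots,z_M)$ be distinct nonzero complex numbers, containing all singular points of $V$ in $\mathbb C^*$, such that the exponents at $z_a$ are $0<1<\dots<N-2<N-1+m_a$. Then $(V,\boldsymbol z)$ is called a space of quasi-polynomials of the $(\boldsymbol n,\boldsymbol\lambda,\boldsymbol m,\boldsymbol z)$-type. Necessarily $\sum_in_i=\sum_am_a$. $\bar D_V$ is the monic linear differential operator of order $N$ annihilating $V$; $\tilde D_V=x^N\prod_{a=1}^M(x-z_a)\,\bar D_V$ is the special fundamental differential operator; it is a polynomial in $x$ and $x\partial_x$ of degree at most $M$ in $x$ and $N$ in $x\partial_x$ ($\partial_x=d/dx$). $V^\star$ is the span of all $\mathrm{Wr}(f_1,\dots,f_{N-1})/\mathrm{Wr}_V$, $f_i\in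 V$, where $\mathrm{Wr}$ is the Wronskian and $\mathrm{Wr}_V$ the Wronskian of a basis of $V$. $\gamma_a$ is a small circle around $z_a$ oriented counterclockwise. An argument of each $z_a$ is fixed; near $z_a$, $x^u$ and elements of $V^\star$ are computed with the corresponding branch of $\ln x$. **Special spaces of quasi-exponentials.** $(\tau_uf)(u)=f(u+1)$ and $z^u=e^{u\ln z}$ for nonzero $z$ with fixed argument. Let $M>1$, $\boldsymbol m=(m_1,\dots,m_M)$ nonnegative integers, $\boldsymbol z=(z_1,\dots,z_M)$ distinct nonzero numbers with fixed arguments, $q_a\in\mathbb C[u]$ of degree $m_a$, and $U$ the $M$-dimensional span of the functions $z_a^uq_a(u)$. The discrete exponents of $U$ at $\mu\in\mathbb C$ are the unique nonnegative integers $c_1<\dots<c_M$ for which there is a basis $f_1,\dots,f_M$ of $U$ with $f_i(\mu+j)=0$ for $0\le j<c_i$ and $f_i(\mu+c_i)\neq0$. Let $N>1$ and $\boldsymbol\mu=(\mu_1,\dots,\mu_N)$ with $\mu_i-\mu_j\notin\mathbb Z$ for $i\ne j$, such that the discrete exponents of $U$ at $\mu_i$ are $0<1<\dots<M-2<M-1+n_i$ with $n_i\ge0$, and $\sum_in_i=\sum_am_a$. Then $(U,\boldsymbol\mu)$ is called a space of quasi-exponentials of the $(\boldsymbol m,\boldsymbol z,\boldsymbol n,\boldsymbol\mu)$-type. Its special fundamental difference operator is $\tilde D_U=\prod_{i=1}^N(u-\mu_i-n_i+1)\,\bar D_U$, where $\bar D_U$ is the monic linear difference operator $\tau_u^M+\dots$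 of order $M$ annihilating $U$. *)

theory Defs
  imports
    "HOL-Complex_Analysis.Complex_Analysis"
    "HOL-Library.Function_Algebras"
    "Jordan_Normal_Form.Determinant"
begin

text \<open>
  A multivalued function on the punctured plane is represented by a function of \<open>t = ln x\<close>,
  i.e. by a function on the universal cover \<open>exp\<close>: the function \<open>x\<^sup>\<lambda> p(x)\<close> is
  \<open>\<lambda>t. exp (\<lambda> * t) * poly p (exp t)\<close>.  Fixing an argument of a nonzero number \<open>z\<close> means
  fixing a logarithm \<open>l\<close> of it (\<open>exp l = z\<close>).
  Families indexed by \<open>1, \<dots>, k\<close> are functions on \<open>nat\<close>, used on \<open>{..<k}\<close> only.
\<close>

interpretation cfun: vector_space "\<lambda>(c::complex) (f::complex \<Rightarrow> complex) x. c * f x"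
  by unfold_locales (auto simp: fun_eq_iff algebra_simps)

definition is_basis :: "nat \<Rightarrow> (nat \<Rightarrow> complex \<Rightarrow> complex) \<Rightarrow> (complex \<Rightarrow> complex) set \<Rightarrow> bool" where
  "is_basis k f W \<longleftrightarrow>
     inj_on f {..<k} \<and> cfun.independent (f ` {..<k}) \<and> cfun.span (f ` {..<k}) = W"

text \<open>
  The single-valued branch, near \<open>x = exp l\<close>, of a multivalued function, computed with the
  branch of \<open>ln x\<close> whose value at \<open>exp l\<close> is \<open>l\<close>.  It is meaningful
  on the half-plane \<open>Re (x / exp l) > 0\<close>, in particular on the disc around \<open>exp l\<close> up to \<open>0\<close>.
\<close>

definition branch :: "complex \<Rightarrow> (complex \<Rightarrow> complex) \<Rightarrow> complex \<Rightarrow> complex" where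
  "branch l f x = f (l + Ln (x / exp l))"


subsection \<open>Spaces of quasi-polynomials\<close>

text \<open>
  The multiplicities at \<open>x\<close> of the nonzero elements of \<open>V\<close>.  For an \<open>N\<close>-dimensional \<open>V\<close> these
  are exactly \<open>N\<close> integers.
\<close>

definition exponents :: "(complex \<Rightarrow> complex) set \<Rightarrow> complex \<Rightarrow> int set" where
  "exponents V x = {e. \<exists>f\<in>V. \<exists>l. f \<noteq> 0 \<and> exp l = x \<and> zorder (branch l f) x = e}"

definition singular_point :: "nat \<Rightarrow> (complex \<Rightarrow> complex) set \<Rightarrow> complex \<Rightarrow> bool" where
  "singular_point N V x \<longleftrightarrow> x \<noteq> 0 \<and> exponents V x \<noteq> {0..int N - 1}"

definition quasi_polynomial_space ::
  "nat \<Rightarrow> nat \<Rightarrow> (nat \<Rightarrow> nat) \<Rightarrow> (nat \<Rightarrow> complex) \<Rightarrow> (nat \<Rightarrow> nat) \<Rightarrow> (nat \<Rightarrow> complex) \<Rightarrow>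
   (complex \<Rightarrow> complex) set \<Rightarrow> bool" where
  "quasi_polynomial_space N M n lam m z V \<longleftrightarrow>
     1 < N \<and> 1 < M \<and>
     (\<forall>i<N. \<forall>j<N. i \<noteq> j \<longrightarrow> lam i - lam j \<notin> \<int>) \<and>
     (\<exists>p. (\<forall>i<N. degree (p i) = n i \<and> poly (p i) 0 \<noteq> 0) \<and>
          is_basis N (\<lambda>i t. exp (lam i * t) * poly (p i) (exp t)) V) \<and>
     inj_on z {..<M} \<and> (\<forall>a<M. z a \<noteq> 0) \<and>
     (\<forall>x. singular_point N V x \<longrightarrow> x \<in> z ` {..<M}) \<and>
     (\<forall>a<M. exponents V (z a) = {0..int N - 2} \<union> {int N - 1 + int (m a)})"

text \<open>The value at \<open>t\<close> involves the derivatives with respect to \<open>x = exp t\<close>.\<close>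

definition wronskian :: "nat \<Rightarrow> (nat \<Rightarrow> complex \<Rightarrow> complex) \<Rightarrow> complex \<Rightarrow> complex" where
  "wronskian k f t =
     Determinant.det (Matrix.mat k k (\<lambda>(i, j). (deriv ^^ j) (branch t (f i)) (exp t)))"

text \<open>
  The Wronskian of a basis \<open>g\<close> of \<open>V\<close> does not depend on \<open>g\<close> up to a nonzero constant factor,
  so that the span is the same as for one fixed basis.
\<close>

definition dual_space :: "nat \<Rightarrow> (complex \<Rightarrow> complex) set \<Rightarrow> (complex \<Rightarrow> complex) set" where
  "dual_space N V = cfun.span
     {(\<lambda>t. wronskian (N - 1) f t / wronskian N g t) | f g.
        (\<forall>i<N - 1. f i \<in> V) \<and> is_basis N g V}"

text \<open>
  \<open>a k\<close> is the coefficient of the \<open>k\<close>-th power of \<open>d/dx\<close>.  Coefficients are meromorphic, hence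
  identities between operators are required outside of a closed discrete set of \<open>x\<close>.
\<close>

definition differential_op ::
  "nat \<Rightarrow> (nat \<Rightarrow> complex \<Rightarrow> complex) \<Rightarrow> (complex \<Rightarrow> complex) \<Rightarrow> complex \<Rightarrow> complex" where
  "differential_op N a f x = (\<Sum>k\<le>N. a k x * (deriv ^^ k) f x)"

definition fundamental_differential_op ::
  "nat \<Rightarrow> (complex \<Rightarrow> complex) set \<Rightarrow> (nat \<Rightarrow> complex \<Rightarrow> complex) \<Rightarrow> bool" where
  "fundamental_differential_op N V a \<longleftrightarrow>
     (\<forall>k\<le>N. a k meromorphic_on UNIV) \<and> a N = (\<lambda>x. 1) \<and>
     (\<forall>f\<in>V. \<forall>\<^sub>F x in cosparse UNIV. \<forall>l. exp l = x \<longrightarrow> differential_op N a (branch l f) x = 0)"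

text \<open>
  Two differential operators are equal if they agree on all germs of analytic functions.
  The operator given by \<open>a\<close> is unique, since the Wronskian of a basis of \<open>V\<close> is not identically
  zero; the same holds for difference operators below.
\<close>

definition special_fundamental_differential_op ::
  "nat \<Rightarrow> nat \<Rightarrow> (nat \<Rightarrow> complex) \<Rightarrow> (complex \<Rightarrow> complex) set \<Rightarrow>
   ((complex \<Rightarrow> complex) \<Rightarrow> complex \<Rightarrow> complex) \<Rightarrow> bool" where
  "special_fundamental_differential_op N M z V T \<longleftrightarrow>
     (\<exists>a. fundamental_differential_op N V a \<and>
        (\<forall>\<^sub>F x in cosparse UNIV. \<forall>f. f analytic_on {x} \<longrightarrow>
           T f x = x ^ N * (\<Prod>b<M. x - z b) * differential_op N a f x))"

definition euler_op :: "(complex \<Rightarrow> complex) \<Rightarrow> complex \<Rightarrow> complex" where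
  "euler_op f x = x * deriv f x"


subsection \<open>Spaces of quasi-exponentials\<close>

definition shift_op :: "(complex \<Rightarrow> complex) \<Rightarrow> complex \<Rightarrow> complex" where
  "shift_op g u = g (u + 1)"

definition discrete_exponents ::
  "nat \<Rightarrow> (complex \<Rightarrow> complex) set \<Rightarrow> complex \<Rightarrow> (nat \<Rightarrow> nat) \<Rightarrow> bool" where
  "discrete_exponents M U mu c \<longleftrightarrow>
     strict_mono_on {..<M} c \<and>
     (\<exists>f. is_basis M f U \<and>
        (\<forall>i<M. (\<forall>j<c i. f i (mu + of_nat j) = 0) \<and> f i (mu + of_nat (c i)) \<noteq> 0))"

text \<open>\<open>l a\<close> is the fixed logarithm of \<open>z a\<close>, so that \<open>exp (u * l a)\<close> is the \<open>u\<close>-th power of \<open>z a\<close>.\<close>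

definition quasi_exponential_space ::
  "nat \<Rightarrow> nat \<Rightarrow> (nat \<Rightarrow> nat) \<Rightarrow> (nat \<Rightarrow> complex) \<Rightarrow> (nat \<Rightarrow> complex) \<Rightarrow> (nat \<Rightarrow> nat) \<Rightarrow>
   (nat \<Rightarrow> complex) \<Rightarrow> (complex \<Rightarrow> complex) set \<Rightarrow> bool" where
  "quasi_exponential_space M N m z l n mu U \<longleftrightarrow>
     1 < M \<and> 1 < N \<and>
     inj_on z {..<M} \<and> (\<forall>a<M. z a \<noteq> 0 \<and> exp (l a) = z a) \<and>
     (\<exists>q. (\<forall>a<M. q a \<noteq> 0 \<and> degree (q a) = m a) \<and>
          is_basis M (\<lambda>a u. exp (u * l a) * poly (q a) u) U) \<and>
     (\<forall>i<N. \<forall>j<N. i \<noteq> j \<longrightarrow> mu i - mu j \<notin> \<int>) \<and>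
     (\<forall>i<N. discrete_exponents M U (mu i) (\<lambda>k. if k = M - 1 then M - 1 + n i else k)) \<and>
     (\<Sum>i<N. n i) = (\<Sum>a<M. m a)"

definition difference_op ::
  "nat \<Rightarrow> (nat \<Rightarrow> complex \<Rightarrow> complex) \<Rightarrow> (complex \<Rightarrow> complex) \<Rightarrow> complex \<Rightarrow> complex" where
  "difference_op M b g u = (\<Sum>k\<le>M. b k u * (shift_op ^^ k) g u)"

definition fundamental_difference_op ::
  "nat \<Rightarrow> (complex \<Rightarrow> complex) set \<Rightarrow> (nat \<Rightarrow> complex \<Rightarrow> complex) \<Rightarrow> bool" where
  "fundamental_difference_op M U b \<longleftrightarrow>
     (\<forall>k\<le>M. b k meromorphic_on UNIV) \<and> b M = (\<lambda>u. 1) \<and>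
     (\<forall>g\<in>U. \<forall>\<^sub>F u in cosparse UNIV. difference_op M b g u = 0)"

definition special_fundamental_difference_op ::
  "nat \<Rightarrow> nat \<Rightarrow> (nat \<Rightarrow> nat) \<Rightarrow> (nat \<Rightarrow> complex) \<Rightarrow> (complex \<Rightarrow> complex) set \<Rightarrow>
   ((complex \<Rightarrow> complex) \<Rightarrow> complex \<Rightarrow> complex) \<Rightarrow> bool" where
  "special_fundamental_difference_op M N n mu U T \<longleftrightarrow>
     (\<exists>b. fundamental_difference_op M U b \<and>
        (\<forall>\<^sub>F u in cosparse UNIV. \<forall>g.
           T g u = (\<Prod>i<N. u - mu i - of_nat (n i) + 1) * difference_op M b g u))"


subsection \<open>The integral transform\<close>

text \<open>
  The circle is the one of radius \<open>r a\<close> around \<open>z a\<close>; both the power \<open>x\<^sup>u\<close> and \<open>f\<close> are computed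
  with the branch of \<open>ln x\<close> equal to \<open>l a\<close> at \<open>z a\<close>.
\<close>

definition hat_transform ::
  "nat \<Rightarrow> nat \<Rightarrow> (nat \<Rightarrow> complex) \<Rightarrow> (nat \<Rightarrow> complex) \<Rightarrow> (nat \<Rightarrow> real) \<Rightarrow>
   (complex \<Rightarrow> complex) \<Rightarrow> nat \<Rightarrow> complex \<Rightarrow> complex" where
  "hat_transform N M z l r f a u =
     contour_integral (circlepath (z a) (r a))
       (\<lambda>x. branch (l a) (\<lambda>t. exp (u * t)) x * branch (l a) f x
             * inverse (x ^ N) * inverse (\<Prod>b<M. x - z b))"

text \<open>The circles are small enough if no closed disc contains \<open>0\<close> or another \<open>z b\<close>.\<close>

definition small_radii :: "nat \<Rightarrow> (nat \<Rightarrow> complex) \<Rightarrow> (nat \<Rightarrow> real) \<Rightarrow> bool" where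
  "small_radii M z r \<longleftrightarrow>
     (\<forall>a<M. 0 < r a \<and> 0 \<notin> cball (z a) (r a) \<and>
        (\<forall>b<M. b \<noteq> a \<longrightarrow> z b \<notin> cball (z a) (r a)))"

definition transformed_space ::
  "nat \<Rightarrow> nat \<Rightarrow> (nat \<Rightarrow> complex) \<Rightarrow> (nat \<Rightarrow> complex) \<Rightarrow> (nat \<Rightarrow> real) \<Rightarrow>
   (complex \<Rightarrow> complex) set \<Rightarrow> (complex \<Rightarrow> complex) set" where
  "transformed_space N M z l r V =
     cfun.span {hat_transform N M z l r f a | f a. f \<in> dual_space N V \<and> a < M}"

end

theory Submission
  imports Defs "HOL-Computational_Algebra.Fundamental_Theorem_Algebra"
begin

text \<open>
  Put \<open>t = ln x\<close>. The elements of \<open>V\<close> are then entire functions of \<open>t\<close>, \<open>x d/dx\<close> is \<open>d/dt\<close>,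
  and the special fundamental operator is \<open>\<Sum>\<^sub>j C\<^sub>j(x) (x d/dx)\<^sup>j\<close> with polynomials \<open>C\<^sub>j\<close> of degree at most
  \<open>M\<close> and \<open>C\<^sub>N = \<Prod>(x - z\<^sub>b)\<close>. Such polynomials exist (\<open>annihilator_exists\<close>): by Cramer's rule the
  coefficients are rational functions, and the exponents \<open>0, \<dots>, N - 2, N - 1 + m\<^sub>a\<close> leave them at most a
  simple pole at \<open>z\<^sub>a\<close>. Their coefficients of \<open>x\<^sup>M\<close> and of \<open>x\<^sup>0\<close> are the indicial polynomials at infinity
  and at zero, which have the roots \<open>\<lambda>\<^sub>k + n\<^sub>k\<close> and \<open>\<lambda>\<^sub>k\<close>; comparing their second coefficients with the
  residues at the \<open>z\<^sub>a\<close> yields \<open>\<Sum>n\<^sub>i = \<Sum>m\<^sub>a\<close> (\<open>fuchs_relation\<close>).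

  Let \<open>f = Wr(f\<^sub>1,\<dots>,f\<^sub>N\<^sub>-\<^sub>1) / Wr\<^sub>V\<close> be a generator of the dual space. Up to a power of \<open>x\<close>, \<open>f\<close> is the leading
  coefficient of the operator \<open>E h = Wr(f\<^sub>1,\<dots>,f\<^sub>N\<^sub>-\<^sub>1,h) / Wr\<^sub>V\<close> of order \<open>N - 1\<close>, which maps every element
  of \<open>V\<close> to a constant. So \<open>d/dt \<circ> E\<close> kills \<open>V\<close> and is a multiple of the fundamental operator
  (\<open>symbol_derivative\<close>). Applied to \<open>h = x\<^sup>u\<close> this says that the fundamental operator on \<open>x\<^sup>u\<close>, multiplied
  by \<open>f x\<^sup>-\<^sup>N \<Prod>(x - z\<^sub>b)\<^sup>-\<^sup>1\<close>, is the \<open>x\<close>-derivative of a function that is single-valued near the circle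
  \<open>\<gamma>\<^sub>a\<close>. Its integral vanishes, and this is the difference equation for the transform of \<open>f\<close>
  (\<open>hat_recurrence\<close>).

  Near \<open>z\<^sub>a\<close> an element of the dual space is a multiple of one function with a pole of order \<open>m\<^sub>a\<close> plus a
  function that vanishes at \<open>z\<^sub>a\<close>. The latter does not contribute to the integral, and Cauchy's formula for
  the \<open>m\<^sub>a\<close>-th derivative turns the former into \<open>z\<^sub>a\<^sup>u q\<^sub>a(u)\<close> with \<open>deg q\<^sub>a = m\<^sub>a\<close> (\<open>hat_transform_form\<close>).

  It remains to find the discrete exponents (\<open>discrete_exponents_U\<close>). In the difference equation the leading
  coefficient is \<open>\<Prod>(u - \<lambda>\<^sub>k - n\<^sub>k)\<close>, and the trailing one vanishes at \<open>\<lambda>\<^sub>i\<close>. Hence a solution on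
  \<open>\<lambda>\<^sub>i + 1, \<lambda>\<^sub>i + 2, \<dots>\<close> is determined by its first \<open>M - 1\<close> values and the one value at which the leading
  coefficient vanishes, so that evaluation at these \<open>M\<close> points is an isomorphism on \<open>U\<close>.
\<close>

section \<open>Determinants of families of scalars\<close>

text \<open>
  Determinants of \<open>n \<times> n\<close> arrays given as functions: the arrays below depend on a complex variable or have
  polynomial entries, and Cramer's rule is needed for single entries.
\<close>

definition fdet :: "nat \<Rightarrow> (nat \<Rightarrow> nat \<Rightarrow> 'a::comm_ring_1) \<Rightarrow> 'a" where
  "fdet n a = Determinant.det (Matrix.mat n n (\<lambda>(i, j). a i j))"

definition fcof :: "nat \<Rightarrow> (nat \<Rightarrow> nat \<Rightarrow> 'a::comm_ring_1) \<Rightarrow> nat \<Rightarrow> nat \<Rightarrow> 'a" where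
  "fcof n a i j = Determinant.cofactor (Matrix.mat n n (\<lambda>(i, j). a i j)) i j"

lemma fdet_cong:
  assumes "\<And>i j. i < n \<Longrightarrow> j < n \<Longrightarrow> a i j = b i j"
  shows "fdet n a = fdet n b"
  unfolding fdet_def by (rule arg_cong[where f = Determinant.det]) (auto intro!: eq_matI assms)

lemma fdet_expand_row:
  assumes "i < n" shows "fdet n a = (\<Sum>j<n. a i j * fcof n a i j)"
  unfolding fdet_def fcof_def using assms
  by (subst Determinant.laplace_expansion_row[where i = i]) (auto intro!: sum.cong)

text \<open>
  Row expansion of the determinant in which row \<open>i'\<close> is replaced by row \<open>i\<close>: for \<open>i \<noteq> i'\<close> two rows agree.
\<close>

lemma fcof_row:
  assumes "i < n" "i' < n"
  shows "(\<Sum>j<n. a i j * fcof n a i' j) = (if i = i' then fdet n a else 0)"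
proof -
  let ?A = "Matrix.mat n n (\<lambda>(i, j). a i j)"
  have A: "?A \<in> carrier_mat n n" by simp
  have "Matrix.index_mat (?A * adj_mat ?A) (i, i') = Matrix.index_mat (Determinant.det ?A \<cdot>\<^sub>m 1\<^sub>m n) (i, i')"
    using adj_mat(2)[OF A] by simp
  thus ?thesis using assms
    by (simp add: fdet_def fcof_def adj_mat_def scalar_prod_def atLeast0LessThan)
qed

lemma fcof_col:
  assumes "j < n" "j' < n"
  shows "(\<Sum>i<n. fcof n a i j * a i j') = (if j = j' then fdet n a else 0)"
proof -
  let ?A = "Matrix.mat n n (\<lambda>(i, j). a i j)"
  have A: "?A \<in> carrier_mat n n" by simp
  have "Matrix.index_mat (adj_mat ?A * ?A) (j, j') = Matrix.index_mat (Determinant.det ?A \<cdot>\<^sub>m 1\<^sub>m n) (j, j')"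
    using adj_mat(3)[OF A] by simp
  thus ?thesis using assms
    by (simp add: fdet_def fcof_def adj_mat_def scalar_prod_def atLeast0LessThan)
qed

lemma fdet_cramer:
  assumes "\<And>i. i < n \<Longrightarrow> (\<Sum>j<n. a i j * e j) = b i" and j: "j < n"
  shows "fdet n a * e j = (\<Sum>i<n. fcof n a i j * b i)"
proof -
  have "(\<Sum>i<n. fcof n a i j * b i) = (\<Sum>i<n. \<Sum>j'<n. fcof n a i j * a i j' * e j')"
    by (intro sum.cong refl) (simp flip: assms(1) add: sum_distrib_left mult.assoc)
  also have "\<dots> = (\<Sum>j'<n. (\<Sum>i<n. fcof n a i j * a i j') * e j')"
    by (subst sum.swap) (simp add: sum_distrib_right)
  also have "\<dots> = (\<Sum>j'<n. if j = j' then fdet n a * e j' else 0)"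
    using j by (intro sum.cong refl) (simp add: fcof_col)
  also have "\<dots> = fdet n a * e j" using j by simp
  finally show ?thesis by simp
qed

lemma fdet_injective:
  fixes a :: "nat \<Rightarrow> nat \<Rightarrow> 'a::idom"
  assumes "fdet n a \<noteq> 0" "\<And>i. i < n \<Longrightarrow> (\<Sum>j<n. a i j * e j) = 0" "j < n"
  shows "e j = 0"
  using fdet_cramer[where b = "\<lambda>_. 0" and a = a and e = e and n = n, OF _ assms(3)] assms(1,2) by simp

lemma fdet_solvable:
  fixes a :: "nat \<Rightarrow> nat \<Rightarrow> 'a::field"
  assumes "fdet n a \<noteq> 0"
  shows "\<exists>e. \<forall>i<n. (\<Sum>j<n. a i j * e j) = b i"
proof (intro exI allI impI)
  fix i assume i: "i < n"
  have "(\<Sum>j<n. a i j * ((\<Sum>i'<n. fcof n a i' j * b i') / fdet n a))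
      = (\<Sum>j<n. \<Sum>i'<n. a i j * fcof n a i' j * b i') / fdet n a"
    by (simp add: sum_distrib_left sum_divide_distrib mult.assoc)
  also have "(\<Sum>j<n. \<Sum>i'<n. a i j * fcof n a i' j * b i') = (\<Sum>i'<n. (\<Sum>j<n. a i j * fcof n a i' j) * b i')"
    by (subst sum.swap) (simp add: sum_distrib_right)
  also have "\<dots> = (\<Sum>i'<n. if i = i' then fdet n a * b i' else 0)"
    using i by (intro sum.cong refl) (simp add: fcof_row)
  also have "\<dots> = fdet n a * b i" using i by simp
  finally show "(\<Sum>j<n. a i j * ((\<Sum>i'<n. fcof n a i' j * b i') / fdet n a)) = b i"
    using assms by simp
qed

lemma fdet_nonzeroI:
  fixes a :: "nat \<Rightarrow> nat \<Rightarrow> 'a::idom"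
  assumes "\<And>e j. (\<And>i. i < n \<Longrightarrow> (\<Sum>j<n. a i j * e j) = 0) \<Longrightarrow> j < n \<Longrightarrow> e j = 0"
  shows "fdet n a \<noteq> 0"
proof
  let ?A = "Matrix.mat n n (\<lambda>(i, j). a i j)"
  assume "fdet n a = 0"
  then obtain v where v: "v \<in> carrier_vec n" "v \<noteq> 0\<^sub>v n" "?A *\<^sub>v v = 0\<^sub>v n"
    using det_0_iff_vec_prod_zero[of ?A n] by (auto simp: fdet_def)
  have "(\<Sum>j<n. a i j * vec_index v j) = 0" if "i < n" for i
  proof -
    have "vec_index (?A *\<^sub>v v) i = 0" using v(3) that by simp
    thus ?thesis using that v(1)
      by (simp add: mult_mat_vec_def scalar_prod_def atLeast0LessThan)
  qed
  hence "vec_index v j = 0" if "j < n" for j using assms[of "vec_index v"] that by auto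
  hence "v = 0\<^sub>v n" using v(1) by (intro eq_vecI) auto
  with v(2) show False by simp
qed

lemma fdet_mult:
  "fdet n (\<lambda>i j. \<Sum>k<n. c i k * b k j) = fdet n c * fdet n b"
proof -
  have "Matrix.mat n n (\<lambda>(i, j). \<Sum>k<n. c i k * b k j)
      = Matrix.mat n n (\<lambda>(i, j). c i j) * Matrix.mat n n (\<lambda>(i, j). b i j)"
    by (intro eq_matI) (auto simp: scalar_prod_def atLeast0LessThan)
  thus ?thesis by (simp add: fdet_def det_mult[of _ n])
qed

lemma fdet_upper_triangular:
  assumes "\<And>i j. i < n \<Longrightarrow> j < i \<Longrightarrow> a i j = 0"
  shows "fdet n a = (\<Prod>i<n. a i i)"
proof -
  let ?A = "Matrix.mat n n (\<lambda>(i, j). a i j)"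
  have "fdet n a = prod_list (diag_mat ?A)"
    unfolding fdet_def by (rule det_upper_triangular) (auto simp: upper_triangular_def assms)
  also have "\<dots> = (\<Prod>i<n. a i i)"
    by (simp add: diag_mat_def prod.list_conv_set_nth atLeast0LessThan prod.distinct_set_conv_list[symmetric])
  finally show ?thesis .
qed

lemma fdet_mult_row:
  assumes "k < n" "\<And>i j. i < n \<Longrightarrow> i \<noteq> k \<Longrightarrow> j < n \<Longrightarrow> a i j = b i j" "\<And>j. j < n \<Longrightarrow> a k j = c * b k j"
  shows "fdet n a = c * fdet n b"
proof -
  have "fdet n a = (\<Sum>j<n. a k j * fcof n a k j)" by (rule fdet_expand_row) fact
  also have "\<dots> = (\<Sum>j<n. c * (b k j * fcof n b k j))"
  proof (rule sum.cong[OF refl])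
    fix j assume "j \<in> {..<n}"
    have "mat_delete (Matrix.mat n n (\<lambda>(i, j). a i j)) k j = mat_delete (Matrix.mat n n (\<lambda>(i, j). b i j)) k j"
      unfolding mat_delete_def using assms(1) by (intro eq_matI) (auto simp: assms(2))
    thus "a k j * fcof n a k j = c * (b k j * fcof n b k j)"
      using \<open>j \<in> _\<close> by (simp add: fcof_def cofactor_def assms(3))
  qed
  also have "\<dots> = c * fdet n b" using fdet_expand_row[OF assms(1), of b] by (simp add: sum_distrib_left)
  finally show ?thesis .
qed

text \<open>
  The cofactors along a row do not see that row. This allows for varying the last function of a Wronskian
  while its cofactors stay fixed.
\<close>

lemma fcof_cong_row:
  assumes "k < n" "\<And>i j. i < n \<Longrightarrow> i \<noteq> k \<Longrightarrow> j < n \<Longrightarrow> a i j = b i j"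
  shows "fcof n a k j = fcof n b k j"
proof -
  have "mat_delete (Matrix.mat n n (\<lambda>(i, j). a i j)) k j = mat_delete (Matrix.mat n n (\<lambda>(i, j). b i j)) k j"
    unfolding mat_delete_def using assms(1) by (intro eq_matI) (auto simp: assms(2))
  thus ?thesis by (simp add: fcof_def cofactor_def)
qed

lemma fcof_last:
  "fcof (Suc n) a n n = fdet n a"
proof -
  have "mat_delete (Matrix.mat (Suc n) (Suc n) (\<lambda>(i, j). a i j)) n n = Matrix.mat n n (\<lambda>(i, j). a i j)"
    unfolding mat_delete_def by (intro eq_matI) auto
  thus ?thesis by (simp add: fcof_def fdet_def cofactor_def)
qed

lemma fdet_hom:
  assumes "comm_ring_hom h"
  shows "fdet n (\<lambda>i j. h (a i j)) = h (fdet n a)"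
proof -
  interpret comm_ring_hom h by fact
  have "Matrix.mat n n (\<lambda>(i, j). h (a i j)) = map_mat h (Matrix.mat n n (\<lambda>(i, j). a i j))"
    by (intro eq_matI) auto
  thus ?thesis by (simp add: fdet_def)
qed

lemma fdet_scale_rows: "fdet n (\<lambda>i j. c i * a i j) = (\<Prod>i<n. c i) * fdet n a"
proof -
  have "fdet n (\<lambda>i j. c i * a i j) = fdet n (\<lambda>i j. \<Sum>k<n. (if i = k then c i else 0) * a k j)"
  proof (rule fdet_cong)
    fix i j assume "i < n"
    have "(\<Sum>k<n. (if i = k then c i else 0) * a k j) = (\<Sum>k<n. if i = k then c i * a k j else 0)"
      by (intro sum.cong) auto
    thus "c i * a i j = (\<Sum>k<n. (if i = k then c i else 0) * a k j)" using \<open>i < n\<close> by simp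
  qed
  also have "\<dots> = fdet n (\<lambda>i k. if i = k then c i else 0) * fdet n a" by (rule fdet_mult)
  also have "fdet n (\<lambda>i k. if i = k then c i else 0) = (\<Prod>i<n. c i)"
    by (subst fdet_upper_triangular) auto
  finally show ?thesis .
qed

text \<open>
  Evaluation at a point is a ring homomorphism, so it commutes with determinants.
\<close>

lemma poly_fdet: "poly (fdet n a) x = fdet n (\<lambda>i j. poly (a i j) x)"
  by (rule fdet_hom[symmetric]) (unfold_locales, auto)

lemma holomorphic_fdet:
  assumes "\<And>i j. i < n \<Longrightarrow> j < n \<Longrightarrow> (\<lambda>t. a t i j) holomorphic_on S"
  shows "(\<lambda>t. fdet n (a t)) holomorphic_on S"
proof -
  have "(\<lambda>t. \<Sum>p | p permutes {0..<n}. signof p * (\<Prod>i = 0..<n. a t i (p i))) holomorphic_on S"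
    by (intro holomorphic_intros assms) (auto dest: permutes_in_image)
  also have "?this \<longleftrightarrow> ?thesis"
    unfolding fdet_def
    by (intro holomorphic_cong refl)
       (auto simp: Determinant.det_def intro!: sum.cong prod.cong dest: permutes_in_image)
  finally show ?thesis .
qed

lemma holomorphic_fcof:
  assumes "\<And>i j. i < n \<Longrightarrow> j < n \<Longrightarrow> (\<lambda>t. a t i j) holomorphic_on S" "k < n" "l < n"
  shows "(\<lambda>t. fcof n (a t) k l) holomorphic_on S"
proof -
  let ?b = "\<lambda>t i j. a t (if i < k then i else Suc i) (if j < l then j else Suc j)"
  have "(\<lambda>t. (-1) ^ (k + l) * fdet (n - 1) (?b t)) holomorphic_on S"
    using assms(2,3) by (intro holomorphic_intros holomorphic_fdet assms(1)) auto
  also have "(\<lambda>t. (-1) ^ (k + l) * fdet (n - 1) (?b t)) = (\<lambda>t. fcof n (a t) k l)"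
  proof
    fix t
    have "mat_delete (Matrix.mat n n (\<lambda>(i, j). a t i j)) k l = Matrix.mat (n - 1) (n - 1) (\<lambda>(i, j). ?b t i j)"
      unfolding mat_delete_def using assms(2,3) by (intro eq_matI) auto
    thus "(-1) ^ (k + l) * fdet (n - 1) (?b t) = fcof n (a t) k l"
      by (simp add: fdet_def fcof_def cofactor_def)
  qed
  finally show ?thesis .
qed

section \<open>Functions of the logarithmic coordinate\<close>

text \<open>
  A part of the plane on which \<open>branch l\<close> is analytic for every entire function: there
  \<open>x / exp l\<close> stays off the cut of the principal logarithm.
\<close>

definition half_plane :: "complex \<Rightarrow> complex set" where
  "half_plane l = {x. Re (x / exp l) > 0}"

definition log_branch :: "complex \<Rightarrow> complex \<Rightarrow> complex" where
  "log_branch l x = l + Ln (x / exp l)"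

lemma branch_log_branch: "branch l f x = f (log_branch l x)"
  by (simp add: branch_def log_branch_def)

lemma open_half_plane: "open (half_plane l)"
  unfolding half_plane_def by (intro open_Collect_less continuous_intros) auto

lemma half_plane_nonzero: "x \<in> half_plane l \<Longrightarrow> x \<noteq> 0"
  by (auto simp: half_plane_def)

lemma exp_in_half_plane [simp]: "exp l \<in> half_plane l"
  by (simp add: half_plane_def)

lemma log_branch_exp [simp]: "log_branch l (exp l) = l"
  by (simp add: log_branch_def)

lemma exp_log_branch: "x \<noteq> 0 \<Longrightarrow> exp (log_branch l x) = x"
  by (simp add: log_branch_def exp_add)

lemma has_field_derivative_log_branch:
  assumes "x \<in> half_plane l"
  shows "(log_branch l has_field_derivative 1 / x) (at x)"
proof -
  have "x / exp l \<notin> \<real>\<^sub>\<le>\<^sub>0" using assms by (auto simp: half_plane_def complex_nonpos_Reals_iff)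
  thus ?thesis unfolding log_branch_def[abs_def] using half_plane_nonzero[OF assms]
    by (auto intro!: derivative_eq_intros)
qed

lemma holomorphic_log_branch: "S \<subseteq> half_plane l \<Longrightarrow> log_branch l holomorphic_on S"
  using has_field_derivative_log_branch
  by (meson field_differentiable_at_within field_differentiable_def holomorphic_on_def subsetD)

lemma cball_subset_half_plane:
  assumes "exp l = z" "0 \<notin> cball z r" shows "cball z r \<subseteq> half_plane l"
proof
  fix x assume x: "x \<in> cball z r"
  have z: "z \<noteq> 0" using assms(1) by auto
  have "cmod (x - z) < cmod z" using x assms(2) by (auto simp: dist_norm norm_minus_commute)
  hence "cmod ((x - z) / z) < 1" using z by (simp add: norm_divide)
  moreover have "(x - z) / z = x / z - 1" using z by (simp add: field_simps)
  ultimately have "cmod (1 - x / z) < 1" by (metis norm_minus_commute)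
  hence "Re (1 - x / z) < 1" using complex_Re_le_cmod[of "1 - x / z"] by linarith
  thus "x \<in> half_plane l" by (simp add: half_plane_def assms(1))
qed

lemma has_field_derivative_higher_entire:
  assumes "v holomorphic_on UNIV"
  shows "((deriv ^^ j) v has_field_derivative (deriv ^^ Suc j) v t) (at t)"
  using has_field_derivative_higher_deriv[OF assms, of t j] by simp

lemma higher_deriv_entire_lincomb:
  assumes "\<And>k. k \<in> K \<Longrightarrow> h k holomorphic_on UNIV"
  shows "(deriv ^^ j) (\<lambda>t. \<Sum>k\<in>K. c k * h k t) = (\<lambda>t. \<Sum>k\<in>K. c k * (deriv ^^ j) (h k) t)"
proof (induction j)
  case (Suc j)
  show ?case
  proof
    fix t
    have "((\<lambda>t. \<Sum>k\<in>K. c k * (deriv ^^ j) (h k) t) has_field_derivative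
            (\<Sum>k\<in>K. c k * (deriv ^^ Suc j) (h k) t)) (at t)"
      by (intro DERIV_sum DERIV_cmult has_field_derivative_higher_entire assms)
    thus "(deriv ^^ Suc j) (\<lambda>t. \<Sum>k\<in>K. c k * h k t) t = (\<Sum>k\<in>K. c k * (deriv ^^ Suc j) (h k) t)"
      by (simp add: Suc.IH DERIV_imp_deriv)
  qed
qed auto

lemma has_field_derivative_branch:
  assumes "v holomorphic_on UNIV" "x \<in> half_plane l"
  shows "(branch l ((deriv ^^ j) v) has_field_derivative branch l ((deriv ^^ Suc j) v) x / x) (at x)"
proof -
  have "((\<lambda>x. (deriv ^^ j) v (log_branch l x)) has_field_derivative (deriv ^^ Suc j) v (log_branch l x) * (1 / x)) (at x)"
    by (rule DERIV_chain2[OF has_field_derivative_higher_entire[OF assms(1)] has_field_derivative_log_branch[OF assms(2)]])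
  thus ?thesis by (simp add: branch_log_branch[abs_def])
qed

lemma euler_op_branch:
  assumes v: "v holomorphic_on UNIV" and "x \<in> half_plane l"
  shows "(euler_op ^^ j) (branch l v) x = branch l ((deriv ^^ j) v) x"
  using assms(2)
proof (induction j arbitrary: x)
  case (Suc j)
  have "\<forall>\<^sub>F y in nhds x. (euler_op ^^ j) (branch l v) y = branch l ((deriv ^^ j) v) y"
    using eventually_nhds_in_open[OF open_half_plane Suc.prems] by eventually_elim (rule Suc.IH)
  hence "deriv ((euler_op ^^ j) (branch l v)) x = deriv (branch l ((deriv ^^ j) v)) x"
    by (intro deriv_cong_ev) auto
  also have "\<dots> = branch l ((deriv ^^ Suc j) v) x / x"
    by (rule DERIV_imp_deriv[OF has_field_derivative_branch[OF v Suc.prems]])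
  finally show ?case using half_plane_nonzero[OF Suc.prems]
    by (simp add: euler_op_def[of "(euler_op ^^ j) (branch l v)" x])
qed auto

definition falling_poly :: "nat \<Rightarrow> complex poly" where
  "falling_poly k = (\<Prod>i<k. [:- of_nat i, 1:])"

lemma degree_falling_poly: "degree (falling_poly k) = k"
  unfolding falling_poly_def by (subst degree_prod_eq_sum_degree) auto

lemma lead_coeff_falling_poly: "coeff (falling_poly k) k = 1"
proof -
  have "lead_coeff (falling_poly k) = 1" unfolding falling_poly_def by (subst lead_coeff_prod) auto
  thus ?thesis by (simp add: degree_falling_poly)
qed

text \<open>
  Read \<open>y i\<close> as the \<open>i\<close>-th \<open>t\<close>-derivative of a function: this is the step from
  \<open>\<theta>(\<theta> - 1)\<cdots>(\<theta> - k + 1)\<close> to the next factor \<open>\<theta> - k\<close>, where \<open>\<theta> = d/dt\<close>.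
\<close>

lemma falling_poly_Suc_sum:
  "(\<Sum>i\<le>Suc k. coeff (falling_poly (Suc k)) i * y i)
     = (\<Sum>i\<le>k. coeff (falling_poly k) i * (y (Suc i) - of_nat k * y i))"
proof -
  let ?p = "falling_poly k"
  have p: "falling_poly (Suc k) = [:- of_nat k, 1:] * ?p" by (simp add: falling_poly_def mult.commute)
  have [simp]: "coeff ?p (Suc k) = 0" by (rule coeff_eq_0) (simp add: degree_falling_poly)
  have "(\<Sum>i\<le>Suc k. coeff (falling_poly (Suc k)) i * y i)
      = (\<Sum>i\<le>Suc k. coeff (pCons 0 ?p) i * y i) - (\<Sum>i\<le>Suc k. of_nat k * coeff ?p i * y i)"
    unfolding p by (simp add: sum_subtractf[symmetric] algebra_simps del: sum.atMost_Suc)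
  also have "(\<Sum>i\<le>Suc k. coeff (pCons 0 ?p) i * y i) = (\<Sum>i\<le>k. coeff ?p i * y (Suc i))"
    by (subst sum.atMost_Suc_shift) (simp add: coeff_pCons)
  finally show ?thesis by (simp add: sum_subtractf algebra_simps)
qed

text \<open>
  The classical identity \<open>x\<^sup>k (d/dx)\<^sup>k = \<theta>(\<theta> - 1)\<cdots>(\<theta> - k + 1)\<close> with \<open>\<theta> = x d/dx = d/dt\<close>.
\<close>

lemma higher_deriv_branch:
  assumes v: "v holomorphic_on UNIV" and "x \<in> half_plane l"
  shows "(deriv ^^ k) (branch l v) x
      = (\<Sum>i\<le>k. coeff (falling_poly k) i * branch l ((deriv ^^ i) v) x) / x ^ k"
  using assms(2)
proof (induction k arbitrary: x)
  case 0
  thus ?case by (simp add: falling_poly_def)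
next
  case (Suc k)
  have x0: "x \<noteq> 0" by (rule half_plane_nonzero) fact
  let ?F = "\<lambda>x. (\<Sum>i\<le>k. coeff (falling_poly k) i * branch l ((deriv ^^ i) v) x) / x ^ k"
  let ?b = "\<lambda>i. branch l ((deriv ^^ i) v) x"
  have "\<forall>\<^sub>F y in nhds x. (deriv ^^ k) (branch l v) y = ?F y"
    using eventually_nhds_in_open[OF open_half_plane Suc.prems] by eventually_elim (rule Suc.IH)
  hence "(deriv ^^ Suc k) (branch l v) x = deriv ?F x" by (auto intro: deriv_cong_ev)
  also have "\<dots> = ((\<Sum>i\<le>k. coeff (falling_poly k) i * (?b (Suc i) / x)) * x ^ k
        - (\<Sum>i\<le>k. coeff (falling_poly k) i * ?b i) * (of_nat k * x ^ (k - 1))) / (x ^ k * x ^ k)"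
    using x0
    by (intro DERIV_imp_deriv DERIV_divide DERIV_sum DERIV_cmult has_field_derivative_branch[OF v Suc.prems])
       (auto intro!: derivative_eq_intros)
  also have "\<dots> = (\<Sum>i\<le>k. coeff (falling_poly k) i * (?b (Suc i) - of_nat k * ?b i)) / x ^ Suc k"
  proof -
    have k: "of_nat k * x ^ (k - 1) = of_nat k * x ^ k / x" using x0 by (cases k) auto
    define S where "S = (\<Sum>i\<le>k. coeff (falling_poly k) i * ?b (Suc i))"
    define S' where "S' = (\<Sum>i\<le>k. coeff (falling_poly k) i * ?b i)"
    have "(\<Sum>i\<le>k. coeff (falling_poly k) i * (?b (Suc i) / x)) = S / x"
      by (simp add: S_def sum_divide_distrib)
    moreover have "(\<Sum>i\<le>k. coeff (falling_poly k) i * (?b (Suc i) - of_nat k * ?b i)) = S - of_nat k * S'"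
      by (simp add: S_def S'_def right_diff_distrib sum_subtractf sum_distrib_left mult.left_commute)
    moreover have "(S / x * X - S' * (of_nat k * X / x)) / (X * X) = (S - of_nat k * S') / (x * X)"
      if "X \<noteq> 0" for X using x0 that by (simp add: field_simps)
    ultimately show ?thesis unfolding k S'_def[symmetric] using x0 by simp
  qed
  also have "\<dots> = (\<Sum>i\<le>Suc k. coeff (falling_poly (Suc k)) i * ?b i) / x ^ Suc k"
    by (simp only: falling_poly_Suc_sum)
  finally show ?case .
qed

definition log_wronskian :: "nat \<Rightarrow> (nat \<Rightarrow> complex \<Rightarrow> complex) \<Rightarrow> complex \<Rightarrow> complex" where
  "log_wronskian n f t = fdet n (\<lambda>i j. (deriv ^^ j) (f i) t)"

text \<open>
  Passing from \<open>x\<close>-derivatives to \<open>t\<close>-derivatives multiplies the matrix by a triangular one whose diagonal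
  entries are \<open>x\<^sup>-\<^sup>j\<close>.
\<close>

lemma wronskian_eq_log_wronskian:
  assumes "\<And>i. i < n \<Longrightarrow> f i holomorphic_on UNIV"
  shows "wronskian n f t = exp (- of_nat (\<Sum>j<n. j) * t) * log_wronskian n f t"
proof -
  have "wronskian n f t = fdet n (\<lambda>i j. (deriv ^^ j) (branch t (f i)) (exp t))"
    by (simp add: wronskian_def fdet_def)
  also have "\<dots> = fdet n (\<lambda>i j. \<Sum>k<n. (deriv ^^ k) (f i) t * (coeff (falling_poly j) k / exp t ^ j))"
  proof (rule fdet_cong)
    fix i j assume i: "i < n" and j: "j < n"
    have "(deriv ^^ j) (branch t (f i)) (exp t)
        = (\<Sum>k\<le>j. coeff (falling_poly j) k * (deriv ^^ k) (f i) t) / exp t ^ j"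
      by (subst higher_deriv_branch[OF assms[OF i]]) (auto simp: branch_log_branch)
    also have "(\<Sum>k\<le>j. coeff (falling_poly j) k * (deriv ^^ k) (f i) t)
        = (\<Sum>k<n. coeff (falling_poly j) k * (deriv ^^ k) (f i) t)"
      using j by (intro sum.mono_neutral_left) (auto intro!: coeff_eq_0 simp: degree_falling_poly)
    finally show "(deriv ^^ j) (branch t (f i)) (exp t)
        = (\<Sum>k<n. (deriv ^^ k) (f i) t * (coeff (falling_poly j) k / exp t ^ j))"
      by (simp add: sum_divide_distrib mult.commute)
  qed
  also have "\<dots> = log_wronskian n f t * fdet n (\<lambda>k j. coeff (falling_poly j) k / exp t ^ j)"
    by (simp only: fdet_mult log_wronskian_def)
  also have "fdet n (\<lambda>k j. coeff (falling_poly j) k / exp t ^ j) = (\<Prod>j<n. 1 / exp t ^ j)"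
    by (subst fdet_upper_triangular) (auto simp: coeff_eq_0 degree_falling_poly lead_coeff_falling_poly)
  also have "\<dots> = exp (- of_nat (\<Sum>j<n. j) * t)"
  proof (induction n)
    case (Suc n)
    have "1 / exp t ^ n = exp (- of_nat n * t)"
      by (simp add: exp_minus exp_of_nat_mult inverse_eq_divide)
    thus ?case using Suc by (simp add: exp_add[symmetric] algebra_simps)
  qed auto
  finally show ?thesis by (simp add: mult.commute)
qed

lemma holomorphic_log_wronskian:
  assumes "\<And>i. i < n \<Longrightarrow> f i holomorphic_on UNIV" shows "log_wronskian n f holomorphic_on UNIV"
  unfolding log_wronskian_def[abs_def] by (intro holomorphic_fdet holomorphic_higher_deriv assms) auto

lemma log_wronskian_lincomb:
  assumes "\<And>k. k < n \<Longrightarrow> h k holomorphic_on UNIV"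
    and "\<And>i. i < n \<Longrightarrow> f i = (\<lambda>t. \<Sum>k<n. c i k * h k t)"
  shows "log_wronskian n f t = fdet n c * log_wronskian n h t"
proof -
  have "(deriv ^^ j) (f i) t = (\<Sum>k<n. c i k * (deriv ^^ j) (h k) t)" if "i < n" for i j
    unfolding assms(2)[OF that] by (subst higher_deriv_entire_lincomb) (auto intro: assms(1))
  thus ?thesis unfolding log_wronskian_def by (subst fdet_mult[symmetric]) (auto intro!: fdet_cong)
qed

section \<open>Local frames\<close>

text \<open>
  The entire function \<open>(x - exp l) / (t - l)\<close>. It is a unit near \<open>l\<close> and converts orders of vanishing in
  \<open>t\<close> into orders of vanishing in \<open>x\<close>.
\<close>

definition exp_quot :: "complex \<Rightarrow> complex \<Rightarrow> complex" where
  "exp_quot l t = (if t = l then exp l else (exp t - exp l) / (t - l))"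

lemma holomorphic_exp_quot: "exp_quot l holomorphic_on UNIV"
proof -
  have "(\<lambda>t. if t = l then deriv exp l else (exp t - exp l) / (t - l)) holomorphic_on UNIV"
    by (rule pole_lemma) (auto intro: holomorphic_intros)
  thus ?thesis unfolding exp_quot_def[abs_def] DERIV_imp_deriv[OF DERIV_exp] .
qed

lemma exp_quot_mult: "(t - l) * exp_quot l t = exp t - exp l"
  by (simp add: exp_quot_def)

lemma exp_quot_nonzero: "x \<in> half_plane l \<Longrightarrow> exp_quot l (log_branch l x) \<noteq> 0"
  using exp_log_branch[OF half_plane_nonzero, of x l] exp_quot_mult[of "log_branch l x" l]
  by (cases "x = exp l") (auto simp: exp_quot_def)

text \<open>
  The local factorization at a zero extends to the whole plane, because away from \<open>l\<close> the cofactor is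
  \<open>f t / (t - l) ^ e\<close>.
\<close>

lemma entire_factor_order:
  assumes hol: "f holomorphic_on UNIV" and "f \<noteq> (\<lambda>_. 0)"
  shows "\<exists>e v. v holomorphic_on UNIV \<and> v l \<noteq> 0 \<and> f = (\<lambda>t. (t - l) ^ e * v t)"
proof -
  define e where "e = nat (zorder f l)"
  obtain r where r: "r > 0" "zor_poly f l holomorphic_on cball l r"
    "\<And>w. w \<in> cball l r \<Longrightarrow> f w = zor_poly f l w * (w - l) ^ e" "\<And>w. w \<in> cball l r \<Longrightarrow> zor_poly f l w \<noteq> 0"
  proof -
    have nz: "\<exists>w\<in>UNIV. f w \<noteq> 0" using assms(2) by auto
    show thesis
      using conjunct2[OF zorder_exist_zero[where z = l, OF hol open_UNIV connected_UNIV UNIV_I nz]] that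
      unfolding e_def by blast
  qed
  define v where "v t = (if t = l then zor_poly f l l else f t / (t - l) ^ e)" for t
  have v: "v t = zor_poly f l t" if "t \<in> cball l r" for t
    using r(3)[OF that] by (auto simp: v_def)
  have "v holomorphic_on (ball l r)"
    using r(2) by (rule holomorphic_transform[OF holomorphic_on_subset]) (auto simp: v)
  moreover have "v holomorphic_on (- {l})"
    by (rule holomorphic_transform[of "\<lambda>t. f t / (t - l) ^ e"])
       (auto simp: v_def intro!: holomorphic_intros holomorphic_on_subset[OF hol])
  ultimately have "v holomorphic_on (ball l r \<union> - {l})"
    by (rule holomorphic_on_Un) auto
  also have "ball l r \<union> - {l} = UNIV" using r(1) by auto
  finally have "v holomorphic_on UNIV" .
  moreover have "v l \<noteq> 0" using v[of l] r(1) r(4)[of l] by simp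
  moreover have "f = (\<lambda>t. (t - l) ^ e * v t)"
    using r(1) r(3)[of l] by (auto simp: v_def fun_eq_iff)
  ultimately show ?thesis by blast
qed

text \<open>
  Since \<open>x - exp l = (t - l) exp_quot l t\<close> and the last factor is a unit near \<open>l\<close>, a power of \<open>t - l\<close> is as
  good as one of \<open>x - exp l\<close>.
\<close>

lemma zorder_branch:
  assumes "v holomorphic_on UNIV" "v l \<noteq> 0" "f = (\<lambda>t. (t - l) ^ e * v t)"
  shows "zorder (branch l f) (exp l) = int e"
proof (rule zorder_eqI[OF open_half_plane exp_in_half_plane])
  let ?g = "\<lambda>x. v (log_branch l x) / exp_quot l (log_branch l x) ^ e"
  have "(\<lambda>x. v (log_branch l x)) holomorphic_on half_plane l"
    using holomorphic_on_compose_gen[OF holomorphic_log_branch[OF order_refl] assms(1)] by (simp add: o_def)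
  moreover have "(\<lambda>x. exp_quot l (log_branch l x)) holomorphic_on half_plane l"
    using holomorphic_on_compose_gen[OF holomorphic_log_branch[OF order_refl] holomorphic_exp_quot] by (simp add: o_def)
  ultimately show "?g holomorphic_on half_plane l"
    by (intro holomorphic_intros) (auto simp: exp_quot_nonzero)
  show "?g (exp l) \<noteq> 0" using assms(2) by (simp add: exp_quot_def)
  fix x assume x: "x \<in> half_plane l"
  have "x - exp l = (log_branch l x - l) * exp_quot l (log_branch l x)"
    by (simp add: exp_quot_mult exp_log_branch half_plane_nonzero[OF x])
  thus "branch l f x = ?g x * (x - exp l) powi int e"
    using exp_quot_nonzero[OF x] by (simp add: branch_log_branch assms(3) power_mult_distrib)
qed

text \<open>
  Each derivative lowers the order by one, and the new leading coefficient is multiplied by the old order.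
\<close>

lemma higher_deriv_power_factor:
  assumes "v holomorphic_on UNIV" "j \<le> E"
  shows "\<exists>u. u holomorphic_on UNIV \<and> u l = fact E / fact (E - j) * v l \<and>
    (deriv ^^ j) (\<lambda>t. (t - l) ^ E * v t) = (\<lambda>t. (t - l) ^ (E - j) * u t)"
  using assms(2)
proof (induction j)
  case 0
  thus ?case using assms(1) by auto
next
  case (Suc j)
  then obtain u where u: "u holomorphic_on UNIV" "u l = fact E / fact (E - j) * v l"
    "(deriv ^^ j) (\<lambda>t. (t - l) ^ E * v t) = (\<lambda>t. (t - l) ^ (E - j) * u t)" by auto
  define k where "k = E - Suc j"
  have k: "E - j = Suc k" using Suc.prems by (simp add: k_def)
  let ?u = "\<lambda>t. of_nat (Suc k) * u t + (t - l) * deriv u t"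
  have "((\<lambda>t. (t - l) ^ Suc k * u t) has_field_derivative (t - l) ^ k * ?u t) (at t)" for t
  proof -
    have "(u has_field_derivative deriv u t) (at t)"
      using has_field_derivative_higher_entire[OF u(1), of 0 t] by simp
    moreover have "((\<lambda>t. t - l) has_field_derivative 1) (at t)"
      by (auto intro!: derivative_eq_intros)
    ultimately have "((\<lambda>t. (t - l) ^ Suc k * u t) has_field_derivative
        (1 + of_nat k) * (1 * (t - l) ^ k) * u t + deriv u t * (t - l) ^ Suc k) (at t)"
      by (intro DERIV_mult DERIV_power_Suc)
    also have "(1 + of_nat k) * (1 * (t - l) ^ k) * u t + deriv u t * (t - l) ^ Suc k = (t - l) ^ k * ?u t"
      by (simp add: distrib_left distrib_right mult_ac)
    finally show ?thesis .
  qed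
  hence "(deriv ^^ Suc j) (\<lambda>t. (t - l) ^ E * v t) = (\<lambda>t. (t - l) ^ k * ?u t)"
    by (auto simp: u(3) k fun_eq_iff intro!: DERIV_imp_deriv)
  moreover have "?u l = fact E / fact k * v l"
    unfolding u(2) k by (simp add: fact_Suc del: of_nat_Suc)
  moreover have "?u holomorphic_on UNIV" using u(1) by (intro holomorphic_intros) auto
  ultimately show ?case unfolding k_def by blast
qed

text \<open>
  Functions with the exponents \<open>0, \<dots>, N - 2, N - 1 + m\<close> at \<open>l\<close>. The array \<open>R\<close> is their matrix of derivatives
  with the factor \<open>(t - l) ^ m\<close> removed from the last row; what remains is triangular and invertible at \<open>l\<close>.
  Thus everything that is singular at \<open>l\<close> comes from this one factor.
\<close>

locale local_frame =
  fixes N m :: nat and l :: complex and f :: "nat \<Rightarrow> complex \<Rightarrow> complex"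
    and R :: "nat \<Rightarrow> nat \<Rightarrow> complex \<Rightarrow> complex"
  assumes N: "1 < N"
    and f_entire: "\<And>k. k < N \<Longrightarrow> f k holomorphic_on UNIV"
    and R_entire: "\<And>k j. k < N \<Longrightarrow> j < N \<Longrightarrow> R k j holomorphic_on UNIV"
    and R_row: "\<And>k j. k < N - 1 \<Longrightarrow> j < N \<Longrightarrow> R k j = (deriv ^^ j) (f k)"
    and R_last: "\<And>j t. j < N \<Longrightarrow> (deriv ^^ j) (f (N - 1)) t = (t - l) ^ m * R (N - 1) j t"
    and R_lower: "\<And>k j. k < N \<Longrightarrow> j < k \<Longrightarrow> R k j l = 0"
    and R_diag: "\<And>k. k < N \<Longrightarrow> R k k l \<noteq> 0"
begin

definition reduced_det :: "complex \<Rightarrow> complex" where "reduced_det t = fdet N (\<lambda>k j. R k j t)"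

definition reduced_cof :: "nat \<Rightarrow> nat \<Rightarrow> complex \<Rightarrow> complex" where
  "reduced_cof k j t = fcof N (\<lambda>k j. R k j t) k j"

lemma reduced_det_entire: "reduced_det holomorphic_on UNIV"
  unfolding reduced_det_def[abs_def] by (intro holomorphic_fdet R_entire)

lemma reduced_cof_entire: "k < N \<Longrightarrow> j < N \<Longrightarrow> reduced_cof k j holomorphic_on UNIV"
  unfolding reduced_cof_def[abs_def] by (intro holomorphic_fcof R_entire)

lemma reduced_det_center: "reduced_det l \<noteq> 0"
  unfolding reduced_det_def by (subst fdet_upper_triangular) (auto simp: R_lower R_diag)

lemma log_wronskian_eq: "log_wronskian N f t = (t - l) ^ m * reduced_det t"
  unfolding log_wronskian_def reduced_det_def
proof (rule fdet_mult_row[of "N - 1"])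
  show "(deriv ^^ j) (f i) t = R i j t" if "i < N" "i \<noteq> N - 1" "j < N" for i j
    using R_row[of i j] that by simp
qed (use N R_last in auto)

text \<open>
  At \<open>l\<close> the cofactors of the last column, viewed as a row vector \<open>y\<close>, satisfy that \<open>y R\<close> is a multiple of the
  last unit vector. As \<open>R\<close> is triangular there, the entries of \<open>y\<close> before the last one vanish in turn.
\<close>

lemma reduced_cof_last_column:
  assumes "k < N - 1" shows "reduced_cof k (N - 1) l = 0"
  using assms
proof (induction k rule: less_induct)
  case (less k)
  have "0 = (\<Sum>i<N. reduced_cof i (N - 1) l * R i k l)"
    unfolding reduced_cof_def using N less.prems by (subst fcof_col) auto
  also have "\<dots> = (\<Sum>i\<in>{k}. reduced_cof i (N - 1) l * R i k l)"
  proof (rule sum.mono_neutral_right)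
    show "\<forall>i\<in>{..<N} - {k}. reduced_cof i (N - 1) l * R i k l = 0"
    proof
      fix i assume "i \<in> {..<N} - {k}"
      thus "reduced_cof i (N - 1) l * R i k l = 0"
        using less by (cases "i < k") (auto simp: R_lower)
    qed
  qed (use less.prems in auto)
  finally show ?case using R_diag[of k] less.prems by simp
qed

lemma reduced_cof_last_entry: "reduced_cof (N - 1) (N - 1) l \<noteq> 0"
proof
  assume *: "reduced_cof (N - 1) (N - 1) l = 0"
  have "reduced_det l = (\<Sum>i<N. reduced_cof i (N - 1) l * R i (N - 1) l)"
    unfolding reduced_cof_def reduced_det_def using N by (subst fcof_col) auto
  also have "\<dots> = 0"
  proof (rule sum.neutral, rule ballI)
    fix i assume "i \<in> {..<N}"
    thus "reduced_cof i (N - 1) l * R i (N - 1) l = 0"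
      using * reduced_cof_last_column[of i] by (cases "i = N - 1") auto
  qed
  finally show False using reduced_det_center by simp
qed

text \<open>
  For \<open>m > 0\<close> the \<open>N\<close>-th derivative of the last function has order \<open>m - 1\<close> only, so that it takes an extra factor \<open>t - l\<close>
  to extract \<open>(t - l) ^ m\<close> from it. What is left is this function; its value at \<open>l\<close> yields the residue of the
  subleading coefficient of the fundamental operator.
\<close>

definition reduced_top :: "complex \<Rightarrow> complex" where
  "reduced_top t = of_nat m * R (N - 1) (N - 1) t + (t - l) * deriv (R (N - 1) (N - 1)) t"

lemma reduced_top_entire: "reduced_top holomorphic_on UNIV"
  unfolding reduced_top_def[abs_def] using N by (intro holomorphic_intros R_entire) auto

lemma reduced_top_eq: "(t - l) * (deriv ^^ N) (f (N - 1)) t = (t - l) ^ m * reduced_top t"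
proof -
  let ?u = "R (N - 1) (N - 1)"
  have u: "(?u has_field_derivative deriv ?u t) (at t)"
    using has_field_derivative_higher_entire[OF R_entire[of "N - 1" "N - 1"], of 0 t] N by simp
  have "(deriv ^^ (N - 1)) (f (N - 1)) = (\<lambda>t. (t - l) ^ m * ?u t)"
    using R_last[of "N - 1"] N by auto
  moreover have "(deriv ^^ N) (f (N - 1)) = deriv ((deriv ^^ (N - 1)) (f (N - 1)))"
    using N funpow.simps(2)[of "N - 1" deriv, unfolded fun_eq_iff o_apply, rule_format, of "f (N - 1)"]
    by (simp add: fun_eq_iff)
  ultimately have "(deriv ^^ N) (f (N - 1)) t = deriv (\<lambda>t. (t - l) ^ m * ?u t) t"
    by simp
  also have "\<dots> = of_nat m * (t - l) ^ (m - 1) * ?u t + (t - l) ^ m * deriv ?u t"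
    by (rule DERIV_imp_deriv) (use u in \<open>auto intro!: derivative_eq_intros\<close>)
  finally have *: "(deriv ^^ N) (f (N - 1)) t = \<dots>" .
  have **: "(t - l) * (of_nat m * (t - l) ^ (m - 1) * ?u t) = of_nat m * (t - l) ^ m * ?u t"
    by (cases m) auto
  show ?thesis unfolding * reduced_top_def distrib_left **
    by (simp only: mult_ac)
qed

text \<open>
  Cramer's rule for the reduced matrix: only the last right-hand side is divided by \<open>(t - l) ^ m\<close>.
\<close>

lemma solve_frame:
  assumes "\<And>k. k < N \<Longrightarrow> (\<Sum>j<N. e j * (deriv ^^ j) (f k) t) = \<kappa> k" and "t \<noteq> l" and j: "j < N"
  shows "reduced_det t * e j = (\<Sum>k<N - 1. reduced_cof k j t * \<kappa> k) + reduced_cof (N - 1) j t * (\<kappa> (N - 1) / (t - l) ^ m)"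
proof -
  let ?b = "\<lambda>k. if k = N - 1 then \<kappa> k / (t - l) ^ m else \<kappa> k"
  have "(\<Sum>j<N. R k j t * e j) = ?b k" if k: "k < N" for k
  proof (cases "k = N - 1")
    case True
    have "\<kappa> (N - 1) = (\<Sum>j<N. e j * (deriv ^^ j) (f (N - 1)) t)" using assms(1)[of "N - 1"] N by simp
    also have "\<dots> = (t - l) ^ m * (\<Sum>j<N. R (N - 1) j t * e j)"
      unfolding sum_distrib_left by (intro sum.cong refl) (simp only: R_last lessThan_iff mult_ac)
    finally show ?thesis using True assms(2) by simp
  next
    case False
    thus ?thesis using assms(1)[OF k] k by (simp add: R_row mult.commute)
  qed
  from fdet_cramer[OF this j] have "reduced_det t * e j = (\<Sum>k<N. reduced_cof k j t * ?b k)"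
    unfolding reduced_det_def reduced_cof_def .
  also have "\<dots> = (\<Sum>k<Suc (N - 1). reduced_cof k j t * ?b k)" using N by simp
  also have "\<dots> = (\<Sum>k<N - 1. reduced_cof k j t * \<kappa> k) + reduced_cof (N - 1) j t * (\<kappa> (N - 1) / (t - l) ^ m)"
    by (simp only: sum.lessThan_Suc if_True) simp
  finally show ?thesis .
qed

end

lemma local_frameI:
  assumes N: "1 < N" and v: "\<And>k. k < N \<Longrightarrow> v k holomorphic_on UNIV" "\<And>k. k < N \<Longrightarrow> v k l \<noteq> 0"
    and f: "\<And>k. k < N \<Longrightarrow> f k = (\<lambda>t. (t - l) ^ (if k = N - 1 then N - 1 + m else k) * v k t)"
  shows "\<exists>R. local_frame N m l f R"
proof -
  have f_hol: "f k holomorphic_on UNIV" if "k < N" for k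
    using f[OF that] v[OF that] by (auto intro!: holomorphic_intros)
  have "\<exists>u. u holomorphic_on UNIV \<and> u l \<noteq> 0 \<and>
      (deriv ^^ j) (f (N - 1)) = (\<lambda>t. (t - l) ^ (N - 1 + m - j) * u t)" if "j < N" for j
  proof -
    have "j \<le> N - 1 + m" using that by simp
    from higher_deriv_power_factor[OF v(1) this, of "N - 1" l] show ?thesis
      using N v(2)[of "N - 1"] f[of "N - 1"] by auto
  qed
  then obtain u where u: "\<And>j. j < N \<Longrightarrow> u j holomorphic_on UNIV" "\<And>j. j < N \<Longrightarrow> u j l \<noteq> 0"
    "\<And>j. j < N \<Longrightarrow> (deriv ^^ j) (f (N - 1)) = (\<lambda>t. (t - l) ^ (N - 1 + m - j) * u j t)"
    by metis
  define R where "R k j = (if k = N - 1 then \<lambda>t. (t - l) ^ (N - 1 - j) * u j t else (deriv ^^ j) (f k))" for k j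
  have vanish: "(deriv ^^ j) (f k) l = (if j = k then fact k * v k l else 0)" if "k < N - 1" "j \<le> k" for k j
  proof -
    have "k < N" using that by simp
    from higher_deriv_power_factor[OF v(1)[OF this] that(2), of l] obtain w where
      "w l = fact k / fact (k - j) * v k l" "(deriv ^^ j) (\<lambda>t. (t - l) ^ k * v k t) = (\<lambda>t. (t - l) ^ (k - j) * w t)"
      by auto
    thus ?thesis using f[OF \<open>k < N\<close>] that by (auto simp: power_0_left)
  qed
  have "local_frame N m l f R"
  proof
    show "R k j holomorphic_on UNIV" if "k < N" "j < N" for k j
      using that by (auto simp: R_def intro!: holomorphic_intros u f_hol)
    show "(deriv ^^ j) (f (N - 1)) t = (t - l) ^ m * R (N - 1) j t" if "j < N" for j t
    proof -
      have *: "N - 1 + m - j = m + (N - 1 - j)" using that by simp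
      show ?thesis unfolding u(3)[OF that] * R_def by (simp add: power_add)
    qed
    show "R k j l = 0" if "k < N" "j < k" for k j
      using that vanish[of k j] by (auto simp: R_def)
    show "R k k l \<noteq> 0" if "k < N" for k
      using that vanish[of k k] u(2)[of "N - 1"] v(2)[of k] by (auto simp: R_def)
  qed (use N f_hol in \<open>auto simp: R_def\<close>)
  thus ?thesis by blast
qed

text \<open>
  Elements of \<open>V\<close> that realize the exponents may do so for different logarithms of the same point;
  invariance under the shifts by periods of \<open>exp\<close> moves all of them to \<open>l\<close>.
\<close>

lemma local_frame_exists:
  assumes N: "1 < N"
    and entire: "\<And>f. f \<in> V \<Longrightarrow> f holomorphic_on UNIV"
    and shift: "\<And>f s. f \<in> V \<Longrightarrow> exp s = 1 \<Longrightarrow> (\<lambda>t. f (t + s)) \<in> V"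
    and ex: "exponents V (exp l) = {0..int N - 2} \<union> {int N - 1 + int m}"
  shows "\<exists>f R. (\<forall>k<N. f k \<in> V) \<and> local_frame N m l f R"
proof -
  define P where "P k f v \<longleftrightarrow> f \<in> V \<and> v holomorphic_on UNIV \<and> v l \<noteq> 0 \<and>
    f = (\<lambda>t. (t - l) ^ (if k = N - 1 then N - 1 + m else k) * v t)" for k f v
  have "\<exists>f v. P k f v" if k: "k < N" for k
  proof -
    define E where "E = (if k = N - 1 then N - 1 + m else k)"
    have "int E \<in> exponents V (exp l)" using k N by (auto simp: E_def ex)
    then obtain g l' where g: "g \<in> V" "g \<noteq> 0" "exp l' = exp l" "zorder (branch l' g) (exp l) = int E"
      unfolding exponents_def by auto
    define h where "h t = g (t + (l' - l))" for t
    have hV: "h \<in> V" unfolding h_def[abs_def] using g by (intro shift) (auto simp: exp_diff)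
    have "h \<noteq> (\<lambda>_. 0)"
    proof
      assume h0: "h = (\<lambda>_. 0)"
      have "g t = h (t - (l' - l))" for t by (simp add: h_def)
      thus False using g(2) h0 by (auto simp: fun_eq_iff)
    qed
    from entire_factor_order[OF entire[OF hV] this, of l] obtain e v where
      v: "v holomorphic_on UNIV" "v l \<noteq> 0" "h = (\<lambda>t. (t - l) ^ e * v t)" by blast
    have "branch l h = branch l' g"
      by (auto simp: branch_def h_def fun_eq_iff g(3) algebra_simps)
    with zorder_branch[OF v] g(4) have "e = E" by simp
    thus ?thesis using v hV unfolding P_def E_def by blast
  qed
  then obtain f v where P: "\<And>k. k < N \<Longrightarrow> P k (f k) (v k)" by metis
  have "\<exists>R. local_frame N m l f R"
    by (rule local_frameI[OF N, of v]) (use P in \<open>auto simp: P_def\<close>)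
  thus ?thesis using P unfolding P_def by blast
qed

section \<open>Polynomials\<close>

lemma coeff_mult_top:
  fixes p q :: "'a::comm_semiring_0 poly"
  assumes "degree p \<le> a" "degree q \<le> b"
  shows "coeff (p * q) (a + b) = coeff p a * coeff q b"
proof -
  have "coeff (p * q) (a + b) = (\<Sum>i\<le>a + b. coeff p i * coeff q (a + b - i))"
    by (simp add: coeff_mult)
  also have "\<dots> = (\<Sum>i\<in>{a}. coeff p i * coeff q (a + b - i))"
  proof (rule sum.mono_neutral_right)
    show "\<forall>i\<in>{..a + b} - {a}. coeff p i * coeff q (a + b - i) = 0"
    proof
      fix i assume "i \<in> {..a + b} - {a}"
      hence "i > a \<or> a + b - i > b" by auto
      thus "coeff p i * coeff q (a + b - i) = 0" using assms by (auto simp: coeff_eq_0)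
    qed
  qed auto
  finally show ?thesis by simp
qed

lemma poly_eq_0_of_roots:
  fixes p :: "'a::idom poly"
  assumes "inj_on r {..<N}" "\<And>k. k < N \<Longrightarrow> poly p (r k) = 0" "degree p < N"
  shows "p = 0"
proof (rule ccontr)
  assume p: "p \<noteq> 0"
  have "N = card (r ` {..<N})" using assms(1) by (simp add: card_image)
  also have "\<dots> \<le> card {x. poly p x = 0}"
    using assms(2) by (intro card_mono poly_roots_finite p) auto
  also have "\<dots> \<le> degree p" by (rule card_poly_roots_bound[OF p])
  finally show False using assms(3) by simp
qed

lemma poly_exp_eq_0:
  fixes p :: "complex poly"
  assumes "\<And>t. poly p (exp t) = 0" shows "p = 0"
proof (rule ccontr)
  assume "p \<noteq> 0"
  hence "finite {x. poly p x = 0}" by (rule poly_roots_finite)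
  moreover have "- {0} \<subseteq> {x. poly p x = 0}" using assms by (auto) (metis exp_Ln)
  ultimately have "finite (- {0 :: complex})" by (rule rev_finite_subset)
  thus False using infinite_UNIV_char_0[where 'a = complex] by simp
qed

definition lin_prod :: "nat \<Rightarrow> (nat \<Rightarrow> complex) \<Rightarrow> complex poly" where
  "lin_prod M z = (\<Prod>b<M. [:- z b, 1:])"

lemma poly_lin_prod: "poly (lin_prod M z) x = (\<Prod>b<M. x - z b)"
  by (simp add: lin_prod_def poly_prod)

lemma degree_lin_prod [simp]: "degree (lin_prod M z) = M"
  unfolding lin_prod_def by (subst degree_prod_eq_sum_degree) auto

lemma lead_coeff_lin_prod [simp]: "coeff (lin_prod M z) M = 1"
proof -
  have "lead_coeff (lin_prod M z) = 1" unfolding lin_prod_def by (subst lead_coeff_prod) auto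
  thus ?thesis by simp
qed

lemma subleading_coeff_lin_prod: "coeff (lin_prod (Suc M) z) M = - (\<Sum>b<Suc M. z b)"
proof (induction M)
  case (Suc M)
  have "lin_prod (Suc (Suc M)) z = [:- z (Suc M), 1:] * lin_prod (Suc M) z"
    by (simp add: lin_prod_def mult_ac)
  hence "coeff (lin_prod (Suc (Suc M)) z) (Suc M)
      = - z (Suc M) * coeff (lin_prod (Suc M) z) (Suc M) + coeff (lin_prod (Suc M) z) M"
    by simp
  thus ?case using Suc by simp
qed (simp add: lin_prod_def)

lemma monic_poly_of_roots:
  assumes "inj_on r {..<N}" "\<And>k. k < N \<Longrightarrow> poly p (r k) = 0" "degree p \<le> N" "coeff p N = 1"
  shows "p = lin_prod N r"
proof (cases "N = 0")
  case True
  thus ?thesis using assms(3,4) by (auto simp: lin_prod_def elim!: degree_eq_zeroE)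
next
  case False
  have "degree (p - lin_prod N r) < N"
  proof (rule degree_lessI)
    show "\<forall>k\<ge>N. coeff (p - lin_prod N r) k = 0"
    proof (intro allI impI)
      fix k assume "k \<ge> N"
      thus "coeff (p - lin_prod N r) k = 0"
        using assms(3,4) by (cases "k = N") (auto simp: coeff_eq_0)
    qed
  qed (use False in auto)
  moreover have "poly (lin_prod N r) (r k) = 0" if "k < N" for k
    using that by (auto simp: poly_lin_prod)
  ultimately have "p - lin_prod N r = 0"
    using assms(2) by (intro poly_eq_0_of_roots[OF assms(1)]) auto
  thus ?thesis by simp
qed

lemma eq_0_of_isCont:
  fixes F :: "complex \<Rightarrow> complex"
  assumes "isCont F l" "\<forall>\<^sub>F t in at l. F t = 0" shows "F l = 0"
proof -
  have "(F \<longlongrightarrow> 0) (at l)" using assms(2) by (rule tendsto_eventually)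
  thus ?thesis using assms(1) by (simp add: isCont_def LIM_unique)
qed

lemma entire_isCont: "f holomorphic_on UNIV \<Longrightarrow> isCont f t"
  using has_field_derivative_higher_entire[of f 0 t] by (auto intro: DERIV_isCont)

lemma eventually_exp_neq: "\<forall>\<^sub>F t in at l. exp t \<noteq> (x :: complex)"
proof (cases "x = exp l")
  case True
  have "((\<lambda>t. (exp t - exp l) / (t - l)) \<longlongrightarrow> exp l) (at l)"
    using DERIV_exp[of l] by (simp add: has_field_derivative_iff)
  hence "\<forall>\<^sub>F t in at l. (exp t - exp l) / (t - l) \<noteq> 0"
    by (rule tendsto_imp_eventually_ne) simp
  thus ?thesis by eventually_elim (auto simp: True)
next
  case False
  have "(exp \<longlongrightarrow> exp l) (at l)" by (intro tendsto_intros)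
  thus ?thesis by (rule tendsto_imp_eventually_ne) (use False in auto)
qed

text \<open>
  A polynomial divides another one if the quotient stays bounded at every zero of the divisor. The quotient is
  given as \<open>H / d\<close> in the coordinate \<open>t = ln x\<close>, since this is the form in which Cramer's rule supplies it.
\<close>

lemma poly_dvd_of_local_quotients:
  fixes w p :: "complex poly"
  assumes "w \<noteq> 0"
    and "\<And>x. poly w x = 0 \<Longrightarrow> \<exists>t d H. exp t = x \<and> isCont d t \<and> isCont H t \<and> d t \<noteq> 0 \<and>
           (\<forall>\<^sub>F s in at t. poly p (exp s) * d s = poly w (exp s) * H s)"
  shows "w dvd p"
  using assms
proof (induction "degree w" arbitrary: w p)
  case 0
  thus ?case by (metis is_unit_iff_degree unit_imp_dvd)
next
  case (Suc k)
  obtain x where x: "poly w x = 0"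
    using alg_closed_imp_poly_has_root[of w] Suc.hyps(2) by auto
  then obtain w' where w': "w = [:-x, 1:] * w'" by (auto simp: poly_eq_0_iff_dvd elim: dvdE)
  have w'0: "w' \<noteq> 0" using Suc.prems(1) w' by auto
  from Suc.prems(2)[OF x] obtain t d H where t: "exp t = x" "isCont d t" "isCont H t" "d t \<noteq> 0"
    "\<forall>\<^sub>F s in at t. poly p (exp s) * d s = poly w (exp s) * H s" by blast
  have "poly p (exp t) * d t - poly w (exp t) * H t = 0"
    by (rule eq_0_of_isCont[where F = "\<lambda>s. poly p (exp s) * d s - poly w (exp s) * H s"])
       (use t in \<open>auto intro!: continuous_intros\<close>)
  hence "poly p x = 0" using t x by simp
  then obtain p' where p': "p = [:-x, 1:] * p'" by (auto simp: poly_eq_0_iff_dvd elim: dvdE)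
  have "w' dvd p'"
  proof (rule Suc.hyps(1))
    show "k = degree w'" using Suc.hyps(2) w'0 unfolding w' by (subst (asm) degree_mult_eq) auto
    fix y assume "poly w' y = 0"
    hence "poly w y = 0" by (simp add: w')
    then obtain t d H where t: "exp t = y" "isCont d t" "isCont H t" "d t \<noteq> 0"
      "\<forall>\<^sub>F s in at t. poly p (exp s) * d s = poly w (exp s) * H s" using Suc.prems(2) by blast
    from t(5) eventually_exp_neq[of x t]
    have "\<forall>\<^sub>F s in at t. poly p' (exp s) * d s = poly w' (exp s) * H s"
    proof eventually_elim
      case (elim s)
      hence "(exp s - x) * (poly p' (exp s) * d s) = (exp s - x) * (poly w' (exp s) * H s)"
        by (simp add: p' w' algebra_simps)
      thus ?case using elim(2) by simp
    qed
    thus "\<exists>t d H. exp t = y \<and> isCont d t \<and> isCont H t \<and> d t \<noteq> 0 \<and>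
        (\<forall>\<^sub>F s in at t. poly p' (exp s) * d s = poly w' (exp s) * H s)" using t by blast
  qed fact
  thus ?case unfolding w' p' by (rule mult_dvd_mono[OF dvd_refl])
qed

text \<open>
  The operator \<open>x d/dx\<close> conjugated by \<open>x\<^sup>c\<close>, that is \<open>x\<^sup>-\<^sup>c (x d/dx) x\<^sup>c\<close>.
\<close>

definition twisted_euler :: "complex \<Rightarrow> complex poly \<Rightarrow> complex poly" where
  "twisted_euler c p = Polynomial.smult c p + pCons 0 (pderiv p)"

lemma coeff_twisted_euler: "coeff (twisted_euler c p) i = (c + of_nat i) * coeff p i"
  by (cases i) (auto simp: twisted_euler_def coeff_pderiv algebra_simps)

lemma coeff_twisted_euler_iter: "coeff ((twisted_euler c ^^ j) p) i = (c + of_nat i) ^ j * coeff p i"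
  by (induction j) (auto simp: coeff_twisted_euler mult_ac)

lemma degree_twisted_euler_iter: "degree ((twisted_euler c ^^ j) p) \<le> degree p"
  by (rule degree_le) (auto simp: coeff_twisted_euler_iter coeff_eq_0)

lemma higher_deriv_quasi_polynomial:
  "(deriv ^^ j) (\<lambda>t. exp (c * t) * poly p (exp t)) = (\<lambda>t. exp (c * t) * poly ((twisted_euler c ^^ j) p) (exp t))"
proof (induction j)
  case (Suc j)
  let ?q = "(twisted_euler c ^^ j) p"
  have "((\<lambda>t. exp (c * t) * poly ?q (exp t)) has_field_derivative exp (c * t) * poly (twisted_euler c ?q) (exp t)) (at t)" for t
    by (auto intro!: derivative_eq_intros simp: twisted_euler_def algebra_simps)
  thus ?case by (auto simp: Suc fun_eq_iff intro!: DERIV_imp_deriv)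
qed auto

text \<open>
  The coefficient of the highest possible power of \<open>x\<close> in the equation: \<open>x\<^sup>c p\<close> behaves like \<open>x\<^sup>c\<^sup>+\<^sup>d\<close> at
  infinity, where \<open>d\<close> is the degree of \<open>p\<close>.
\<close>

lemma top_indicial_root:
  assumes "(\<Sum>j\<le>N. C j * (twisted_euler c ^^ j) p) = 0" "\<And>j. j \<le> N \<Longrightarrow> degree (C j) \<le> D" "p \<noteq> 0"
  shows "(\<Sum>j\<le>N. coeff (C j) D * (c + of_nat (degree p)) ^ j) = 0"
proof -
  have "0 = coeff (\<Sum>j\<le>N. C j * (twisted_euler c ^^ j) p) (D + degree p)" by (simp add: assms(1))
  also have "\<dots> = (\<Sum>j\<le>N. coeff (C j) D * (c + of_nat (degree p)) ^ j * lead_coeff p)"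
    unfolding coeff_sum
    by (intro sum.cong refl) (auto simp: coeff_mult_top assms(2) degree_twisted_euler_iter coeff_twisted_euler_iter)
  finally show ?thesis using assms(3) by (simp flip: sum_distrib_right)
qed

text \<open>
  The lowest power of \<open>x\<close> in the equation: \<open>x\<^sup>c p\<close> behaves like \<open>x\<^sup>c\<close> at zero.
\<close>

lemma bottom_indicial_root:
  assumes "(\<Sum>j\<le>N. C j * (twisted_euler c ^^ j) p) = 0" "poly p 0 \<noteq> 0"
  shows "(\<Sum>j\<le>N. coeff (C j) 0 * c ^ j) = 0"
proof -
  have "0 = coeff (\<Sum>j\<le>N. C j * (twisted_euler c ^^ j) p) 0" by (simp add: assms(1))
  also have "\<dots> = (\<Sum>j\<le>N. coeff (C j) 0 * c ^ j * coeff p 0)"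
    unfolding coeff_sum by (intro sum.cong refl) (auto simp: coeff_mult_0 coeff_twisted_euler_iter mult_ac)
  finally show ?thesis using assms(2) by (simp add: poly_0_coeff_0 flip: sum_distrib_right)
qed

text \<open>
  A vector in the kernel consists of the coefficients of a polynomial of degree below \<open>N\<close> with \<open>N\<close> roots.
\<close>

lemma vandermonde_nonzero:
  fixes r :: "nat \<Rightarrow> 'a::idom"
  assumes "inj_on r {..<N}" "\<And>k. k < N \<Longrightarrow> c k \<noteq> 0"
  shows "fdet N (\<lambda>k j. r k ^ j * c k) \<noteq> 0"
proof (rule fdet_nonzeroI)
  fix e j assume e: "\<And>k. k < N \<Longrightarrow> (\<Sum>j<N. r k ^ j * c k * e j) = 0" and j: "j < N"
  let ?p = "\<Sum>j<N. monom (e j) j"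
  have "poly ?p (r k) = 0" if "k < N" for k
  proof -
    have "c k * poly ?p (r k) = (\<Sum>j<N. r k ^ j * c k * e j)"
      by (simp add: poly_sum poly_monom sum_distrib_left mult_ac)
    thus ?thesis using e[OF that] assms(2)[OF that] by simp
  qed
  moreover have "degree ?p < N" using j by (intro degree_sum_less) (auto intro: le_less_trans[OF degree_monom_le])
  ultimately have "?p = 0" by (intro poly_eq_0_of_roots[OF assms(1)])
  hence "coeff ?p j = 0" by simp
  thus "e j = 0" using j by (simp add: coeff_sum)
qed

section \<open>Finite families of functions\<close>

lemma span_family_imp_lincomb:
  assumes "f \<in> cfun.span (h ` {..<N :: nat})"
  shows "\<exists>c. f = (\<lambda>t. \<Sum>k<N. c k * h k t)"
  using assms
proof (induction rule: cfun.span_induct_alt)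
  case base
  show ?case by (rule exI[of _ "\<lambda>_. 0"]) (auto simp: fun_eq_iff)
next
  case (step c x y)
  from step(1) obtain k0 where k0: "k0 < N" "x = h k0" by auto
  from step(2) obtain d where d: "y = (\<lambda>t. \<Sum>k<N. d k * h k t)" by blast
  have "(\<lambda>t. c * x t) + y = (\<lambda>t. \<Sum>k<N. (if k = k0 then c + d k else d k) * h k t)"
  proof
    fix t
    have "(\<Sum>k<N. (if k = k0 then c + d k else d k) * h k t) = (\<Sum>k<N. (if k = k0 then c * h k t else 0) + d k * h k t)"
      by (intro sum.cong) (auto simp: algebra_simps)
    also have "\<dots> = c * h k0 t + y t" using k0(1) by (simp add: sum.distrib d)
    finally show "((\<lambda>t. c * x t) + y) t = (\<Sum>k<N. (if k = k0 then c + d k else d k) * h k t)"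
      by (simp add: k0)
  qed
  thus ?case by (rule exI[of _ "\<lambda>k. if k = k0 then c + d k else d k"])
qed

lemma lincomb_in_span:
  assumes "finite K" "\<And>k. k \<in> K \<Longrightarrow> h k \<in> cfun.span W"
  shows "(\<lambda>t. \<Sum>k\<in>K. c k * h k t) \<in> cfun.span W"
  using assms
proof (induction K rule: finite_induct)
  case empty
  have "(\<lambda>t. \<Sum>k\<in>{}. c k * h k t) = 0" by (auto simp: fun_eq_iff)
  thus ?case using cfun.span_zero by metis
next
  case (insert a K)
  have "(\<lambda>t. \<Sum>k\<in>insert a K. c k * h k t) = (\<lambda>t. c a * h a t) + (\<lambda>t. \<Sum>k\<in>K. c k * h k t)"
    using insert by (auto simp: fun_eq_iff)
  also have "\<dots> \<in> cfun.span W"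
    using insert by (intro cfun.span_add cfun.span_scale) auto
  finally show ?case .
qed

text \<open>
  Injectivity of the family is itself a case of the absence of linear relations.
\<close>

lemma is_basisI:
  assumes "\<And>c. (\<And>t. (\<Sum>k<n. c k * h k t) = 0) \<Longrightarrow> \<forall>k<n. c k = 0"
    and "cfun.span (h ` {..<n}) = W"
  shows "is_basis n h W"
proof -
  have inj: "inj_on h {..<n}"
  proof (rule inj_onI, rule ccontr)
    fix i j assume ij: "i \<in> {..<n}" "j \<in> {..<n}" "h i = h j" "i \<noteq> j"
    have "(\<Sum>k<n. (if k = i then 1 else if k = j then -1 else 0) * h k t) = 0" for t
    proof -
      have "(\<Sum>k<n. (if k = i then 1 else if k = j then -1 else 0) * h k t)
          = (\<Sum>k\<in>{i, j}. (if k = i then 1 else if k = j then -1 else 0) * h k t)"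
        using ij by (intro sum.mono_neutral_right) auto
      thus ?thesis using ij by simp
    qed
    from assms(1)[OF this] ij(1) show False by auto
  qed
  have sum_apply: "(\<Sum>v\<in>S. (\<lambda>x. u v * v x)) t = (\<Sum>v\<in>S. u v * v t)"
    for S and u :: "(complex \<Rightarrow> complex) \<Rightarrow> complex" and t
    by (induction S rule: infinite_finite_induct) auto
  have "cfun.independent (h ` {..<n})"
  proof
    assume "cfun.dependent (h ` {..<n})"
    then obtain u where u: "\<exists>v\<in>h ` {..<n}. u v \<noteq> 0" "(\<Sum>v\<in>h ` {..<n}. (\<lambda>x. u v * v x)) = 0"
      using cfun.dependent_finite[of "h ` {..<n}"] by auto
    have "(\<Sum>k<n. u (h k) * h k t) = 0" for t
    proof -
      have "(\<Sum>k<n. u (h k) * h k t) = (\<Sum>v\<in>h ` {..<n}. u v * v t)"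
        using inj by (simp add: sum.reindex)
      also have "\<dots> = (\<Sum>v\<in>h ` {..<n}. (\<lambda>x. u v * v x)) t" by (rule sum_apply[symmetric])
      also have "\<dots> = 0" by (simp add: u(2))
      finally show ?thesis .
    qed
    from assms(1)[of "\<lambda>k. u (h k)", OF this] u(1) show False by auto
  qed
  thus ?thesis using inj assms(2) by (simp add: is_basis_def)
qed

section \<open>Spaces of quasi-polynomials\<close>

locale quasi_polynomials =
  fixes N M :: nat and n m :: "nat \<Rightarrow> nat" and lam z :: "nat \<Rightarrow> complex"
    and V :: "(complex \<Rightarrow> complex) set" and p :: "nat \<Rightarrow> complex poly"
  assumes N: "1 < N" and M: "1 < M"
    and lam: "\<And>i j. i < N \<Longrightarrow> j < N \<Longrightarrow> i \<noteq> j \<Longrightarrow> lam i - lam j \<notin> \<int>"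
    and p: "\<And>i. i < N \<Longrightarrow> degree (p i) = n i" "\<And>i. i < N \<Longrightarrow> poly (p i) 0 \<noteq> 0"
    and basis: "is_basis N (\<lambda>i t. exp (lam i * t) * poly (p i) (exp t)) V"
    and z_inj: "inj_on z {..<M}" and z0: "\<And>a. a < M \<Longrightarrow> z a \<noteq> 0"
    and sing: "\<And>x. singular_point N V x \<Longrightarrow> x \<in> z ` {..<M}"
    and expo: "\<And>a. a < M \<Longrightarrow> exponents V (z a) = {0..int N - 2} \<union> {int N - 1 + int (m a)}"
begin

definition g :: "nat \<Rightarrow> complex \<Rightarrow> complex" where
  "g i = (\<lambda>t. exp (lam i * t) * poly (p i) (exp t))"

lemma V_eq: "V = cfun.span (g ` {..<N})"
  using basis unfolding is_basis_def g_def[abs_def] by blast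

lemma g_entire: "g i holomorphic_on UNIV"
proof -
  have "g i field_differentiable at t" for t
    unfolding g_def field_differentiable_def by (auto intro!: exI derivative_eq_intros)
  thus ?thesis by (simp add: holomorphic_on_def field_differentiable_at_within)
qed

lemma in_V_iff: "f \<in> V \<longleftrightarrow> (\<exists>c. f = (\<lambda>t. \<Sum>k<N. c k * g k t))"
proof
  assume "\<exists>c. f = (\<lambda>t. \<Sum>k<N. c k * g k t)"
  then obtain c where "f = (\<lambda>t. \<Sum>k<N. c k * g k t)" by blast
  moreover have "(\<lambda>t. \<Sum>k<N. c k * g k t) \<in> V"
    unfolding V_eq by (rule lincomb_in_span) (auto intro: cfun.span_base)
  ultimately show "f \<in> V" by simp
qed (auto simp: V_eq dest: span_family_imp_lincomb)

lemma g_in_V: "k < N \<Longrightarrow> g k \<in> V"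
  by (auto simp: V_eq intro: cfun.span_base)

lemma V_entire: "f \<in> V \<Longrightarrow> f holomorphic_on UNIV"
  by (auto simp: in_V_iff intro!: holomorphic_intros g_entire)

lemma V_shift:
  assumes "f \<in> V" "exp s = 1" shows "(\<lambda>t. f (t + s)) \<in> V"
proof -
  obtain c where c: "f = (\<lambda>t. \<Sum>k<N. c k * g k t)" using assms(1) by (auto simp: in_V_iff)
  have "g k (t + s) = exp (lam k * s) * g k t" for k t
    by (simp add: g_def exp_add assms(2) distrib_left mult_ac)
  hence "(\<lambda>t. f (t + s)) = (\<lambda>t. \<Sum>k<N. (c k * exp (lam k * s)) * g k t)"
    by (simp add: c mult_ac)
  thus ?thesis unfolding in_V_iff by (rule exI[of _ "\<lambda>k. c k * exp (lam k * s)"])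
qed

lemma lam_inj: "inj_on lam {..<N}"
proof (rule inj_onI)
  fix i j assume "i \<in> {..<N}" "j \<in> {..<N}" "lam i = lam j"
  thus "i = j" using lam[of i j] by auto
qed

lemma lam_n_inj: "inj_on (\<lambda>k. lam k + of_nat (n k)) {..<N}"
proof (rule inj_onI)
  fix i j assume ij: "i \<in> {..<N}" "j \<in> {..<N}" "lam i + of_nat (n i) = lam j + of_nat (n j)"
  hence "lam i - lam j = of_int (int (n j) - int (n i))" by (simp add: algebra_simps)
  hence "lam i - lam j \<in> \<int>" by simp
  thus "i = j" using lam[of i j] ij by auto
qed

definition deriv_poly :: "nat \<Rightarrow> nat \<Rightarrow> complex poly" where "deriv_poly k j = (twisted_euler (lam k) ^^ j) (p k)"

lemma higher_deriv_g: "(deriv ^^ j) (g k) t = exp (lam k * t) * poly (deriv_poly k j) (exp t)"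
  by (simp add: g_def deriv_poly_def higher_deriv_quasi_polynomial)

definition wronskian_poly :: "complex poly" where "wronskian_poly = fdet N deriv_poly"

lemma log_wronskian_g: "log_wronskian N g t = exp ((\<Sum>k<N. lam k) * t) * poly wronskian_poly (exp t)"
  by (simp add: log_wronskian_def higher_deriv_g fdet_scale_rows wronskian_poly_def poly_fdet exp_sum sum_distrib_right)

text \<open>
  At \<open>x = 0\<close> only the constant terms of the \<open>p\<^sub>i\<close> survive, which leaves a Vandermonde determinant in the
  \<open>\<lambda>\<^sub>i\<close>.
\<close>

lemma wronskian_poly_0: "poly wronskian_poly 0 \<noteq> 0"
proof -
  have "poly wronskian_poly 0 = fdet N (\<lambda>k j. poly (deriv_poly k j) 0)" by (simp only: wronskian_poly_def poly_fdet)
  also have "\<dots> = fdet N (\<lambda>k j. lam k ^ j * poly (p k) 0)"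
    by (rule fdet_cong) (simp add: deriv_poly_def poly_0_coeff_0 coeff_twisted_euler_iter)
  also have "\<dots> \<noteq> 0" by (rule vandermonde_nonzero[OF lam_inj]) (rule p(2))
  finally show ?thesis .
qed

lemma log_wronskian_in_V:
  assumes "\<And>k. k < N \<Longrightarrow> f k \<in> V"
  shows "\<exists>c. \<forall>t. log_wronskian N f t = c * log_wronskian N g t"
proof -
  have "\<forall>k. \<exists>c. k < N \<longrightarrow> f k = (\<lambda>t. \<Sum>i<N. c i * g i t)" using assms by (auto simp: in_V_iff)
  then obtain c where "\<And>k. k < N \<Longrightarrow> f k = (\<lambda>t. \<Sum>i<N. c k i * g i t)" by metis
  thus ?thesis using log_wronskian_lincomb[of N g f c] g_entire by blast
qed

text \<open>
  The Wronskian of a frame is \<open>(t - l) ^ m\<close> times a function that does not vanish at \<open>l\<close>, so it is not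
  identically zero. In other words, a frame in \<open>V\<close> is a basis of \<open>V\<close>.
\<close>

lemma frame_log_wronskian_proportional:
  assumes "\<And>k. k < N \<Longrightarrow> f k \<in> V" "local_frame N m' l f R"
  shows "\<exists>c. c \<noteq> 0 \<and> (\<forall>t. log_wronskian N f t = c * log_wronskian N g t)"
proof -
  interpret local_frame N m' l f R by fact
  obtain c where c: "\<And>t. log_wronskian N f t = c * log_wronskian N g t" using log_wronskian_in_V[of f, OF assms(1)] by blast
  have "c \<noteq> 0"
  proof
    assume "c = 0"
    hence "reduced_det t = 0" if "t \<noteq> l" for t using log_wronskian_eq[of t] c[of t] that by simp
    hence "\<forall>\<^sub>F t in at l. reduced_det t = 0" by (auto simp: eventually_at_filter)
    hence "reduced_det l = 0" by (rule eq_0_of_isCont[OF entire_isCont[OF reduced_det_entire]])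
    thus False using reduced_det_center by simp
  qed
  thus ?thesis using c by blast
qed

lemma frame_at:
  assumes "a < M" "exp l = z a"
  shows "\<exists>f R. (\<forall>k<N. f k \<in> V) \<and> local_frame N (m a) l f R"
  using assms by (intro local_frame_exists N V_entire V_shift) (auto simp: expo)

text \<open>
  A point outside the \<open>z\<^sub>a\<close> is not singular, so it carries a frame with \<open>m = 0\<close>.
\<close>

lemma log_wronskian_g_nonzero:
  assumes "exp t \<notin> z ` {..<M}" shows "log_wronskian N g t \<noteq> 0"
proof -
  have "\<not> singular_point N V (exp t)" using sing assms by blast
  hence "exponents V (exp t) = {0..int N - 1}" by (simp add: singular_point_def)
  also have "\<dots> = {0..int N - 2} \<union> {int N - 1 + int 0}" using N by auto
  finally obtain f R where f: "\<forall>k<N. f k \<in> V" "local_frame N 0 t f R"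
    using local_frame_exists[OF N V_entire V_shift] by blast
  from f(2) have "log_wronskian N f t \<noteq> 0" by (simp add: local_frame.log_wronskian_eq local_frame.reduced_det_center)
  moreover obtain c where "\<And>t. log_wronskian N f t = c * log_wronskian N g t" using log_wronskian_in_V f(1) by blast
  ultimately show ?thesis by auto
qed

lemma eventually_regular: "\<forall>\<^sub>F t in at l. exp t \<notin> z ` {..<M}"
proof -
  have "\<forall>\<^sub>F t in at l. \<forall>b\<in>{..<M}. exp t \<noteq> z b"
    by (intro eventually_ball_finite ballI eventually_exp_neq) auto
  thus ?thesis by eventually_elim auto
qed

text \<open>
  The polynomials \<open>C\<^sub>j\<close> are the coefficients of the special fundamental operator
  \<open>\<Sum>\<^sub>j C\<^sub>j(x) (x d/dx)\<^sup>j\<close> in the coordinate \<open>t\<close>.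
\<close>

definition annihilator :: "(nat \<Rightarrow> complex poly) \<Rightarrow> bool" where
  "annihilator C \<longleftrightarrow> C N = lin_prod M z \<and> (\<forall>j\<le>N. degree (C j) \<le> M) \<and>
     (\<forall>f\<in>V. \<forall>t. (\<Sum>j\<le>N. poly (C j) (exp t) * (deriv ^^ j) f t) = 0)"

lemma annihilates_V_iff:
  "(\<forall>f\<in>V. \<forall>t. (\<Sum>j\<le>N. poly (C j) (exp t) * (deriv ^^ j) f t) = 0)
    \<longleftrightarrow> (\<forall>k<N. (\<Sum>j\<le>N. C j * deriv_poly k j) = 0)" (is "?L \<longleftrightarrow> ?R")
proof
  assume L: ?L
  show ?R
  proof (intro allI impI)
    fix k assume k: "k < N"
    have "poly (\<Sum>j\<le>N. C j * deriv_poly k j) (exp t) = 0" for t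
    proof -
      have "exp (lam k * t) * poly (\<Sum>j\<le>N. C j * deriv_poly k j) (exp t)
          = (\<Sum>j\<le>N. poly (C j) (exp t) * (deriv ^^ j) (g k) t)"
        by (simp add: higher_deriv_g poly_sum sum_distrib_left mult_ac)
      also have "\<dots> = 0" using L g_in_V[OF k] by blast
      finally show ?thesis by simp
    qed
    thus "(\<Sum>j\<le>N. C j * deriv_poly k j) = 0" by (rule poly_exp_eq_0)
  qed
next
  assume R: ?R
  show ?L
  proof (intro ballI allI)
    fix f t assume "f \<in> V"
    then obtain c where c: "f = (\<lambda>t. \<Sum>k<N. c k * g k t)" by (auto simp: in_V_iff)
    have "(\<Sum>j\<le>N. poly (C j) (exp t) * (deriv ^^ j) f t)
        = (\<Sum>j\<le>N. \<Sum>k<N. c k * exp (lam k * t) * (poly (C j) (exp t) * poly (deriv_poly k j) (exp t)))"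
      unfolding c by (subst higher_deriv_entire_lincomb[OF g_entire])
        (simp add: higher_deriv_g sum_distrib_left mult_ac)
    also have "\<dots> = (\<Sum>k<N. c k * exp (lam k * t) * poly (\<Sum>j\<le>N. C j * deriv_poly k j) (exp t))"
      by (subst sum.swap) (simp add: poly_sum sum_distrib_left)
    also have "\<dots> = 0" using R by simp
    finally show "(\<Sum>j\<le>N. poly (C j) (exp t) * (deriv ^^ j) f t) = 0" .
  qed
qed

text \<open>
  If some \<open>C\<^sub>j\<close> had a degree above \<open>M\<close>, the indicial polynomial at infinity would have degree below \<open>N\<close>, because
  \<open>C\<^sub>N\<close> has degree \<open>M\<close>; but it has the \<open>N\<close> roots \<open>\<lambda>\<^sub>k + n\<^sub>k\<close>.
\<close>

lemma degree_annihilator: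
  assumes CN: "C N = lin_prod M z" and C: "\<And>k. k < N \<Longrightarrow> (\<Sum>j\<le>N. C j * deriv_poly k j) = 0" and "j \<le> N"
  shows "degree (C j) \<le> M"
proof (rule ccontr)
  assume *: "\<not> degree (C j) \<le> M"
  define D where "D = Max ((\<lambda>j. degree (C j)) ` {..N})"
  have D: "degree (C i) \<le> D" if "i \<le> N" for i unfolding D_def using that by (intro Max_ge) auto
  have "D > M" using * D[OF assms(3)] by simp
  hence CND: "coeff (C N) D = 0" by (simp add: CN coeff_eq_0)
  define q where "q = (\<Sum>j\<le>N. monom (coeff (C j) D) j)"
  have coeff_q: "coeff q j = (if j \<le> N then coeff (C j) D else 0)" for j
    by (auto simp: q_def coeff_sum)
  have "q = 0"
  proof (rule poly_eq_0_of_roots[OF lam_n_inj])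
    fix k assume k: "k < N"
    have "p k \<noteq> 0" using p(2)[OF k] by auto
    from top_indicial_root[OF C[OF k, unfolded deriv_poly_def] D this]
    show "poly q (lam k + of_nat (n k)) = 0" by (simp add: q_def poly_sum poly_monom p(1)[OF k])
  next
    show "degree q < N"
    proof (rule degree_lessI)
      show "\<forall>k\<ge>N. coeff q k = 0" using CND by (auto simp: coeff_q)
    qed (use N in auto)
  qed
  hence top: "coeff (C i) D = 0" if "i \<le> N" for i using coeff_q[of i] that by simp
  have "D \<in> (\<lambda>j. degree (C j)) ` {..N}" unfolding D_def by (intro Max_in) auto
  then obtain i where i: "i \<le> N" "D = degree (C i)" by auto
  with top[of i] have "C i = 0" by simp
  with i \<open>D > M\<close> show False by simp
qed

lemma relation_on_V:
  assumes "\<And>k. k < N \<Longrightarrow> (\<Sum>j\<le>N. e j * (deriv ^^ j) (g k) t) = 0" and "f \<in> V"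
  shows "(\<Sum>j\<le>N. e j * (deriv ^^ j) f t) = 0"
proof -
  obtain c where c: "f = (\<lambda>t. \<Sum>k<N. c k * g k t)" using assms(2) by (auto simp: in_V_iff)
  have "(\<Sum>j\<le>N. e j * (deriv ^^ j) f t) = (\<Sum>j\<le>N. \<Sum>k<N. c k * (e j * (deriv ^^ j) (g k) t))"
    unfolding c by (subst higher_deriv_entire_lincomb[OF g_entire]) (simp add: sum_distrib_left mult_ac)
  also have "\<dots> = (\<Sum>k<N. c k * (\<Sum>j\<le>N. e j * (deriv ^^ j) (g k) t))"
    by (subst sum.swap) (simp add: sum_distrib_left)
  also have "\<dots> = 0" using assms(1) by simp
  finally show ?thesis .
qed

text \<open>
  Cramer's numerators for the coefficients \<open>C\<^sub>j\<close> with \<open>j < N\<close>; the common denominator is \<open>wronskian_poly\<close>.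
\<close>

definition numer :: "nat \<Rightarrow> complex poly" where
  "numer j = - (lin_prod M z * (\<Sum>k<N. fcof N deriv_poly k j * deriv_poly k N))"

lemma numer_relation:
  assumes "k < N"
  shows "(\<Sum>j<N. deriv_poly k j * numer j) = - (lin_prod M z * (wronskian_poly * deriv_poly k N))"
proof -
  have "(\<Sum>j<N. deriv_poly k j * numer j) = (\<Sum>j<N. \<Sum>i<N. - (lin_prod M z * (deriv_poly k j * fcof N deriv_poly i j * deriv_poly i N)))"
    by (simp add: numer_def sum_distrib_left sum_negf mult_ac)
  also have "\<dots> = - (lin_prod M z * (\<Sum>i<N. (\<Sum>j<N. deriv_poly k j * fcof N deriv_poly i j) * deriv_poly i N))"
    by (subst sum.swap) (simp add: sum_distrib_left sum_distrib_right sum_negf mult_ac)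
  also have "(\<Sum>i<N. (\<Sum>j<N. deriv_poly k j * fcof N deriv_poly i j) * deriv_poly i N) = (\<Sum>i<N. if k = i then wronskian_poly * deriv_poly i N else 0)"
    using assms by (intro sum.cong refl) (simp add: fcof_row wronskian_poly_def)
  also have "\<dots> = wronskian_poly * deriv_poly k N" using assms by simp
  finally show ?thesis .
qed

lemma lin_prod_exp_factor:
  assumes "a < M" "exp l = z a"
  shows "poly (lin_prod M z) (exp t) = (t - l) * (exp_quot l t * (\<Prod>b\<in>{..<M}-{a}. exp t - z b))"
proof -
  have "poly (lin_prod M z) (exp t) = (exp t - z a) * (\<Prod>b\<in>{..<M}-{a}. exp t - z b)"
    unfolding poly_lin_prod using assms(1) by (subst prod.remove[of _ a]) auto
  also have "exp t - z a = (t - l) * exp_quot l t" by (simp add: exp_quot_mult assms(2))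
  finally show ?thesis by (simp add: mult.assoc)
qed

text \<open>
  A zero \<open>x\<close> of the Wronskian is one of the \<open>z\<^sub>a\<close>. In a local frame the last equation of the linear system has the
  right-hand side \<open>- (d/dt)\<^sup>N f / (t - l) ^ m\<close>, which has at most a simple pole. The factor \<open>x - z\<^sub>a\<close> of
  \<open>C\<^sub>N\<close> removes it.
\<close>

lemma wronskian_poly_dvd_numer:
  assumes j: "j < N" shows "wronskian_poly dvd numer j"
proof (rule poly_dvd_of_local_quotients)
  show "wronskian_poly \<noteq> 0" using wronskian_poly_0 by auto
  fix x assume x: "poly wronskian_poly x = 0"
  hence "x \<noteq> 0" using wronskian_poly_0 by auto
  define l where "l = Ln x"
  have l: "exp l = x" using \<open>x \<noteq> 0\<close> by (simp add: l_def)
  have "log_wronskian N g l = 0" by (simp add: log_wronskian_g l x)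
  hence "x \<in> z ` {..<M}" using log_wronskian_g_nonzero l by blast
  then obtain a where a: "a < M" "exp l = z a" using l by auto
  obtain f R where f: "\<And>k. k < N \<Longrightarrow> f k \<in> V" "local_frame N (m a) l f R" using frame_at[OF a] by blast
  interpret local_frame N "m a" l f R by fact
  \<comment> \<open>\<open>t - l\<close> times the right-hand side of Cramer's rule in the frame, times the rest of \<open>C\<^sub>N\<close>\<close>
  define H where "H t = - (exp_quot l t * (\<Prod>b\<in>{..<M}-{a}. exp t - z b)
      * ((t - l) * (\<Sum>k<N - 1. reduced_cof k j t * (deriv ^^ N) (f k) t) + reduced_cof (N - 1) j t * reduced_top t))" for t
  have "H holomorphic_on UNIV" unfolding H_def[abs_def] using j
    by (intro holomorphic_intros holomorphic_exp_quot reduced_cof_entire reduced_top_entire f_entire) auto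
  moreover have "\<forall>\<^sub>F t in at l. poly (numer j) (exp t) * reduced_det t = poly wronskian_poly (exp t) * H t"
    using eventually_regular[of l] eventually_neq_at_within[of l]
  proof eventually_elim
    case (elim t)
    define \<omega> where "\<omega> = poly wronskian_poly (exp t)"
    define \<pi> where "\<pi> = poly (lin_prod M z) (exp t)"
    have \<omega>: "\<omega> \<noteq> 0" using log_wronskian_g_nonzero[OF elim(1)] by (simp add: log_wronskian_g \<omega>_def)
    have \<pi>: "\<pi> \<noteq> 0" using elim(1) by (auto simp: \<pi>_def poly_lin_prod)
    define c where "c i = (if i = N then 1 else poly (numer i) (exp t) / (\<pi> * \<omega>))" for i
    have "(\<Sum>i\<le>N. c i * (deriv ^^ i) (g k) t) = 0" if k: "k < N" for k
    proof -
      have "(\<Sum>i<N. poly (deriv_poly k i) (exp t) * poly (numer i) (exp t)) = - (\<pi> * (\<omega> * poly (deriv_poly k N) (exp t)))"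
        using arg_cong[OF numer_relation[OF k], of "\<lambda>q. poly q (exp t)"]
        by (simp add: poly_sum \<pi>_def \<omega>_def)
      hence "(\<Sum>i<N. poly (numer i) (exp t) / (\<pi> * \<omega>) * poly (deriv_poly k i) (exp t)) = - poly (deriv_poly k N) (exp t)"
        using \<pi> \<omega> by (simp add: sum_divide_distrib[symmetric] mult.commute) 
      moreover have "(\<Sum>i\<le>N. c i * (deriv ^^ i) (g k) t)
          = exp (lam k * t) * ((\<Sum>i<N. poly (numer i) (exp t) / (\<pi> * \<omega>) * poly (deriv_poly k i) (exp t)) + poly (deriv_poly k N) (exp t))"
        unfolding lessThan_Suc_atMost[symmetric] sum.lessThan_Suc
        by (simp add: higher_deriv_g c_def sum_distrib_left distrib_left mult_ac)
      ultimately show ?thesis by simp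
    qed
    hence "(\<Sum>i\<le>N. c i * (deriv ^^ i) (f k) t) = 0" if "k < N" for k
      using relation_on_V f(1)[OF that] by blast
    hence "(\<Sum>i<N. c i * (deriv ^^ i) (f k) t) = - (deriv ^^ N) (f k) t" if "k < N" for k
      using that unfolding lessThan_Suc_atMost[symmetric] sum.lessThan_Suc
      by (simp add: c_def add_eq_0_iff2)
    note c_eq = solve_frame[OF this elim(2) j]
    have *: "(t - l) * (S + r * (- D / X)) = (t - l) * S - r * ((t - l) * D / X)" for S r D X
      by (simp add: distrib_left right_diff_distrib divide_inverse mult_ac)
    have "(t - l) * (reduced_det t * c j) = (t - l) * (\<Sum>k<N - 1. reduced_cof k j t * - (deriv ^^ N) (f k) t)
        - reduced_cof (N - 1) j t * ((t - l) * (deriv ^^ N) (f (N - 1)) t / (t - l) ^ m a)"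
      by (rule trans[OF arg_cong[OF c_eq, where f = "(*) (t - l)"] *])
    also have "(t - l) * (deriv ^^ N) (f (N - 1)) t / (t - l) ^ m a = reduced_top t"
      unfolding reduced_top_eq using elim(2) by simp
    finally have *: "(t - l) * (reduced_det t * c j) = - ((t - l) * (\<Sum>k<N - 1. reduced_cof k j t * (deriv ^^ N) (f k) t) + reduced_cof (N - 1) j t * reduced_top t)"
      by (simp add: sum_negf)
    have "poly (numer j) (exp t) = \<pi> * \<omega> * c j" using j \<pi> \<omega> by (simp add: c_def)
    hence "poly (numer j) (exp t) * reduced_det t = \<omega> * (exp_quot l t * (\<Prod>b\<in>{..<M}-{a}. exp t - z b) * ((t - l) * (reduced_det t * c j)))"
      unfolding \<pi>_def lin_prod_exp_factor[OF a] by simp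
    thus ?case unfolding * H_def \<omega>_def by (simp only: mult_minus_right)
  qed
  ultimately show "\<exists>t d H. exp t = x \<and> isCont d t \<and> isCont H t \<and> d t \<noteq> 0 \<and>
      (\<forall>\<^sub>F s in at t. poly (numer j) (exp s) * d s = poly wronskian_poly (exp s) * H s)"
    using l reduced_det_center entire_isCont[OF reduced_det_entire] entire_isCont by blast
qed

theorem annihilator_exists: "\<exists>C. annihilator C"
proof -
  have "\<forall>j. \<exists>c. j < N \<longrightarrow> numer j = wronskian_poly * c" using wronskian_poly_dvd_numer by (auto simp: dvd_def)
  then obtain c where c: "\<And>j. j < N \<Longrightarrow> numer j = wronskian_poly * c j" by metis
  define C where "C j = (if j = N then lin_prod M z else c j)" for j
  have *: "(\<Sum>j\<le>N. C j * deriv_poly k j) = 0" if k: "k < N" for k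
  proof -
    have "wronskian_poly * (\<Sum>j\<le>N. C j * deriv_poly k j) = (\<Sum>j<N. deriv_poly k j * numer j) + wronskian_poly * (lin_prod M z * deriv_poly k N)"
      unfolding lessThan_Suc_atMost[symmetric] sum.lessThan_Suc
      by (simp add: distrib_left sum_distrib_left C_def c mult_ac)
    also have "\<dots> = 0" by (simp add: numer_relation[OF k] mult_ac)
    finally show ?thesis using wronskian_poly_0 by auto
  qed
  have CN: "C N = lin_prod M z" by (simp add: C_def)
  show ?thesis unfolding annihilator_def annihilates_V_iff
    using CN * degree_annihilator[OF CN *] by blast
qed

context
  fixes C assumes C: "annihilator C"
begin

lemma annihilator_deriv_poly: "k < N \<Longrightarrow> (\<Sum>j\<le>N. C j * deriv_poly k j) = 0"
  using C annihilates_V_iff unfolding annihilator_def by blast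

lemma annihilator_top: "(\<Sum>j\<le>N. coeff (C j) M * u ^ j) = (\<Prod>k<N. u - lam k - of_nat (n k))"
proof -
  define q where "q = (\<Sum>j\<le>N. monom (coeff (C j) M) j)"
  have q: "coeff q j = (if j \<le> N then coeff (C j) M else 0)" for j
    by (auto simp: q_def coeff_sum)
  have "q = lin_prod N (\<lambda>k. lam k + of_nat (n k))"
  proof (rule monic_poly_of_roots[OF lam_n_inj])
    fix k assume k: "k < N"
    have "p k \<noteq> 0" using p(2)[OF k] by auto
    from top_indicial_root[OF annihilator_deriv_poly[OF k, unfolded deriv_poly_def] _ this, of M] C
    show "poly q (lam k + of_nat (n k)) = 0"
      by (simp add: q_def poly_sum poly_monom p(1)[OF k] annihilator_def)
  next
    show "degree q \<le> N" by (rule degree_le) (auto simp: q)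
    show "coeff q N = 1" using C by (simp add: q annihilator_def)
  qed
  hence "poly q u = (\<Prod>k<N. u - lam k - of_nat (n k))" by (simp add: poly_lin_prod diff_diff_eq)
  thus ?thesis by (simp add: q_def poly_sum poly_monom)
qed

lemma annihilator_bottom: "k < N \<Longrightarrow> (\<Sum>j\<le>N. coeff (C j) 0 * lam k ^ j) = 0"
  by (rule bottom_indicial_root[OF annihilator_deriv_poly[unfolded deriv_poly_def] p(2)])

text \<open>
  The indicial equation at \<open>z\<^sub>a\<close> for the exponent \<open>N - 1 + m\<^sub>a\<close>: apply the operator to the last function of the
  frame, divide by \<open>(t - l) ^ m\<^sub>a\<close> and let \<open>t\<close> tend to \<open>l\<close>. Only the derivatives of order \<open>N\<close> and \<open>N - 1\<close>
  contribute.
\<close>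

lemma annihilator_residue:
  assumes a: "a < M"
  shows "poly (C (N - 1)) (z a) = - of_nat (m a) * z a * (\<Prod>b\<in>{..<M}-{a}. z a - z b)"
proof -
  define l where "l = Ln (z a)"
  have l: "exp l = z a" using z0[OF a] by (simp add: l_def)
  obtain f R where f: "\<And>k. k < N \<Longrightarrow> f k \<in> V" "local_frame N (m a) l f R" using frame_at[OF a l] by blast
  interpret local_frame N "m a" l f R by fact
  define F where "F t = (\<Sum>j<N. poly (C j) (exp t) * R (N - 1) j t)
      + exp_quot l t * (\<Prod>b\<in>{..<M}-{a}. exp t - z b) * reduced_top t" for t
  have "F t = 0" if t: "t \<noteq> l" for t
  proof -
    have "0 = (\<Sum>j\<le>N. poly (C j) (exp t) * (deriv ^^ j) (f (N - 1)) t)"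
      using C f(1)[of "N - 1"] N by (simp add: annihilator_def)
    also have "\<dots> = (\<Sum>j<N. poly (C j) (exp t) * (deriv ^^ j) (f (N - 1)) t)
        + exp_quot l t * (\<Prod>b\<in>{..<M}-{a}. exp t - z b) * ((t - l) * (deriv ^^ N) (f (N - 1)) t)"
      unfolding lessThan_Suc_atMost[symmetric] sum.lessThan_Suc
      using C by (simp add: annihilator_def lin_prod_exp_factor[OF a l])
    also have "\<dots> = (t - l) ^ m a * F t"
      unfolding reduced_top_eq F_def distrib_left sum_distrib_left
      by (intro arg_cong2[of _ _ _ _ "(+)"] sum.cong refl) (simp_all add: R_last[simplified] mult_ac)
    finally show ?thesis using t by simp
  qed
  hence "\<forall>\<^sub>F t in at l. F t = 0" by (auto simp: eventually_at_filter)
  moreover have "F holomorphic_on UNIV"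
  proof -
    have "(\<lambda>t. poly q (exp t)) holomorphic_on UNIV" for q :: "complex poly"
      unfolding holomorphic_on_def field_differentiable_def
      by (auto intro!: exI derivative_eq_intros)
    thus ?thesis unfolding F_def[abs_def] using N
      by (intro holomorphic_intros holomorphic_exp_quot reduced_top_entire R_entire) auto
  qed
  ultimately have "F l = 0" using eq_0_of_isCont entire_isCont by blast
  moreover have "(\<Sum>j<N. poly (C j) (exp l) * R (N - 1) j l) = poly (C (N - 1)) (z a) * R (N - 1) (N - 1) l"
  proof -
    have "(\<Sum>j<N. poly (C j) (exp l) * R (N - 1) j l) = (\<Sum>j\<in>{N - 1}. poly (C j) (exp l) * R (N - 1) j l)"
      by (rule sum.mono_neutral_right) (use N R_lower[of "N - 1"] in auto)
    thus ?thesis by (simp add: l)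
  qed
  ultimately have "R (N - 1) (N - 1) l * (poly (C (N - 1)) (z a) + of_nat (m a) * z a * (\<Prod>b\<in>{..<M}-{a}. z a - z b)) = 0"
    by (simp add: F_def reduced_top_def exp_quot_def l algebra_simps)
  thus ?thesis using R_diag[of "N - 1"] N by (simp add: add_eq_0_iff2)
qed

end

text \<open>
  The Fuchs relation. The subleading coefficient \<open>C\<^sub>N\<^sub>-\<^sub>1\<close> is determined by its coefficient of \<open>x\<^sup>M\<close>,
  which is \<open>- \<Sum>(\<lambda>\<^sub>k + n\<^sub>k)\<close>, and its values at the \<open>z\<^sub>a\<close>. Its value at \<open>0\<close>, which is proportional to
  \<open>\<Sum>\<lambda>\<^sub>k\<close>, then gives a second expression for the same sum.
\<close>

theorem fuchs_relation: "(\<Sum>i<N. n i) = (\<Sum>a<M. m a)"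
proof -
  obtain C where C: "annihilator C" using annihilator_exists by blast
  obtain N' where N': "N = Suc N'" using N by (cases N) auto
  obtain M' where M': "M = Suc M'" using M by (cases M) auto
  define P' where "P' a = (\<Prod>b\<in>{..<M}-{a}. [:- z b, 1:])" for a
  have poly_P': "poly (P' a) x = (\<Prod>b\<in>{..<M}-{a}. x - z b)" for a x by (simp add: P'_def poly_prod)
  have deg_P': "degree (P' a) \<le> M'" if "a < M" for a
    unfolding P'_def using that M' by (subst degree_prod_eq_sum_degree) auto
  define s where "s = coeff (C N') M"
  \<comment> \<open>Lagrange interpolation: \<open>q\<close> has degree below \<open>M\<close> and vanishes at the \<open>M\<close> points \<open>z a\<close>\<close>
  define q where "q = C N' - Polynomial.smult s (lin_prod M z) + (\<Sum>a<M. Polynomial.smult (of_nat (m a) * z a) (P' a))"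
  have "q = 0"
  proof (rule poly_eq_0_of_roots[OF z_inj])
    fix a assume a: "a < M"
    have "poly (P' b) (z a) = 0" if "b < M" "b \<noteq> a" for b
      unfolding poly_P' using that a by (intro prod_zero) auto
    hence "(\<Sum>b<M. of_nat (m b) * z b * poly (P' b) (z a)) = (\<Sum>b<M. if b = a then of_nat (m a) * z a * poly (P' a) (z a) else 0)"
      by (intro sum.cong) auto
    also have "\<dots> = of_nat (m a) * z a * poly (P' a) (z a)" using a by simp
    finally have "poly q (z a) = poly (C N') (z a) - s * poly (lin_prod M z) (z a) + of_nat (m a) * z a * poly (P' a) (z a)"
      by (simp add: q_def poly_sum)
    also have "poly (lin_prod M z) (z a) = 0" using a by (auto simp: poly_lin_prod)
    also have "poly (C N') (z a) = - of_nat (m a) * z a * poly (P' a) (z a)"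
      using annihilator_residue[OF C a] by (simp add: N' poly_P')
    finally show "poly q (z a) = 0" by simp
  next
    show "degree q < M"
    proof (rule degree_lessI)
      show "\<forall>k\<ge>M. coeff q k = 0"
      proof (intro allI impI)
        fix k assume k: "k \<ge> M"
        have "coeff (P' a) k = 0" if "a < M" for a
          using deg_P'[OF that] k M' by (intro coeff_eq_0) auto
        hence "coeff q k = coeff (C N') k - s * coeff (lin_prod M z) k"
          by (simp add: q_def coeff_sum)
        moreover have "\<forall>j\<le>N. degree (C j) \<le> M" using C by (simp add: annihilator_def)
        hence "degree (C N') \<le> M" using N' by simp
        ultimately show "coeff q k = 0"
          using k by (cases "k = M") (auto simp: s_def coeff_eq_0)
      qed
    qed (use M in auto)
  qed
  hence "0 = poly q 0" by simp
  also have "\<dots> = poly (C N') 0 - s * (\<Prod>b<M. - z b) + (\<Sum>a<M. of_nat (m a) * z a * (\<Prod>b\<in>{..<M}-{a}. - z b))"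
    by (simp add: q_def poly_sum poly_P' poly_lin_prod)
  also have "(\<Sum>a<M. of_nat (m a) * z a * (\<Prod>b\<in>{..<M}-{a}. - z b)) = - (\<Sum>a<M. of_nat (m a)) * (\<Prod>b<M. - z b)"
    unfolding sum_negf[symmetric] sum_distrib_right
    by (intro sum.cong refl) (subst prod.remove[of "{..<M}" _ "\<lambda>b. - z b"], auto)
  finally have 1: "poly (C N') 0 = (s + (\<Sum>a<M. of_nat (m a))) * (\<Prod>b<M. - z b)"
    by (simp add: algebra_simps)
  have s: "s = - (\<Sum>k<N. lam k + of_nat (n k))"
  proof -
    have "(\<Sum>j\<le>N. monom (coeff (C j) M) j) = lin_prod N (\<lambda>k. lam k + of_nat (n k))"
      using annihilator_top[OF C] by (intro poly_eqI_degree_lead_coeff poly_ext)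
        (auto simp: poly_sum poly_monom poly_lin_prod diff_diff_eq)
    from arg_cong[OF this, of "\<lambda>q. coeff q N'"] show ?thesis
      by (simp add: s_def coeff_sum N' subleading_coeff_lin_prod del: sum.lessThan_Suc)
  qed
  have 2: "poly (C N') 0 = - (\<Prod>b<M. - z b) * (\<Sum>k<N. lam k)"
  proof -
    define c where "c = (\<Prod>b<M. - z b)"
    have c: "c \<noteq> 0" using z0 by (auto simp: c_def)
    have "coeff (lin_prod M z) 0 = c" unfolding poly_0_coeff_0[symmetric] by (simp add: poly_lin_prod c_def)
    hence cN: "coeff (C N) 0 = c" using C by (simp add: annihilator_def)
    define r where "r = (\<Sum>j\<le>N. monom (coeff (C j) 0 / c) j)"
    have r: "coeff r j = (if j \<le> N then coeff (C j) 0 / c else 0)" for j by (auto simp: r_def coeff_sum)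
    have "r = lin_prod N lam"
    proof (rule monic_poly_of_roots[OF lam_inj])
      fix k assume "k < N"
      thus "poly r (lam k) = 0" using annihilator_bottom[OF C]
        by (simp add: r_def poly_sum poly_monom sum_divide_distrib[symmetric])
    qed (use cN c in \<open>auto simp: r intro!: degree_le\<close>)
    from arg_cong[OF this, of "\<lambda>q. coeff q N'"] have "coeff (C N') 0 / c = - (\<Sum>k<N. lam k)"
      by (simp add: r N' subleading_coeff_lin_prod del: sum.lessThan_Suc)
    thus ?thesis using c by (simp add: poly_0_coeff_0 c_def[symmetric] field_simps)
  qed
  have "(\<Prod>b<M. - z b) * ((\<Sum>k<N. lam k) + (s + (\<Sum>a<M. of_nat (m a)))) = 0"
    using 1 unfolding 2 by (simp add: distrib_left distrib_right mult_ac neg_eq_iff_add_eq_0)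
  moreover have "(\<Prod>b<M. - z b) \<noteq> 0" using z0 by auto
  ultimately have "(\<Sum>k<N. lam k) + (s + (\<Sum>a<M. of_nat (m a))) = 0" by (simp only: mult_eq_0_iff) simp
  hence "(of_nat (\<Sum>k<N. n k) :: complex) = of_nat (\<Sum>a<M. m a)"
    by (simp add: s sum.distrib)
  thus ?thesis by (simp only: of_nat_eq_iff)
qed

end

section \<open>The dual space\<close>

context quasi_polynomials
begin

definition reg :: "complex set" where "reg = {t. log_wronskian N g t \<noteq> 0}"

text \<open>
  An operator \<open>E = \<Sum>\<^sub>j e\<^sub>j (d/dt)\<^sup>j\<close> of order \<open>N - 1\<close> that maps \<open>V\<close> to constants and has \<open>f\<close> as leading
  coefficient. The factor \<open>exp ((N - 1) t)\<close> arises because \<open>x\<close>- and \<open>t\<close>-Wronskians differ by a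
  power of \<open>x\<close> that depends on their size. Such operators add up and scale, so this description passes from the generators of the dual space to
  their span.
\<close>

definition symbol :: "(complex \<Rightarrow> complex) \<Rightarrow> (nat \<Rightarrow> complex \<Rightarrow> complex) \<Rightarrow> bool" where
  "symbol f e \<longleftrightarrow> (\<forall>j<N. e j holomorphic_on reg) \<and>
     (\<forall>v\<in>V. \<exists>\<kappa>. \<forall>t\<in>reg. (\<Sum>j<N. e j t * (deriv ^^ j) v t) = \<kappa>) \<and>
     (\<forall>t\<in>reg. f t = exp (of_nat (N - 1) * t) * e (N - 1) t)"

lemma open_reg: "open reg"
proof -
  have "continuous_on UNIV (log_wronskian N g)"
    by (intro holomorphic_on_imp_continuous_on holomorphic_log_wronskian g_entire)
  hence "open (log_wronskian N g -` (- {0}))" by (intro open_vimage) auto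
  also have "log_wronskian N g -` (- {0}) = reg" by (auto simp: reg_def)
  finally show ?thesis .
qed

lemma basis_log_wronskian:
  assumes "is_basis N h V"
  shows "\<And>k. k < N \<Longrightarrow> h k \<in> V"
    and "\<And>F. (\<And>k. k < N \<Longrightarrow> F k \<in> V) \<Longrightarrow> \<exists>c. \<forall>t. log_wronskian N F t = c * log_wronskian N h t"
    and "\<And>t. t \<in> reg \<Longrightarrow> log_wronskian N h t \<noteq> 0"
proof -
  have sp: "cfun.span (h ` {..<N}) = V" using assms by (simp add: is_basis_def)
  show h: "h k \<in> V" if "k < N" for k
    unfolding sp[symmetric] using that by (auto intro: cfun.span_base)
  show *: "\<exists>c. \<forall>t. log_wronskian N F t = c * log_wronskian N h t" if "\<And>k. k < N \<Longrightarrow> F k \<in> V" for F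
  proof -
    have "\<forall>k. \<exists>c. k < N \<longrightarrow> F k = (\<lambda>t. \<Sum>i<N. c i * h i t)"
      using that span_family_imp_lincomb unfolding sp[symmetric] by blast
    then obtain c where "\<And>k. k < N \<Longrightarrow> F k = (\<lambda>t. \<Sum>i<N. c k i * h i t)" by metis
    thus ?thesis using log_wronskian_lincomb[of N h F c] h V_entire by blast
  qed
  show "log_wronskian N h t \<noteq> 0" if "t \<in> reg" for t
    using *[of g] g_in_V that by (auto simp: reg_def)
qed

text \<open>
  Here \<open>E v\<close> is the Wronskian of \<open>F\<close> and \<open>v\<close> divided by that of the basis \<open>h\<close>; expansion along the row
  of \<open>v\<close> displays it as a differential operator in \<open>v\<close>. It is constant for \<open>v\<close> in \<open>V\<close> because \<open>F\<close> and \<open>v\<close> are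
  constant linear combinations of \<open>h\<close>.
\<close>

lemma generator_symbol:
  assumes F: "\<And>i. i < N - 1 \<Longrightarrow> F i \<in> V" and h: "is_basis N h V"
  shows "\<exists>e. symbol (\<lambda>t. wronskian (N - 1) F t / wronskian N h t) e \<and>
    (\<forall>v\<in>V. \<forall>t\<in>reg. (\<Sum>j<N. e j t * (deriv ^^ j) v t) = log_wronskian N (F(N - 1 := v)) t / log_wronskian N h t)"
proof -
  have zero: "(\<lambda>_. 0) \<in> V" unfolding in_V_iff by (rule exI[of _ "\<lambda>_. 0"]) auto
  \<comment> \<open>\<open>F (N - 1)\<close> is arbitrary; the cofactors along the last row are unaffected by making it zero\<close>
  define F' where "F' = F(N - 1 := (\<lambda>_. 0))"
  have F': "F' i \<in> V" if "i < N" for i using that F zero by (auto simp: F'_def)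
  define e where "e j t = fcof N (\<lambda>i j. (deriv ^^ j) (F' i) t) (N - 1) j / log_wronskian N h t" for j t
  have E: "(\<Sum>j<N. e j t * (deriv ^^ j) v t) = log_wronskian N (F(N - 1 := v)) t / log_wronskian N h t" for v t
  proof -
    have "log_wronskian N (F(N - 1 := v)) t
        = (\<Sum>j<N. (deriv ^^ j) v t * fcof N (\<lambda>i j. (deriv ^^ j) ((F(N - 1 := v)) i) t) (N - 1) j)"
      unfolding log_wronskian_def using N by (subst fdet_expand_row[of "N - 1"]) auto
    also have "\<dots> = (\<Sum>j<N. (deriv ^^ j) v t * fcof N (\<lambda>i j. (deriv ^^ j) (F' i) t) (N - 1) j)"
      using N by (intro sum.cong refl arg_cong2[of _ _ _ _ "(*)"] fcof_cong_row) (auto simp: F'_def)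
    finally show ?thesis by (simp add: e_def sum_divide_distrib mult_ac)
  qed
  have "symbol (\<lambda>t. wronskian (N - 1) F t / wronskian N h t) e"
    unfolding symbol_def
  proof (intro conjI allI impI ballI)
    fix j assume j: "j < N"
    have "log_wronskian N h holomorphic_on reg"
      using holomorphic_log_wronskian[of N h] basis_log_wronskian(1)[OF h] V_entire holomorphic_on_subset by blast
    moreover have "(\<lambda>t. fcof N (\<lambda>i j. (deriv ^^ j) (F' i) t) (N - 1) j) holomorphic_on reg"
    proof (rule holomorphic_fcof)
      show "(\<lambda>t. (deriv ^^ j) (F' i) t) holomorphic_on reg" if "i < N" for i j
        using holomorphic_higher_deriv[OF V_entire[OF F'[OF that]]] by (auto intro: holomorphic_on_subset)
    qed (use N j in auto)
    ultimately show "e j holomorphic_on reg"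
      unfolding e_def[abs_def] using basis_log_wronskian(3)[OF h] by (intro holomorphic_on_divide) auto
  next
    fix v assume v: "v \<in> V"
    have "\<exists>c. \<forall>t. log_wronskian N (F(N - 1 := v)) t = c * log_wronskian N h t"
      using F v N by (intro basis_log_wronskian(2)[OF h]) auto
    then obtain c where "\<And>t. log_wronskian N (F(N - 1 := v)) t = c * log_wronskian N h t" by blast
    thus "\<exists>\<kappa>. \<forall>t\<in>reg. (\<Sum>j<N. e j t * (deriv ^^ j) v t) = \<kappa>"
      unfolding E using basis_log_wronskian(3)[OF h] by auto
  next
    fix t assume t: "t \<in> reg"
    obtain N' where N': "N = Suc N'" using N by (cases N) auto
    have "log_wronskian N' F t = fcof N (\<lambda>i j. (deriv ^^ j) (F' i) t) N' N'"
      unfolding N' fcof_last log_wronskian_def by (rule fdet_cong) (auto simp: F'_def N')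
    hence e: "e N' t = log_wronskian N' F t / log_wronskian N h t" by (simp add: e_def N')
    have "wronskian N' F t = exp (- of_nat (\<Sum>j<N'. j) * t) * log_wronskian N' F t"
      using F N' by (intro wronskian_eq_log_wronskian V_entire) auto
    moreover have "wronskian N h t = exp (- of_nat (\<Sum>j<N. j) * t) * log_wronskian N h t"
      using basis_log_wronskian(1)[OF h] by (intro wronskian_eq_log_wronskian V_entire) auto
    moreover have "exp (- of_nat (\<Sum>j<N'. j) * t) = exp (of_nat N' * t) * exp (- of_nat (\<Sum>j<N. j) * t)"
      by (simp add: N' exp_add[symmetric] algebra_simps)
    ultimately show "wronskian (N - 1) F t / wronskian N h t = exp (of_nat (N - 1) * t) * e (N - 1) t"
      by (simp add: N' e)
  qed
  thus ?thesis using E by blast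
qed

lemma dual_space_symbol:
  assumes "f \<in> dual_space N V" shows "\<exists>e. symbol f e"
  using assms unfolding dual_space_def
proof (induction rule: cfun.span_induct_alt)
  case base
  show ?case by (rule exI[of _ "\<lambda>_ _. 0"]) (auto simp: symbol_def)
next
  case (step c x y)
  from step(1) obtain F h where "x = (\<lambda>t. wronskian (N - 1) F t / wronskian N h t)"
    "\<forall>i<N - 1. F i \<in> V" "is_basis N h V" by blast
  then obtain ex where ex: "symbol x ex" using generator_symbol[of F h] by blast
  from step(2) obtain ey where ey: "symbol y ey" by blast
  have "symbol ((\<lambda>t. c * x t) + y) (\<lambda>j t. c * ex j t + ey j t)"
    unfolding symbol_def
  proof (intro conjI allI impI ballI)
    fix v assume v: "v \<in> V"
    obtain \<kappa> where \<kappa>: "\<forall>t\<in>reg. (\<Sum>j<N. ex j t * (deriv ^^ j) v t) = \<kappa>"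
      using ex v unfolding symbol_def by blast
    obtain \<kappa>' where \<kappa>': "\<forall>t\<in>reg. (\<Sum>j<N. ey j t * (deriv ^^ j) v t) = \<kappa>'"
      using ey v unfolding symbol_def by blast
    have "(\<Sum>j<N. (c * ex j t + ey j t) * (deriv ^^ j) v t)
        = c * (\<Sum>j<N. ex j t * (deriv ^^ j) v t) + (\<Sum>j<N. ey j t * (deriv ^^ j) v t)" for t
      by (simp add: distrib_right sum.distrib mult.assoc sum_distrib_left)
    hence "\<forall>t\<in>reg. (\<Sum>j<N. (c * ex j t + ey j t) * (deriv ^^ j) v t) = c * \<kappa> + \<kappa>'"
      using \<kappa> \<kappa>' by simp
    thus "\<exists>\<kappa>. \<forall>t\<in>reg. (\<Sum>j<N. (c * ex j t + ey j t) * (deriv ^^ j) v t) = \<kappa>" by blast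
  next
    fix j assume "j < N"
    thus "(\<lambda>t. c * ex j t + ey j t) holomorphic_on reg"
      using ex ey unfolding symbol_def by (intro holomorphic_intros) auto
  next
    fix t assume "t \<in> reg"
    hence "x t = exp (of_nat (N - 1) * t) * ex (N - 1) t" "y t = exp (of_nat (N - 1) * t) * ey (N - 1) t"
      using ex ey unfolding symbol_def by blast+
    thus "((\<lambda>t. c * x t) + y) t = exp (of_nat (N - 1) * t) * (c * ex (N - 1) t + ey (N - 1) t)"
      by (simp add: algebra_simps)
  qed
  thus ?case by blast
qed

text \<open>
  Both \<open>C\<^sub>N d/dt \<circ> E\<close> and \<open>e\<^sub>N\<^sub>-\<^sub>1 \<Sum>\<^sub>j C\<^sub>j (d/dt)\<^sup>j\<close> have order \<open>N\<close>, the same leading coefficient, and kill \<open>V\<close>. Their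
  difference has order below \<open>N\<close> and kills \<open>V\<close>, so it is zero wherever the Wronskian is not.
\<close>

lemma symbol_derivative:
  assumes e: "symbol f e" and C: "annihilator C" and t: "t \<in> reg" and h: "h holomorphic_on UNIV"
  shows "\<exists>D. ((\<lambda>t. \<Sum>j<N. e j t * (deriv ^^ j) h t) has_field_derivative D) (at t) \<and>
    poly (lin_prod M z) (exp t) * D = e (N - 1) t * (\<Sum>j\<le>N. poly (C j) (exp t) * (deriv ^^ j) h t)"
proof -
  obtain N' where N': "N = Suc N'" using N by (cases N) auto
  define D where "D h = (\<Sum>j<N. deriv (e j) t * (deriv ^^ j) h t + (deriv ^^ Suc j) h t * e j t)"
    for h :: "complex \<Rightarrow> complex"
  have D: "((\<lambda>t. \<Sum>j<N. e j t * (deriv ^^ j) h t) has_field_derivative D h) (at t)"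
    if "h holomorphic_on UNIV" for h
    unfolding D_def
  proof (intro DERIV_sum DERIV_mult has_field_derivative_higher_entire that)
    fix j assume "j \<in> {..<N}"
    thus "(e j has_field_derivative deriv (e j) t) (at t)"
      using e t open_reg by (intro holomorphic_derivI[of _ reg]) (auto simp: symbol_def)
  qed
  have DV: "D v = 0" if v: "v \<in> V" for v
  proof -
    obtain \<kappa> where \<kappa>: "\<forall>t\<in>reg. (\<Sum>j<N. e j t * (deriv ^^ j) v t) = \<kappa>"
      using e v unfolding symbol_def by blast
    have "\<forall>\<^sub>F s in nhds t. (\<Sum>j<N. e j s * (deriv ^^ j) v s) = \<kappa>"
      using eventually_nhds_in_open[OF open_reg t] by eventually_elim (use \<kappa> in auto)
    hence "((\<lambda>_. \<kappa>) has_field_derivative D v) (at t)"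
      using D[OF V_entire[OF v]] by (subst (asm) DERIV_cong_ev) auto
    thus ?thesis using DERIV_unique DERIV_const by blast
  qed
  define \<pi> where "\<pi> = poly (lin_prod M z) (exp t)"
  \<comment> \<open>the coefficients of the difference of the two operators\<close>
  define y where "y j = \<pi> * (deriv (e j) t + (if j = 0 then 0 else e (j - 1) t)) - e (N - 1) t * poly (C j) (exp t)" for j
  have y: "(\<Sum>j<N. (deriv ^^ j) h t * y j) = \<pi> * D h - e (N - 1) t * (\<Sum>j\<le>N. poly (C j) (exp t) * (deriv ^^ j) h t)"
    for h
  proof -
    have "(\<Sum>j<N. (deriv ^^ Suc j) h t * e j t)
        = (\<Sum>j<N. (deriv ^^ j) h t * (if j = 0 then 0 else e (j - 1) t)) + (deriv ^^ N) h t * e (N - 1) t"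
      unfolding N' sum.lessThan_Suc[of "\<lambda>j. (deriv ^^ Suc j) h t * e j t"] sum.lessThan_Suc_shift by simp
    hence "D h = (\<Sum>j<N. (deriv ^^ j) h t * (deriv (e j) t + (if j = 0 then 0 else e (j - 1) t)))
        + (deriv ^^ N) h t * e (N - 1) t"
      by (simp add: D_def sum.distrib distrib_left mult.commute)
    moreover have "(\<Sum>j\<le>N. poly (C j) (exp t) * (deriv ^^ j) h t)
        = (\<Sum>j<N. poly (C j) (exp t) * (deriv ^^ j) h t) + \<pi> * (deriv ^^ N) h t"
      using C unfolding lessThan_Suc_atMost[symmetric] sum.lessThan_Suc
      by (simp add: annihilator_def \<pi>_def)
    ultimately show ?thesis
      by (simp add: y_def sum_distrib_left sum_subtractf right_diff_distrib distrib_left sum.distrib mult_ac)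
  qed
  have "y j = 0" if "j < N" for j
  proof (rule fdet_injective[of N "\<lambda>k j. (deriv ^^ j) (g k) t"])
    show "fdet N (\<lambda>k j. (deriv ^^ j) (g k) t) \<noteq> 0" using t by (simp add: reg_def log_wronskian_def)
    show "(\<Sum>j<N. (deriv ^^ j) (g k) t * y j) = 0" if "k < N" for k
      using C DV[OF g_in_V[OF that]] g_in_V[OF that] unfolding y annihilator_def by simp
  qed fact
  hence "\<pi> * D h = e (N - 1) t * (\<Sum>j\<le>N. poly (C j) (exp t) * (deriv ^^ j) h t)"
    using y[of h] by simp
  thus ?thesis using D[OF h] unfolding \<pi>_def by blast
qed

end

section \<open>The integral transform\<close>

lemma higher_deriv_exp_mult: "(deriv ^^ j) (\<lambda>t. exp (u * t)) = (\<lambda>t. u ^ j * exp (u * t :: complex))"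
proof (induction j)
  case (Suc j)
  have "((\<lambda>t. u ^ j * exp (u * t)) has_field_derivative u ^ Suc j * exp (u * t)) (at t)" for t
    by (auto intro!: derivative_eq_intros)
  thus ?case by (auto simp: Suc fun_eq_iff intro!: DERIV_imp_deriv)
qed auto

lemma exp_mult_entire: "(\<lambda>t. exp (u * t)) holomorphic_on UNIV"
  by (intro holomorphic_intros)

text \<open>
  One of the circles of integration. All that matters about its radius is that the closed disc contains no
  \<open>z b\<close> other than the centre and avoids the origin.
\<close>

locale transform_circle = quasi_polynomials +
  fixes a :: nat and l :: "nat \<Rightarrow> complex" and r :: "nat \<Rightarrow> real"
  assumes a: "a < M" and l: "exp (l a) = z a" and r: "r a > 0" "0 \<notin> cball (z a) (r a)"
    "\<And>b. b < M \<Longrightarrow> b \<noteq> a \<Longrightarrow> z b \<notin> cball (z a) (r a)"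
begin

lemma disc_half_plane: "x \<in> cball (z a) (r a) \<Longrightarrow> x \<in> half_plane (l a)"
  using cball_subset_half_plane[OF l r(2)] by blast

lemma exp_log_branch_disc: "x \<in> cball (z a) (r a) \<Longrightarrow> exp (log_branch (l a) x) = x"
  by (rule exp_log_branch[OF half_plane_nonzero[OF disc_half_plane]])

lemma log_branch_reg: "x \<in> cball (z a) (r a) \<Longrightarrow> x \<noteq> z a \<Longrightarrow> log_branch (l a) x \<in> reg"
  unfolding reg_def mem_Collect_eq by (rule log_wronskian_g_nonzero) (use r(3) exp_log_branch_disc in auto)

lemma sphere_disc: "x \<in> sphere (z a) (r a) \<Longrightarrow> x \<in> cball (z a) (r a) \<and> x \<noteq> z a"
  using r(1) by auto

definition integrand :: "(complex \<Rightarrow> complex) \<Rightarrow> complex \<Rightarrow> complex \<Rightarrow> complex" where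
  "integrand f u x = branch (l a) (\<lambda>t. exp (u * t)) x * branch (l a) f x
             * inverse (x ^ N) * inverse (\<Prod>b<M. x - z b)"

lemma hat_transform_eq: "hat_transform N M z l r f a u = contour_integral (circlepath (z a) (r a)) (integrand f u)"
  by (simp add: hat_transform_def integrand_def[abs_def])

lemma path_image_circle: "path_image (circlepath (z a) (r a)) = sphere (z a) (r a)"
  using r(1) by simp

lemma lin_prod_disc:
  assumes "x \<in> cball (z a) (r a)" "x \<noteq> z a" shows "(\<Prod>b<M. x - z b) \<noteq> 0"
  using assms r(3) by auto

lemma integrand_symbol:
  assumes e: "symbol f e" and x: "x \<in> cball (z a) (r a)" "x \<noteq> z a"
  shows "integrand f u x = exp (u * log_branch (l a) x) * e (N - 1) (log_branch (l a) x) / (x * (\<Prod>b<M. x - z b))"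
proof -
  have x0: "x \<noteq> 0" using half_plane_nonzero[OF disc_half_plane[OF x(1)]] .
  have "f (log_branch (l a) x) = exp (of_nat (N - 1) * log_branch (l a) x) * e (N - 1) (log_branch (l a) x)"
    using e log_branch_reg[OF x] unfolding symbol_def by blast
  also have "exp (of_nat (N - 1) * log_branch (l a) x) = x ^ (N - 1)"
    unfolding exp_of_nat_mult exp_log_branch_disc[OF x(1)] by (rule refl)
  finally have "f (log_branch (l a) x) = x ^ (N - 1) * e (N - 1) (log_branch (l a) x)" .
  moreover have "x ^ N = x * x ^ (N - 1)" using N by (simp add: power_eq_if)
  ultimately show ?thesis using x0 by (simp add: integrand_def branch_log_branch field_simps)
qed

lemma integrand_integrable:
  assumes e: "symbol f e"
  shows "integrand f u contour_integrable_on circlepath (z a) (r a)"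
proof (rule contour_integrable_continuous_circlepath)
  have cont_log: "continuous_on (sphere (z a) (r a)) (log_branch (l a))"
    using disc_half_plane sphere_disc by (intro holomorphic_on_imp_continuous_on holomorphic_log_branch) blast
  have "continuous_on reg (e (N - 1))"
    using e N by (intro holomorphic_on_imp_continuous_on) (auto simp: symbol_def)
  hence "continuous_on (sphere (z a) (r a)) (\<lambda>x. e (N - 1) (log_branch (l a) x))"
    by (rule continuous_on_compose2[OF _ cont_log]) (use log_branch_reg sphere_disc in blast)
  hence "continuous_on (sphere (z a) (r a))
      (\<lambda>x. exp (u * log_branch (l a) x) * e (N - 1) (log_branch (l a) x) / (x * (\<Prod>b<M. x - z b)))"
    using lin_prod_disc sphere_disc half_plane_nonzero[OF disc_half_plane]
    by (intro continuous_intros cont_log) (simp_all, blast?)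
  thus "continuous_on (path_image (circlepath (z a) (r a))) (integrand f u)"
    unfolding path_image_circle
    by (rule continuous_on_eq) (use integrand_symbol[OF e] sphere_disc in auto)
qed

text \<open>
  The sum of the integrands is the derivative along the circle of \<open>E\<close> applied to \<open>x\<^sup>u\<close>, and the circle is a closed
  path that stays in the domain of the branch.
\<close>

theorem hat_recurrence:
  assumes f: "f \<in> dual_space N V" and C: "annihilator C"
  shows "(\<Sum>i\<le>M. \<Sum>j\<le>N. coeff (C j) i * u ^ j * hat_transform N M z l r f a (u + of_nat i)) = 0"
proof -
  obtain e where e: "symbol f e" using dual_space_symbol[OF f] by blast
  define G where "G t = (\<Sum>j<N. e j t * (deriv ^^ j) (\<lambda>t. exp (u * t)) t)" for t
  define K where "K x = (\<Sum>i\<le>M. \<Sum>j\<le>N. coeff (C j) i * u ^ j * integrand f (u + of_nat i) x)" for x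
  have "((\<lambda>x. G (log_branch (l a) x)) has_field_derivative K x) (at x within sphere (z a) (r a))"
    if "x \<in> sphere (z a) (r a)" for x
  proof -
    have x: "x \<in> cball (z a) (r a)" "x \<noteq> z a" using sphere_disc[OF that] by auto
    define t where "t = log_branch (l a) x"
    define \<pi> where "\<pi> = (\<Prod>b<M. x - z b)"
    have [simp]: "exp t = x" using exp_log_branch_disc[OF x(1)] by (simp add: t_def)
    have x0: "x \<noteq> 0" using half_plane_nonzero[OF disc_half_plane[OF x(1)]] .
    have \<pi>: "\<pi> \<noteq> 0" using lin_prod_disc[OF x] by (simp add: \<pi>_def)
    obtain D where D: "(G has_field_derivative D) (at t)"
      "\<pi> * D = e (N - 1) t * (\<Sum>j\<le>N. poly (C j) x * (u ^ j * exp (u * t)))"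
      using symbol_derivative[OF e C log_branch_reg[OF x] exp_mult_entire[of u]]
      by (auto simp: G_def[abs_def] higher_deriv_exp_mult poly_lin_prod t_def[symmetric] \<pi>_def)
    have "((\<lambda>x. G (log_branch (l a) x)) has_field_derivative D * (1 / x)) (at x)"
      using D(1) unfolding t_def by (rule DERIV_chain2) (rule has_field_derivative_log_branch[OF disc_half_plane[OF x(1)]])
    moreover have "D * (1 / x) = K x"
    proof -
      have "poly (C j) x = (\<Sum>i\<le>M. coeff (C j) i * x ^ i)" if "j \<le> N" for j
      proof -
        have "degree (C j) \<le> M" using C that by (simp add: annihilator_def)
        thus ?thesis unfolding poly_altdef by (intro sum.mono_neutral_left) (auto simp: coeff_eq_0)
      qed
      hence "\<pi> * D = e (N - 1) t * (\<Sum>j\<le>N. \<Sum>i\<le>M. coeff (C j) i * u ^ j * (exp (u * t) * x ^ i))"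
        unfolding D(2)
        by (intro arg_cong2[of _ _ _ _ "(*)"] sum.cong refl) (simp add: sum_distrib_left sum_distrib_right mult_ac)
      also have "\<dots> = e (N - 1) t * (\<Sum>i\<le>M. \<Sum>j\<le>N. coeff (C j) i * u ^ j * (exp (u * t) * x ^ i))"
        by (subst sum.swap) (rule refl)
      finally have "D * (1 / x) = e (N - 1) t * (\<Sum>i\<le>M. \<Sum>j\<le>N. coeff (C j) i * u ^ j * (exp (u * t) * x ^ i)) / (x * \<pi>)"
        using \<pi> x0 by (simp add: field_simps)
      also have "\<dots> = (\<Sum>i\<le>M. \<Sum>j\<le>N. coeff (C j) i * u ^ j * (exp (u * t) * x ^ i * e (N - 1) t / (x * \<pi>)))"
        by (simp add: sum_distrib_left sum_divide_distrib mult_ac)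
      also have "\<dots> = K x"
        unfolding K_def
      proof (intro sum.cong refl arg_cong2[of _ _ _ _ "(*)"])
        fix i
        have "exp ((u + of_nat i) * t) = exp (u * t) * x ^ i"
          by (simp add: distrib_right exp_add exp_of_nat_mult)
        thus "exp (u * t) * x ^ i * e (N - 1) t / (x * \<pi>) = integrand f (u + of_nat i) x"
          unfolding integrand_symbol[OF e x] t_def[symmetric] \<pi>_def[symmetric] by simp
      qed
      finally show ?thesis .
    qed
    ultimately show ?thesis by (simp add: has_field_derivative_at_within)
  qed
  hence "(K has_contour_integral (G (log_branch (l a) (pathfinish (circlepath (z a) (r a))))
      - G (log_branch (l a) (pathstart (circlepath (z a) (r a)))))) (circlepath (z a) (r a))"
    by (rule contour_integral_primitive) (use r(1) in auto)
  hence "contour_integral (circlepath (z a) (r a)) K = 0"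
    by (simp add: contour_integral_unique)
  moreover have "contour_integral (circlepath (z a) (r a)) K
      = (\<Sum>i\<le>M. \<Sum>j\<le>N. coeff (C j) i * u ^ j * hat_transform N M z l r f a (u + of_nat i))"
    unfolding K_def[abs_def] hat_transform_eq
    by (simp add: contour_integral_sum contour_integral_lmul contour_integrable_sum
        contour_integrable_lmul integrand_integrable[OF e])
  ultimately show ?thesis by simp
qed

text \<open>
  By Cramer's rule in a frame at \<open>z\<^sub>a\<close>, the integrand is \<open>S / (x - z\<^sub>a) + \<kappa> T / (x - z\<^sub>a)\<^sup>m\<^sup>+\<^sup>1\<close>, where \<open>S\<close> vanishes at
  \<open>z\<^sub>a\<close>, while \<open>T\<close> is \<open>x\<^sup>u\<close> times a function \<open>B\<close> with \<open>B(z\<^sub>a) \<noteq> 0\<close> that is the same for all \<open>f\<close>, and \<open>\<kappa>\<close> is the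
  value of \<open>E\<close> on the last function of the frame. The \<open>m\<close>-th derivative of \<open>T\<close> at \<open>z\<^sub>a\<close> is \<open>z\<^sub>a\<^sup>u\<close> times a
  polynomial in \<open>u\<close> of degree \<open>m\<close>.
\<close>

theorem hat_transform_form:
  "\<exists>q. q \<noteq> 0 \<and> degree q = m a \<and>
     (\<forall>f\<in>dual_space N V. \<exists>\<alpha>. hat_transform N M z l r f a = (\<lambda>u. \<alpha> * (exp (u * l a) * poly q u))) \<and>
     (\<exists>f\<in>dual_space N V. \<exists>\<alpha>. \<alpha> \<noteq> 0 \<and> hat_transform N M z l r f a = (\<lambda>u. \<alpha> * (exp (u * l a) * poly q u)))"
proof -
  obtain f R where f: "\<And>k. k < N \<Longrightarrow> f k \<in> V" "local_frame N (m a) (l a) f R" using frame_at[OF a l] by blast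
  interpret local_frame N "m a" "l a" f R by fact
  let ?D = "cball (z a) (r a)" and ?t = "log_branch (l a)"
  define P' where "P' x = (\<Prod>b\<in>{..<M}-{a}. x - z b)" for x
  have za: "z a \<in> ?D" using r(1) by simp
  have t_za [simp]: "?t (z a) = l a" using log_branch_exp[of "l a"] by (simp add: l)
  have D0: "x \<noteq> 0" if "x \<in> ?D" for x using half_plane_nonzero[OF disc_half_plane[OF that]] .
  have P'0: "P' x \<noteq> 0" if "x \<in> ?D" for x using that r(3) by (auto simp: P'_def)
  have reduced_det0: "reduced_det (?t x) \<noteq> 0" if "x \<in> ?D" for x
  proof (cases "x = z a")
    case False
    obtain c where "c \<noteq> 0" "\<And>t. log_wronskian N f t = c * log_wronskian N g t" using frame_log_wronskian_proportional[OF f] by blast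
    with log_branch_reg[OF that False] have "log_wronskian N f (?t x) \<noteq> 0" by (simp add: reg_def)
    thus ?thesis by (auto simp: log_wronskian_eq)
  qed (simp add: reduced_det_center)
  have comp: "(\<lambda>x. v (?t x)) holomorphic_on ?D" if "v holomorphic_on UNIV" for v
  proof -
    have "?t holomorphic_on ?D" by (intro holomorphic_log_branch subsetI disc_half_plane)
    from holomorphic_on_compose_gen[OF this that] show ?thesis by (simp add: o_def)
  qed
  define Q where "Q x = 1 / (x * P' x * reduced_det (?t x))" for x
  have Q: "Q holomorphic_on ?D"
    unfolding Q_def[abs_def] P'_def[abs_def] using D0 P'0 reduced_det0
    by (intro holomorphic_intros comp reduced_det_entire) (auto simp: P'_def)
  define B where "B x = Q x * reduced_cof (N - 1) (N - 1) (?t x) * exp_quot (l a) (?t x) ^ m a" for x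
  have B: "B holomorphic_on ?D"
    unfolding B_def[abs_def] using N
    by (intro holomorphic_intros Q comp reduced_cof_entire holomorphic_exp_quot) auto
  have "B (z a) \<noteq> 0"
    using D0[OF za] P'0[OF za] reduced_det_center reduced_cof_last_entry
    by (simp add: B_def Q_def exp_quot_def)
  define c where "c i = of_nat (m a choose i) * (deriv ^^ (m a - i)) B (z a) / z a ^ i" for i
  define q where "q = (\<Sum>i\<le>m a. Polynomial.smult (c i) (falling_poly i))"
  have coeff_q: "coeff q (m a) \<noteq> 0"
  proof -
    have "coeff q (m a) = (\<Sum>i\<le>m a. c i * coeff (falling_poly i) (m a))"
      by (simp add: q_def coeff_sum)
    also have "\<dots> = (\<Sum>i\<in>{m a}. c i * coeff (falling_poly i) (m a))"
      by (intro sum.mono_neutral_right) (auto intro!: coeff_eq_0 simp: degree_falling_poly)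
    finally show ?thesis using \<open>B (z a) \<noteq> 0\<close> D0[OF za] by (simp add: lead_coeff_falling_poly c_def)
  qed
  have deg_q: "degree q = m a"
  proof (rule antisym)
    show "degree q \<le> m a" unfolding q_def
      by (intro degree_sum_le) (auto intro: order_trans[OF degree_smult_le] simp: degree_falling_poly)
    show "m a \<le> degree q" using coeff_q by (rule le_degree)
  qed
  have main: "hat_transform N M z l r fd a u = \<kappa> (N - 1) * (2 * pi * \<i> / fact (m a)) * (exp (u * l a) * poly q u)"
    if e: "symbol fd e" and \<kappa>: "\<And>k t. k < N \<Longrightarrow> t \<in> reg \<Longrightarrow> (\<Sum>j<N. e j t * (deriv ^^ j) (f k) t) = \<kappa> k"
    for fd e \<kappa> u
  proof -
    define S where "S x = exp (u * ?t x) * (Q x * (\<Sum>k<N - 1. reduced_cof k (N - 1) (?t x) * \<kappa> k))" for x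
    define T where "T x = exp (u * ?t x) * B x" for x
    have expu: "(\<lambda>x. exp (u * ?t x)) holomorphic_on ?D"
      using comp[OF exp_mult_entire[of u]] by simp
    have S: "S holomorphic_on ?D"
      unfolding S_def[abs_def] using N by (intro holomorphic_intros expu Q comp reduced_cof_entire) auto
    have T: "T holomorphic_on ?D"
      unfolding T_def[abs_def] by (intro holomorphic_intros expu B)
    have "(\<Sum>k<N - 1. reduced_cof k (N - 1) (l a) * \<kappa> k) = 0"
      by (rule sum.neutral) (use reduced_cof_last_column in auto)
    hence "S (z a) = 0" by (simp add: S_def)
    have int: "integrand fd u x = S x / (x - z a) ^ Suc 0 + \<kappa> (N - 1) * (T x / (x - z a) ^ Suc (m a))"
      if x: "x \<in> ?D" "x \<noteq> z a" for x
    proof -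
      define t where "t = ?t x"
      have t: "t \<in> reg" using log_branch_reg[OF x] by (simp add: t_def)
      have et: "exp t = x" using exp_log_branch_disc[OF x(1)] by (simp add: t_def)
      have tl: "t \<noteq> l a" using x(2) et l by auto
      have *: "x - z a = (t - l a) * exp_quot (l a) t" by (simp add: exp_quot_mult et l)
      have E0: "exp_quot (l a) t \<noteq> 0" using * x(2) by auto
      have "reduced_det t * e (N - 1) t = (\<Sum>k<N - 1. reduced_cof k (N - 1) t * \<kappa> k)
          + reduced_cof (N - 1) (N - 1) t * (\<kappa> (N - 1) / (t - l a) ^ m a)"
        by (rule solve_frame[of "\<lambda>j. e j t"]) (use \<kappa> t tl N in auto)
      also have "\<kappa> (N - 1) / (t - l a) ^ m a = \<kappa> (N - 1) * exp_quot (l a) t ^ m a / (x - z a) ^ m a"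
        using E0 by (simp add: * power_mult_distrib)
      finally have e1: "e (N - 1) t = ((\<Sum>k<N - 1. reduced_cof k (N - 1) t * \<kappa> k)
          + reduced_cof (N - 1) (N - 1) t * (\<kappa> (N - 1) * exp_quot (l a) t ^ m a / (x - z a) ^ m a)) / reduced_det t"
        using reduced_det0[OF x(1)] by (simp add: t_def field_simps)
      have "(\<Prod>b<M. x - z b) = (x - z a) * P' x"
        unfolding P'_def using a by (subst prod.remove[of _ a]) auto
      hence "integrand fd u x = exp (u * t) * (Q x * (reduced_det t * e (N - 1) t)) / (x - z a)"
        unfolding integrand_symbol[OF e x] t_def[symmetric]
        using reduced_det0[OF x(1)] by (simp add: Q_def t_def mult_ac)
      also have "reduced_det t * e (N - 1) t = (\<Sum>k<N - 1. reduced_cof k (N - 1) t * \<kappa> k)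
          + reduced_cof (N - 1) (N - 1) t * (\<kappa> (N - 1) * exp_quot (l a) t ^ m a / (x - z a) ^ m a)"
        unfolding e1 using reduced_det0[OF x(1)] by (simp add: t_def)
      finally show ?thesis
        unfolding S_def T_def B_def t_def[symmetric] using x(2)
        by (simp add: distrib_left add_divide_distrib mult_ac)
    qed
    have "((\<lambda>x. S x / (x - z a) ^ Suc 0) has_contour_integral (2 * pi * \<i> / fact 0 * (deriv ^^ 0) S (z a))) (circlepath (z a) (r a))"
      using S r(1) by (intro Cauchy_has_contour_integral_higher_derivative_circlepath
          holomorphic_on_imp_continuous_on) (auto intro: holomorphic_on_subset)
    moreover have "((\<lambda>x. T x / (x - z a) ^ Suc (m a)) has_contour_integral (2 * pi * \<i> / fact (m a) * (deriv ^^ m a) T (z a))) (circlepath (z a) (r a))"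
      using T r(1) by (intro Cauchy_has_contour_integral_higher_derivative_circlepath
          holomorphic_on_imp_continuous_on) (auto intro: holomorphic_on_subset)
    ultimately have "((\<lambda>x. S x / (x - z a) ^ Suc 0 + \<kappa> (N - 1) * (T x / (x - z a) ^ Suc (m a))) has_contour_integral
        (2 * pi * \<i> / fact 0 * (deriv ^^ 0) S (z a) + \<kappa> (N - 1) * (2 * pi * \<i> / fact (m a) * (deriv ^^ m a) T (z a)))) (circlepath (z a) (r a))"
      by (intro has_contour_integral_add has_contour_integral_lmul)
    hence "(integrand fd u has_contour_integral
        (2 * pi * \<i> / fact 0 * (deriv ^^ 0) S (z a) + \<kappa> (N - 1) * (2 * pi * \<i> / fact (m a) * (deriv ^^ m a) T (z a)))) (circlepath (z a) (r a))"
      by (rule has_contour_integral_eq) (use int sphere_disc r(1) in auto)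
    hence "hat_transform N M z l r fd a u = \<kappa> (N - 1) * (2 * pi * \<i> / fact (m a) * (deriv ^^ m a) T (z a))"
      by (simp add: hat_transform_eq contour_integral_unique \<open>S (z a) = 0\<close>)
    also have "(deriv ^^ m a) T (z a) = (\<Sum>i = 0..m a. of_nat (m a choose i)
        * (deriv ^^ i) (\<lambda>x. exp (u * ?t x)) (z a) * (deriv ^^ (m a - i)) B (z a))"
      unfolding T_def[abs_def] using expu B r(1)
      by (intro higher_deriv_mult[of _ "ball (z a) (r a)"]) (auto intro: holomorphic_on_subset)
    also have "\<dots> = (\<Sum>i\<le>m a. exp (u * l a) * (c i * poly (falling_poly i) u))"
    proof (intro sum.cong)
      fix i assume "i \<in> {..m a}"
      have "(deriv ^^ i) (\<lambda>x. exp (u * ?t x)) (z a) = (deriv ^^ i) (branch (l a) (\<lambda>t. exp (u * t))) (z a)"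
        by (simp add: branch_log_branch[abs_def])
      also have "\<dots> = (\<Sum>j\<le>i. coeff (falling_poly i) j * (u ^ j * exp (u * l a))) / z a ^ i"
        by (subst higher_deriv_branch[OF exp_mult_entire disc_half_plane[OF za]])
           (simp add: higher_deriv_exp_mult branch_log_branch)
      also have "\<dots> = exp (u * l a) * poly (falling_poly i) u / z a ^ i"
        by (simp add: poly_altdef degree_falling_poly sum_distrib_left mult_ac)
      finally show "of_nat (m a choose i) * (deriv ^^ i) (\<lambda>x. exp (u * ?t x)) (z a) * (deriv ^^ (m a - i)) B (z a)
          = exp (u * l a) * (c i * poly (falling_poly i) u)"
        by (simp add: c_def mult_ac)
    qed auto
    also have "\<dots> = exp (u * l a) * poly q u"
      by (simp add: q_def poly_sum sum_distrib_left)
    finally show ?thesis by simp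
  qed
  have "\<exists>\<alpha>. hat_transform N M z l r fd a = (\<lambda>u. \<alpha> * (exp (u * l a) * poly q u))"
    if fd: "fd \<in> dual_space N V" for fd
  proof -
    obtain e where e: "symbol fd e" using dual_space_symbol[OF fd] by blast
    have "\<forall>k. \<exists>\<kappa>. k < N \<longrightarrow> (\<forall>t\<in>reg. (\<Sum>j<N. e j t * (deriv ^^ j) (f k) t) = \<kappa>)"
      using e f(1) unfolding symbol_def by blast
    then obtain \<kappa> where "\<And>k t. k < N \<Longrightarrow> t \<in> reg \<Longrightarrow> (\<Sum>j<N. e j t * (deriv ^^ j) (f k) t) = \<kappa> k" by metis
    from main[OF e this] show ?thesis by blast
  qed
  moreover have "\<exists>fd\<in>dual_space N V. \<exists>\<alpha>. \<alpha> \<noteq> 0 \<and> hat_transform N M z l r fd a = (\<lambda>u. \<alpha> * (exp (u * l a) * poly q u))"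
  proof -
    have g: "is_basis N g V" using basis by (simp add: g_def[abs_def])
    \<comment> \<open>omitting the last function of the frame makes \<open>\<kappa> (N - 1)\<close> a ratio of two Wronskians of bases\<close>
    define fd where "fd = (\<lambda>t. wronskian (N - 1) f t / wronskian N g t)"
    have fd: "fd \<in> dual_space N V"
      unfolding dual_space_def
    proof (intro cfun.span_base CollectI exI conjI)
      show "fd = (\<lambda>t. wronskian (N - 1) f t / wronskian N g t)" by (rule fd_def)
    qed (use f(1) g in auto)
    obtain e where e: "symbol fd e"
      "\<And>v t. v \<in> V \<Longrightarrow> t \<in> reg \<Longrightarrow> (\<Sum>j<N. e j t * (deriv ^^ j) v t) = log_wronskian N (f(N - 1 := v)) t / log_wronskian N g t"
      using generator_symbol[of f g] f(1) g unfolding fd_def by auto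
    obtain c where c: "c \<noteq> 0" "\<And>t. log_wronskian N f t = c * log_wronskian N g t" using frame_log_wronskian_proportional[OF f] by blast
    have "\<forall>k. \<exists>\<kappa>. k < N \<longrightarrow> (\<forall>t\<in>reg. (\<Sum>j<N. e j t * (deriv ^^ j) (f k) t) = \<kappa>)"
      using e(1) f(1) unfolding symbol_def by blast
    then obtain \<kappa> where \<kappa>: "\<And>k t. k < N \<Longrightarrow> t \<in> reg \<Longrightarrow> (\<Sum>j<N. e j t * (deriv ^^ j) (f k) t) = \<kappa> k" by metis
    obtain t where t: "t \<in> reg"
    proof -
      have "z a + of_real (r a) \<in> sphere (z a) (r a)" using r(1) by (simp add: dist_norm)
      thus thesis using that log_branch_reg sphere_disc by blast
    qed
    have "\<kappa> (N - 1) = log_wronskian N (f(N - 1 := f (N - 1))) t / log_wronskian N g t"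
      using \<kappa>[of "N - 1" t] e(2)[of "f (N - 1)" t] f(1)[of "N - 1"] N t by simp
    also have "\<dots> = c" using t by (simp add: c(2) reg_def)
    finally have "\<kappa> (N - 1) \<noteq> 0" using c(1) by simp
    hence "\<kappa> (N - 1) * (2 * pi * \<i> / fact (m a)) \<noteq> 0" by simp
    thus ?thesis using main[OF e(1) \<kappa>] fd by blast
  qed
  moreover have "q \<noteq> 0" using coeff_q by auto
  ultimately show ?thesis using deg_q by (intro exI[of _ q]) blast
qed

end

section \<open>Exponential polynomials\<close>

lemma poly_eq_0_of_nat_zeros:
  fixes p :: "complex poly"
  assumes "\<And>j :: nat. poly p (of_nat j) = 0" shows "p = 0"
proof (rule ccontr)
  assume "p \<noteq> 0"
  hence "finite {x. poly p x = 0}" by (rule poly_roots_finite)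
  moreover have "range (of_nat :: nat \<Rightarrow> complex) \<subseteq> {x. poly p x = 0}" using assms by auto
  ultimately have "finite (range (of_nat :: nat \<Rightarrow> complex))" by (rule rev_finite_subset)
  moreover have "infinite (range (of_nat :: nat \<Rightarrow> complex))" by (simp add: finite_image_iff inj_on_def)
  ultimately show False by blast
qed

definition translate_poly :: "complex poly \<Rightarrow> complex poly" where
  "translate_poly p = pcompose p [:1, 1:]"

lemma poly_translate: "poly (translate_poly p) x = poly p (x + 1)"
  by (simp add: translate_poly_def poly_pcompose add.commute)

lemma degree_translate_poly: "degree (translate_poly p) = degree p"
  by (simp add: translate_poly_def degree_pcompose)

lemma lead_coeff_translate_poly: "coeff (translate_poly p) (degree p) = lead_coeff p"
proof -
  have "lead_coeff (translate_poly p) = lead_coeff p" unfolding translate_poly_def by (subst lead_coeff_comp) auto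
  thus ?thesis by (simp add: degree_translate_poly)
qed

text \<open>
  For fixed \<open>b\<close> in \<open>A\<close>, the difference operator \<open>\<tau> - z b\<close> lowers the degree of \<open>Q b\<close> and multiplies the leading
  coefficient of every other \<open>Q a\<close> by \<open>z a - z b \<noteq> 0\<close>. So induction on the degree of \<open>Q b\<close> removes this
  term.
\<close>

lemma exponential_polynomial_eq_0:
  fixes z :: "'a \<Rightarrow> complex"
  assumes "finite A" "inj_on z A" "\<And>a. a \<in> A \<Longrightarrow> z a \<noteq> 0"
    and "\<And>j :: nat. (\<Sum>a\<in>A. z a ^ j * poly (Q a) (of_nat j)) = 0"
  shows "\<forall>a\<in>A. Q a = 0"
  using assms
proof (induction A arbitrary: Q rule: finite_induct)
  case (insert b A Q)
  have IH: "\<forall>a\<in>A. Q' a = 0" if "\<And>j :: nat. (\<Sum>a\<in>A. z a ^ j * poly (Q' a) (of_nat j)) = 0" for Q'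
    using insert.prems(1,2) by (intro insert.IH that) (auto intro: inj_on_subset)
  have sum_insert: "(\<Sum>a\<in>insert b A. h a) = h b + (\<Sum>a\<in>A. h a)" for h :: "'a \<Rightarrow> complex"
    using insert.hyps by simp
  show ?case using insert.prems(3)
  proof (induction "if Q b = 0 then 0 else Suc (degree (Q b))" arbitrary: Q rule: less_induct)
    case (less Q)
    show ?case
    proof (cases "Q b = 0")
      case True
      thus ?thesis using IH[of Q] less.prems unfolding sum_insert by simp
    next
      case False
      define Q' where "Q' a = Polynomial.smult (z a) (translate_poly (Q a)) - Polynomial.smult (z b) (Q a)" for a
      have "(\<Sum>a\<in>insert b A. z a ^ j * poly (Q' a) (of_nat j)) = 0" for j :: nat
      proof -
        have "(\<Sum>a\<in>insert b A. z a ^ j * poly (Q' a) (of_nat j))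
            = (\<Sum>a\<in>insert b A. z a ^ Suc j * poly (Q a) (of_nat (Suc j)))
              - z b * (\<Sum>a\<in>insert b A. z a ^ j * poly (Q a) (of_nat j))"
          unfolding sum_distrib_left sum_subtractf[symmetric]
          by (intro sum.cong refl) (simp add: Q'_def poly_translate algebra_simps)
        also have "\<dots> = 0" by (simp only: less.prems) simp
        finally show ?thesis .
      qed
      moreover have "(if Q' b = 0 then 0 else Suc (degree (Q' b))) < (if Q b = 0 then 0 else Suc (degree (Q b)))"
      proof (cases "degree (Q b) = 0")
        case True
        then obtain c where "Q b = [:c:]" by (auto elim: degree_eq_zeroE)
        hence "Q' b = 0" by (simp add: Q'_def translate_poly_def)
        thus ?thesis using False by simp
      next
        case deg: False
        have "degree (Q' b) < degree (Q b)"
        proof (rule degree_lessI)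
          show "\<forall>k\<ge>degree (Q b). coeff (Q' b) k = 0"
          proof (intro allI impI)
            fix k assume "k \<ge> degree (Q b)"
            thus "coeff (Q' b) k = 0"
              by (cases "k = degree (Q b)") (auto simp: Q'_def lead_coeff_translate_poly coeff_eq_0 degree_translate_poly)
          qed
        qed (use deg in auto)
        thus ?thesis using False by simp
      qed
      ultimately have Q': "\<forall>a\<in>insert b A. Q' a = 0" using less.hyps by blast
      have QA: "Q a = 0" if "a \<in> A" for a
      proof -
        have "z a \<noteq> z b" using insert.prems(1) insert.hyps that by (auto simp: inj_on_def)
        moreover have "(z a - z b) * lead_coeff (Q a) = coeff (Q' a) (degree (Q a))"
          by (simp add: Q'_def lead_coeff_translate_poly algebra_simps)
        hence "(z a - z b) * lead_coeff (Q a) = 0" using Q' that by simp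
        ultimately show ?thesis by simp
      qed
      have "poly (Q b) (of_nat j) = 0" for j :: nat
        using less.prems[of j] QA insert.prems(2)[of b] unfolding sum_insert by simp
      hence "Q b = 0" by (rule poly_eq_0_of_nat_zeros)
      thus ?thesis using QA by blast
    qed
  qed
qed auto

section \<open>Spaces of quasi-exponentials from a recurrence\<close>

text \<open>
  Exponential polynomials that satisfy a difference equation of order \<open>M\<close> with the leading and trailing
  coefficients that arise from the indicial polynomials at infinity and at zero.
\<close>

locale recurrence =
  fixes N M :: nat and n :: "nat \<Rightarrow> nat" and lam l :: "nat \<Rightarrow> complex" and q :: "nat \<Rightarrow> complex poly"
    and b :: "nat \<Rightarrow> complex \<Rightarrow> complex" and U :: "(complex \<Rightarrow> complex) set"
  assumes M: "1 < M"
    and lam: "\<And>i j. i < N \<Longrightarrow> j < N \<Longrightarrow> i \<noteq> j \<Longrightarrow> lam i - lam j \<notin> \<int>"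
    and l: "inj_on (\<lambda>a. exp (l a)) {..<M}"
    and q: "\<And>a. a < M \<Longrightarrow> q a \<noteq> 0"
    and U: "U = cfun.span ((\<lambda>a u. exp (u * l a) * poly (q a) u) ` {..<M})"
    and rec: "\<And>f u. f \<in> U \<Longrightarrow> (\<Sum>k\<le>M. b k u * f (u + of_nat k)) = 0"
    and top: "\<And>u. b M u = (\<Prod>k<N. u - lam k - of_nat (n k))"
    and bottom: "\<And>i. i < N \<Longrightarrow> b 0 (lam i) = 0"
begin

definition quasi_exp :: "nat \<Rightarrow> complex \<Rightarrow> complex" where
  "quasi_exp a = (\<lambda>u. exp (u * l a) * poly (q a) u)"

lemma U_quasi_exp: "U = cfun.span (quasi_exp ` {..<M})"
  by (simp add: U quasi_exp_def[abs_def])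

lemma lincomb_in_U: "(\<lambda>u. \<Sum>a<M. c a * quasi_exp a u) \<in> U"
  unfolding U_quasi_exp by (rule lincomb_in_span) (auto intro: cfun.span_base)

text \<open>
  The values on a single progression \<open>\<mu>, \<mu> + 1, \<dots>\<close> already separate the elements of \<open>U\<close>.
\<close>

lemma quasi_exp_independent:
  assumes "\<And>j :: nat. (\<Sum>a<M. c a * quasi_exp a (\<mu> + of_nat j)) = 0" and a: "a < M"
  shows "c a = 0"
proof -
  define Q where "Q a = Polynomial.smult (c a * exp (\<mu> * l a)) (pcompose (q a) [:\<mu>, 1:])" for a
  have "(\<Sum>a<M. exp (l a) ^ j * poly (Q a) (of_nat j)) = 0" for j :: nat
  proof -
    have "exp ((\<mu> + of_nat j) * l a) = exp (\<mu> * l a) * exp (l a) ^ j" for a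
      by (simp add: distrib_right exp_add exp_of_nat_mult)
    hence "exp (l a) ^ j * poly (Q a) (of_nat j) = c a * quasi_exp a (\<mu> + of_nat j)" for a
      by (simp add: Q_def quasi_exp_def poly_pcompose mult_ac)
    thus ?thesis using assms(1)[of j] by simp
  qed
  hence "\<forall>a\<in>{..<M}. Q a = 0" by (intro exponential_polynomial_eq_0[where z = "\<lambda>a. exp (l a)"] l) auto
  hence "Q a = 0" using a by simp
  moreover have "pcompose (q a) [:\<mu>, 1:] \<noteq> 0"
  proof
    assume "pcompose (q a) [:\<mu>, 1:] = 0"
    hence "q a = 0" by (rule pcompose_eq_0) auto
    thus False using q[OF a] by simp
  qed
  ultimately show ?thesis by (simp add: Q_def)
qed

lemma quasi_exp_basis: "is_basis M quasi_exp U"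
proof (rule is_basisI)
  fix c assume "\<And>t. (\<Sum>a<M. c a * quasi_exp a t) = 0"
  thus "\<forall>k<M. c k = 0" using quasi_exp_independent[of c 0] by simp
qed (simp add: U_quasi_exp)

text \<open>
  Use the equation at \<open>u = \<lambda>\<^sub>i + s\<close> with \<open>j = s + M - 1\<close>. Its leading coefficient is nonzero unless
  \<open>s = n\<^sub>i\<close>, since \<open>\<lambda>\<^sub>i - \<lambda>\<^sub>k\<close> is not an integer for \<open>k \<noteq> i\<close>. For \<open>s = 0\<close> the equation involves the value at
  \<open>\<lambda>\<^sub>i\<close>, one place before the progression starts, but there the trailing coefficient is zero.
\<close>

lemma zero_step:
  assumes i: "i < N" and f: "f \<in> U" and j: "j \<ge> M - 1" "j \<noteq> M - 1 + n i"
    and prev: "\<And>k. k < j \<Longrightarrow> f (lam i + 1 + of_nat k) = 0"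
  shows "f (lam i + 1 + of_nat j) = 0"
proof -
  define s where "s = j - (M - 1)"
  have js: "j = s + M - 1" using j(1) M by (simp add: s_def)
  define u where "u = lam i + of_nat s"
  have b: "b k u * f (u + of_nat k) = 0" if "k < M" for k
  proof (cases "s + k = 0")
    case True
    thus ?thesis using bottom[OF i] by (simp add: u_def)
  next
    case False
    have eq: "u + of_nat k = lam i + 1 + of_nat (s + k - 1)"
      using False by (simp add: u_def of_nat_diff Suc_leI)
    have "f (u + of_nat k) = 0"
      unfolding eq by (rule prev) (use False that js in auto)
    thus ?thesis by simp
  qed
  have "0 = (\<Sum>k\<le>M. b k u * f (u + of_nat k))" using rec[OF f] by simp
  also have "\<dots> = b M u * f (u + of_nat M)"
    unfolding lessThan_Suc_atMost[symmetric] sum.lessThan_Suc by (subst sum.neutral) (use b in auto)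
  finally have "b M u * f (u + of_nat M) = 0" by simp
  moreover have "b M u \<noteq> 0"
  proof
    assume "b M u = 0"
    then obtain k where k: "k < N" "lam i + of_nat s = lam k + of_nat (n k)"
      unfolding top u_def by (auto simp: algebra_simps)
    hence "lam i - lam k = of_int (int (n k) - int s)" by (simp add: algebra_simps)
    hence "lam i - lam k \<in> \<int>" by simp
    hence "k = i" using lam[OF i k(1)] by auto
    with k(2) have "s = n i" by simp
    thus False using j js M by simp
  qed
  moreover have "u + of_nat M = lam i + 1 + of_nat j"
    using M by (simp add: u_def js of_nat_diff)
  ultimately show ?thesis by simp
qed

definition exponent :: "nat \<Rightarrow> nat \<Rightarrow> nat" where
  "exponent i k = (if k = M - 1 then M - 1 + n i else k)"

lemma zero_before:
  assumes "i < N" "f \<in> U" "\<And>k. k < M - 1 \<Longrightarrow> f (lam i + 1 + of_nat k) = 0" "j < M - 1 + n i"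
  shows "f (lam i + 1 + of_nat j) = 0"
  using assms(4)
proof (induction j rule: less_induct)
  case (less j)
  show ?case
  proof (cases "j < M - 1")
    case False
    hence "j \<ge> M - 1" "j \<noteq> M - 1 + n i" using less.prems by auto
    from zero_step[OF assms(1,2) this] show ?thesis using less.IH less.prems by simp
  qed (rule assms(3))
qed

text \<open>
  Along the progression each value is zero, either by assumption or by \<open>zero_step\<close>, and an element of \<open>U\<close> is
  determined by these values.
\<close>

lemma zero_of_exponents:
  assumes i: "i < N" and f: "f = (\<lambda>u. \<Sum>a<M. c a * quasi_exp a u)" and z: "\<And>k. k < M \<Longrightarrow> f (lam i + 1 + of_nat (exponent i k)) = 0"
    and a: "a < M"
  shows "c a = 0"
proof -
  have fU: "f \<in> U" unfolding f by (rule lincomb_in_U)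
  have "f (lam i + 1 + of_nat j) = 0" for j
  proof (induction j rule: less_induct)
    case (less j)
    consider "j < M - 1" | "j = M - 1 + n i" | "j \<ge> M - 1" "j \<noteq> M - 1 + n i" by linarith
    thus ?case
    proof cases
      case 1
      thus ?thesis using z[of j] by (simp add: exponent_def)
    next
      case 2
      thus ?thesis using z[of "M - 1"] M by (simp add: exponent_def)
    next
      case 3
      from zero_step[OF i fU this] show ?thesis using less by blast
    qed
  qed
  thus ?thesis using quasi_exp_independent[of c "lam i + 1"] a unfolding f by blast
qed

text \<open>
  Evaluation at the \<open>M\<close> points is injective on \<open>U\<close>, hence invertible; the basis dual to it has the required
  zeros.
\<close>

theorem discrete_exponents_U:
  assumes i: "i < N"
  shows "discrete_exponents M U (lam i + 1) (exponent i)"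
proof -
  let ?p = "\<lambda>k. lam i + 1 + of_nat (exponent i k)"
  have "fdet M (\<lambda>k a. quasi_exp a (?p k)) \<noteq> 0"
  proof (rule fdet_nonzeroI)
    fix e j assume e: "\<And>k. k < M \<Longrightarrow> (\<Sum>a<M. quasi_exp a (?p k) * e a) = 0" and j: "j < M"
    show "e j = 0"
      by (rule zero_of_exponents[OF i refl _ j]) (use e in \<open>simp add: mult.commute\<close>)
  qed
  hence "\<exists>e. \<forall>k<M. (\<Sum>a<M. quasi_exp a (?p k) * e a) = (if k = k' then 1 else 0)" for k'
    by (rule fdet_solvable)
  then obtain e where e: "\<And>k k'. k < M \<Longrightarrow> (\<Sum>a<M. quasi_exp a (?p k) * e k' a) = (if k = k' then 1 else 0)"
    by metis
  define f where "f k = (\<lambda>u. \<Sum>a<M. e k a * quasi_exp a u)" for k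
  have fp: "f k' (?p k) = (if k = k' then 1 else 0)" if "k < M" for k k'
    using e[OF that, of k'] by (simp add: f_def mult.commute)
  have fU: "f k \<in> U" for k unfolding f_def by (rule lincomb_in_U)
  have "is_basis M f U"
  proof (rule is_basisI)
    fix c assume c: "\<And>t. (\<Sum>k<M. c k * f k t) = 0"
    show "\<forall>k<M. c k = 0"
    proof (intro allI impI)
      fix k assume k: "k < M"
      have "0 = (\<Sum>k'<M. c k' * f k' (?p k))" using c by simp
      also have "\<dots> = (\<Sum>k'<M. if k = k' then c k' else 0)"
        by (intro sum.cong refl) (simp add: fp[OF k])
      also have "\<dots> = c k" using k by simp
      finally show "c k = 0" by simp
    qed
  next
    have "quasi_exp a \<in> cfun.span (f ` {..<M})" if a: "a < M" for a
    proof -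
      define d where "d a' = (if a' = a then 1 else 0) - (\<Sum>k<M. quasi_exp a (?p k) * e k a')" for a'
      have d: "(\<Sum>a'<M. d a' * quasi_exp a' u) = quasi_exp a u - (\<Sum>k<M. quasi_exp a (?p k) * f k u)" for u
      proof -
        have "(\<Sum>a'<M. d a' * quasi_exp a' u)
            = (\<Sum>a'<M. if a' = a then quasi_exp a' u else 0) - (\<Sum>a'<M. \<Sum>k<M. quasi_exp a (?p k) * (e k a' * quasi_exp a' u))"
          unfolding sum_subtractf[symmetric]
          by (intro sum.cong refl) (auto simp: d_def left_diff_distrib sum_distrib_right mult.assoc)
        also have "\<dots> = quasi_exp a u - (\<Sum>k<M. quasi_exp a (?p k) * f k u)"
          using a by (subst sum.swap) (simp add: f_def sum_distrib_left)
        finally show ?thesis .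
      qed
      have d0: "d a' = 0" if "a' < M" for a'
      proof (rule zero_of_exponents[OF i refl _ that])
        fix k assume k: "k < M"
        have "(\<Sum>k'<M. quasi_exp a (?p k') * f k' (?p k)) = (\<Sum>k'<M. if k = k' then quasi_exp a (?p k') else 0)"
          by (intro sum.cong refl) (simp add: fp[OF k])
        also have "\<dots> = quasi_exp a (?p k)" using k by simp
        finally show "(\<Sum>a'<M. d a' * quasi_exp a' (?p k)) = 0" by (simp add: d)
      qed
      have "quasi_exp a = (\<lambda>u. \<Sum>k<M. quasi_exp a (?p k) * f k u)"
      proof
        fix u
        have "0 = (\<Sum>a'<M. d a' * quasi_exp a' u)" by (rule sum.neutral[symmetric]) (use d0 in auto)
        also have "\<dots> = quasi_exp a u - (\<Sum>k<M. quasi_exp a (?p k) * f k u)" by (rule d)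
        finally show "quasi_exp a u = (\<Sum>k<M. quasi_exp a (?p k) * f k u)" by simp
      qed
      also have "\<dots> \<in> cfun.span (f ` {..<M})"
        by (rule lincomb_in_span) (auto intro: cfun.span_base)
      finally show ?thesis .
    qed
    hence "U \<subseteq> cfun.span (f ` {..<M})"
      unfolding U_quasi_exp by (intro cfun.span_minimal cfun.subspace_span) auto
    moreover have "cfun.span (f ` {..<M}) \<subseteq> U"
      using fU unfolding U_quasi_exp by (intro cfun.span_minimal cfun.subspace_span) auto
    ultimately show "cfun.span (f ` {..<M}) = U" by simp
  qed
  moreover have "f k (lam i + 1 + of_nat j) = 0" if k: "k < M" and j: "j < exponent i k" for k j
  proof (cases "k = M - 1")
    case False
    hence "j < k" using j by (simp add: exponent_def)
    hence "exponent i j = j" "j < M" using k by (auto simp: exponent_def)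
    thus ?thesis using fp[of j k] \<open>j < k\<close> by simp
  next
    case True
    show ?thesis
    proof (rule zero_before[OF i fU])
      fix k' assume k': "k' < M - 1"
      hence "exponent i k' = k'" by (simp add: exponent_def)
      thus "f k (lam i + 1 + of_nat k') = 0" using fp[of k' k] k' True by simp
    qed (use j True in \<open>simp add: exponent_def\<close>)
  qed
  moreover have "f k (?p k) \<noteq> 0" if "k < M" for k using fp[OF that] by simp
  moreover have "strict_mono_on {..<M} (exponent i)"
    by (rule strict_mono_onI) (auto simp: exponent_def)
  ultimately show ?thesis unfolding discrete_exponents_def by blast
qed

end

section \<open>The special fundamental differential operator\<close>

context quasi_polynomials
begin

definition coeff_poly :: "(nat \<Rightarrow> nat \<Rightarrow> complex) \<Rightarrow> nat \<Rightarrow> complex poly" where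
  "coeff_poly A j = (\<Sum>i\<le>M. monom (A i j) i)"

lemma coeff_coeff_poly: "coeff (coeff_poly A j) i = (if i \<le> M then A i j else 0)"
  by (auto simp: coeff_poly_def coeff_sum)

lemma poly_coeff_poly: "poly (coeff_poly A j) x = (\<Sum>i\<le>M. A i j * x ^ i)"
  by (simp add: coeff_poly_def poly_sum poly_monom)

lemma operator_branch:
  assumes "v holomorphic_on UNIV"
  shows "(\<Sum>i\<le>M. \<Sum>j\<le>N. A i j * exp l ^ i * (euler_op ^^ j) (branch l v) (exp l))
      = (\<Sum>j\<le>N. poly (coeff_poly A j) (exp l) * (deriv ^^ j) v l)"
proof -
  have "(euler_op ^^ j) (branch l v) (exp l) = (deriv ^^ j) v l" for j
    by (simp add: euler_op_branch[OF assms] branch_log_branch)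
  thus ?thesis by (subst sum.swap) (simp add: poly_coeff_poly sum_distrib_right)
qed

lemma higher_deriv_power_at:
  assumes "j \<le> K" shows "(deriv ^^ j) (\<lambda>t. (t - l) ^ K) l = (if j = K then fact K else (0::complex))"
proof -
  have "(\<lambda>_. 1 :: complex) holomorphic_on UNIV" by simp
  from higher_deriv_power_factor[OF this assms, of l] obtain u where
    "u l = fact K / fact (K - j)" "(deriv ^^ j) (\<lambda>t. (t - l) ^ K) = (\<lambda>t. (t - l) ^ (K - j) * u t)"
    by auto
  thus ?thesis using assms by (auto simp: power_0_left)
qed

lemma branch_analytic:
  assumes "v holomorphic_on UNIV" shows "branch l v analytic_on {exp l}"
proof -
  have "branch l v holomorphic_on half_plane l"
    using has_field_derivative_branch[OF assms, of _ l 0] open_half_plane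
    by (auto simp: holomorphic_on_open)
  hence "branch l v analytic_on half_plane l" by (simp add: analytic_on_open open_half_plane)
  thus ?thesis by (rule analytic_on_subset) auto
qed

lemma eventually_exp:
  assumes "\<forall>\<^sub>F x in cosparse UNIV. P x" shows "\<forall>\<^sub>F t in at l. P (exp t :: complex)"
proof -
  have "filterlim exp (at (exp l)) (at l)"
    by (rule filterlim_atI) (auto intro!: tendsto_intros eventually_exp_neq)
  moreover have "\<forall>\<^sub>F x in at (exp l). P x"
    using eventually_cosparse_imp_eventually_at[OF assms UNIV_I] .
  ultimately show ?thesis by (rule eventually_compose_filterlim[rotated])
qed

text \<open>
  The function \<open>(ln x - ln x\<^sub>0)\<^sup>N\<close> isolates the leading coefficient at \<open>x\<^sub>0\<close>, because its \<open>t\<close>-derivatives of order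
  below \<open>N\<close> vanish there, and so do its \<open>x\<close>-derivatives. The elements of \<open>V\<close> give the remaining conditions. Both hold
  outside of a sparse set at first and extend to all points by continuity.
\<close>

theorem special_operator_annihilator:
  assumes "special_fundamental_differential_op N M z V
         (\<lambda>f x. \<Sum>i\<le>M. \<Sum>j\<le>N. A i j * x ^ i * (euler_op ^^ j) f x)"
  shows "annihilator (coeff_poly A)"
proof -
  from assms obtain c where c: "fundamental_differential_op N V c"
    and eq: "\<forall>\<^sub>F x in cosparse UNIV. \<forall>f. f analytic_on {x} \<longrightarrow>
      (\<Sum>i\<le>M. \<Sum>j\<le>N. A i j * x ^ i * (euler_op ^^ j) f x) = x ^ N * (\<Prod>b<M. x - z b) * differential_op N c f x"
    unfolding special_fundamental_differential_op_def by blast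
  have cN: "c N x = 1" for x using c by (simp add: fundamental_differential_op_def)
  have lead: "coeff_poly A N = lin_prod M z"
  proof -
    have "poly (coeff_poly A N - lin_prod M z) (exp l) = 0" for l
    proof (rule eq_0_of_isCont[where F = "\<lambda>t. poly (coeff_poly A N - lin_prod M z) (exp t)"])
      show "\<forall>\<^sub>F t in at l. poly (coeff_poly A N - lin_prod M z) (exp t) = 0"
        using eventually_exp[OF eq, of l]
      proof eventually_elim
        case (elim t)
        define v where "v = (\<lambda>s. (s - t) ^ N)"
        have v: "v holomorphic_on UNIV" unfolding v_def by (intro holomorphic_intros)
        have dv: "(deriv ^^ j) v t = (if j = N then fact N else 0)" if "j \<le> N" for j
          using higher_deriv_power_at[OF that] by (simp add: v_def)
        have pick: "(\<Sum>j\<le>K. h j * (deriv ^^ j) v t) = (if K = N then h N * fact N else 0)"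
          if "K \<le> N" for h K
        proof -
          have "(\<Sum>j\<le>K. h j * (deriv ^^ j) v t) = (\<Sum>j\<le>K. if j = N then h N * fact N else 0)"
            using that by (intro sum.cong refl) (auto simp: dv)
          thus ?thesis using that by auto
        qed
        have "differential_op N c (branch t v) (exp t)
            = (\<Sum>k\<le>N. c k (exp t) * (if k = N then coeff (falling_poly N) N * fact N / exp t ^ N else 0))"
          unfolding differential_op_def
        proof (intro sum.cong refl arg_cong2[of _ _ _ _ "(*)"])
          fix k assume k: "k \<in> {..N}"
          have "(deriv ^^ k) (branch t v) (exp t) = (\<Sum>i\<le>k. coeff (falling_poly k) i * (deriv ^^ i) v t) / exp t ^ k"
            by (simp add: higher_deriv_branch[OF v] branch_log_branch)
          also have "\<dots> = (if k = N then coeff (falling_poly N) N * fact N / exp t ^ N else 0)"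
            using k by (subst pick) auto
          finally show "(deriv ^^ k) (branch t v) (exp t) = \<dots>" .
        qed
        also have "\<dots> = (\<Sum>k\<le>N. if k = N then fact N / exp t ^ N else 0)"
          by (intro sum.cong refl) (auto simp: cN lead_coeff_falling_poly)
        also have "\<dots> = fact N / exp t ^ N" by simp
        finally have D: "differential_op N c (branch t v) (exp t) = fact N / exp t ^ N" .
        have "poly (coeff_poly A N) (exp t) * fact N = (\<Sum>j\<le>N. poly (coeff_poly A j) (exp t) * (deriv ^^ j) v t)"
          by (subst pick) auto
        also have "\<dots> = exp t ^ N * (\<Prod>b<M. exp t - z b) * differential_op N c (branch t v) (exp t)"
          using elim branch_analytic[OF v, of t] unfolding operator_branch[OF v, symmetric] by blast
        also have "\<dots> = (\<Prod>b<M. exp t - z b) * fact N" unfolding D by simp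
        finally show ?case by (simp add: poly_lin_prod)
      qed
    qed (intro continuous_intros)
    hence "coeff_poly A N - lin_prod M z = 0" by (rule poly_exp_eq_0)
    thus ?thesis by simp
  qed
  have "(\<Sum>j\<le>N. poly (coeff_poly A j) (exp l) * (deriv ^^ j) v l) = 0" if vV: "v \<in> V" for v l
  proof (rule eq_0_of_isCont[where F = "\<lambda>t. \<Sum>j\<le>N. poly (coeff_poly A j) (exp t) * (deriv ^^ j) v t"])
    note v = V_entire[OF vV]
    have ann: "\<forall>\<^sub>F x in cosparse UNIV. \<forall>l. exp l = x \<longrightarrow> differential_op N c (branch l v) x = 0"
      using c vV by (simp add: fundamental_differential_op_def)
    show "\<forall>\<^sub>F t in at l. (\<Sum>j\<le>N. poly (coeff_poly A j) (exp t) * (deriv ^^ j) v t) = 0"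
      using eventually_exp[OF eq, of l] eventually_exp[OF ann, of l]
    proof eventually_elim
      case (elim t)
      have "differential_op N c (branch t v) (exp t) = 0" using elim(2) by blast
      thus ?case using elim(1) branch_analytic[OF v, of t] unfolding operator_branch[OF v, symmetric] by simp
    qed
    show "isCont (\<lambda>t. \<Sum>j\<le>N. poly (coeff_poly A j) (exp t) * (deriv ^^ j) v t) l"
      using entire_isCont[OF holomorphic_higher_deriv[OF v open_UNIV]]
      by (intro continuous_intros) auto
  qed
  thus ?thesis unfolding annihilator_def using lead
    by (auto intro!: degree_le simp: coeff_coeff_poly)
qed

end

section \<open>The transformed space\<close>

lemma shift_op_iter: "(shift_op ^^ k) f u = f (u + of_nat k)"
  by (induction k arbitrary: u) (auto simp: shift_op_def add_ac)

locale quasi_polynomial_transform = quasi_polynomials +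
  fixes l :: "nat \<Rightarrow> complex" and r :: "nat \<Rightarrow> real" and U :: "(complex \<Rightarrow> complex) set"
  assumes l_exp: "\<And>a. a < M \<Longrightarrow> exp (l a) = z a" and radii: "small_radii M z r"
    and U_eq: "U = transformed_space N M z l r V"
begin

lemma circle: "a < M \<Longrightarrow> transform_circle N M n m lam z V p a l r"
  using radii l_exp by unfold_locales (auto simp: small_radii_def)

text \<open>
  For each circle the transforms form a line, spanned by one exponential polynomial.
\<close>

lemma transformed_space_basis:
  "\<exists>q. (\<forall>a<M. q a \<noteq> 0 \<and> degree (q a) = m a) \<and>
     U = cfun.span ((\<lambda>a u. exp (u * l a) * poly (q a) u) ` {..<M})"
proof -
  define good where "good a q \<longleftrightarrow> q \<noteq> 0 \<and> degree q = m a \<and>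
     (\<forall>f\<in>dual_space N V. \<exists>\<alpha>. hat_transform N M z l r f a = (\<lambda>u. \<alpha> * (exp (u * l a) * poly q u))) \<and>
     (\<exists>f\<in>dual_space N V. \<exists>\<alpha>. \<alpha> \<noteq> 0 \<and> hat_transform N M z l r f a = (\<lambda>u. \<alpha> * (exp (u * l a) * poly q u)))"
    for a q
  have "\<forall>a. \<exists>q. a < M \<longrightarrow> good a q"
    using transform_circle.hat_transform_form[OF circle] unfolding good_def by blast
  then obtain q where q: "\<And>a. a < M \<Longrightarrow> good a (q a)" by metis
  define quasi_exp where "quasi_exp a = (\<lambda>u. exp (u * l a) * poly (q a) u)" for a
  have "U = cfun.span (quasi_exp ` {..<M})"
    unfolding U_eq transformed_space_def
  proof (rule cfun.span_eq[THEN iffD2], intro conjI subsetI)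
    fix h assume "h \<in> {hat_transform N M z l r f a | f a. f \<in> dual_space N V \<and> a < M}"
    then obtain f a where fa: "h = hat_transform N M z l r f a" "f \<in> dual_space N V" "a < M" by blast
    then obtain \<alpha> where "h = (\<lambda>u. \<alpha> * quasi_exp a u)" using q[OF fa(3)] unfolding good_def quasi_exp_def by blast
    moreover have "(\<lambda>u. \<alpha> * quasi_exp a u) \<in> cfun.span (quasi_exp ` {..<M})"
      by (intro cfun.span_scale cfun.span_base) (use fa(3) in auto)
    ultimately show "h \<in> cfun.span (quasi_exp ` {..<M})" by simp
  next
    fix h assume "h \<in> quasi_exp ` {..<M}"
    then obtain a where a: "h = quasi_exp a" "a < M" by auto
    then obtain f \<alpha> where f: "f \<in> dual_space N V" "\<alpha> \<noteq> 0" "hat_transform N M z l r f a = (\<lambda>u. \<alpha> * quasi_exp a u)"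
      using q[OF a(2)] unfolding good_def quasi_exp_def by blast
    have "h = (\<lambda>u. inverse \<alpha> * hat_transform N M z l r f a u)"
      using f(2) by (simp add: f(3) a(1))
    also have "\<dots> \<in> cfun.span {hat_transform N M z l r f a | f a. f \<in> dual_space N V \<and> a < M}"
      using f(1) a(2) by (intro cfun.span_scale cfun.span_base) blast
    finally show "h \<in> cfun.span {hat_transform N M z l r f a | f a. f \<in> dual_space N V \<and> a < M}" .
  qed
  thus ?thesis using q unfolding good_def quasi_exp_def[abs_def] by blast
qed

lemma U_recurrence:
  assumes C: "annihilator C" and f: "f \<in> U"
  shows "(\<Sum>i\<le>M. (\<Sum>j\<le>N. coeff (C j) i * u ^ j) * f (u + of_nat i)) = 0"
  using f unfolding U_eq transformed_space_def
proof (induction rule: cfun.span_induct_alt)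
  case base
  show ?case by simp
next
  case (step c x y)
  from step(1) obtain f a where fa: "x = hat_transform N M z l r f a" "f \<in> dual_space N V" "a < M" by blast
  have x: "(\<Sum>i\<le>M. (\<Sum>j\<le>N. coeff (C j) i * u ^ j) * x (u + of_nat i)) = 0"
    using transform_circle.hat_recurrence[OF circle[OF fa(3)] fa(2) C, of u]
    by (simp add: fa(1) sum_distrib_right)
  have "(\<Sum>i\<le>M. (\<Sum>j\<le>N. coeff (C j) i * u ^ j) * ((\<lambda>t. c * x t) + y) (u + of_nat i))
      = c * (\<Sum>i\<le>M. (\<Sum>j\<le>N. coeff (C j) i * u ^ j) * x (u + of_nat i))
        + (\<Sum>i\<le>M. (\<Sum>j\<le>N. coeff (C j) i * u ^ j) * y (u + of_nat i))"
    by (simp add: distrib_left sum.distrib sum_distrib_left mult.left_commute)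
  thus ?case using x step(2) by simp
qed

theorem quasi_exponential: "quasi_exponential_space M N m z l n (\<lambda>i. lam i + 1) U"
proof -
  obtain C where C: "annihilator C" using annihilator_exists by blast
  obtain q where q': "\<And>a. a < M \<Longrightarrow> q a \<noteq> 0" "\<And>a. a < M \<Longrightarrow> degree (q a) = m a"
    "U = cfun.span ((\<lambda>a u. exp (u * l a) * poly (q a) u) ` {..<M})"
    using transformed_space_basis by blast
  have "inj_on (\<lambda>a. exp (l a)) {..<M}" using z_inj l_exp by (auto simp: inj_on_def)
  then interpret recurrence N M n lam l q "\<lambda>i u. \<Sum>j\<le>N. coeff (C j) i * u ^ j" U
    using M lam q' U_recurrence[OF C] annihilator_top[OF C] annihilator_bottom[OF C]
    by unfold_locales auto
  have "is_basis M (\<lambda>a u. exp (u * l a) * poly (q a) u) U"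
    using quasi_exp_basis by (simp add: quasi_exp_def[abs_def])
  hence "\<exists>q. (\<forall>a<M. q a \<noteq> 0 \<and> degree (q a) = m a) \<and> is_basis M (\<lambda>a u. exp (u * l a) * poly (q a) u) U"
    using q'(1,2) by blast
  moreover have "discrete_exponents M U (lam i + 1) (\<lambda>k. if k = M - 1 then M - 1 + n i else k)" if "i < N" for i
    using discrete_exponents_U[OF that] by (simp add: exponent_def[abs_def])
  ultimately show ?thesis unfolding quasi_exponential_space_def
    using N M z_inj z0 l_exp lam fuchs_relation by auto
qed

text \<open>
  The leading coefficient of the difference equation is \<open>\<Prod>(u - \<lambda>\<^sub>k - n\<^sub>k)\<close>, which is the factor that the special operator
  prescribes for \<open>\<mu>\<^sub>k = \<lambda>\<^sub>k + 1\<close>; division by it gives the monic operator.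
\<close>

theorem special_difference_operator:
  assumes "special_fundamental_differential_op N M z V
         (\<lambda>f x. \<Sum>i\<le>M. \<Sum>j\<le>N. A i j * x ^ i * (euler_op ^^ j) f x)"
  shows "special_fundamental_difference_op M N n (\<lambda>i. lam i + 1) U
         (\<lambda>g u. \<Sum>i\<le>M. \<Sum>j\<le>N. A i j * u ^ j * (shift_op ^^ i) g u)"
proof -
  have C: "annihilator (coeff_poly A)" using assms by (rule special_operator_annihilator)
  define \<beta> where "\<beta> i u = (\<Sum>j\<le>N. A i j * u ^ j)" for i u
  define \<tau> where "\<tau> u = (\<Prod>k<N. u - lam k - of_nat (n k))" for u
  have top: "\<beta> M u = \<tau> u" for u
    using annihilator_top[OF C, of u] by (simp add: coeff_coeff_poly \<beta>_def \<tau>_def)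
  have rec: "(\<Sum>i\<le>M. \<beta> i u * f (u + of_nat i)) = 0" if "f \<in> U" for f u
    using U_recurrence[OF C that, of u] by (simp add: coeff_coeff_poly \<beta>_def)
  define b where "b k = (if k = M then (\<lambda>u. 1) else (\<lambda>u. \<beta> k u / \<tau> u))" for k
  have nz: "\<forall>\<^sub>F u in cosparse UNIV. \<tau> u \<noteq> 0"
  proof -
    have "finite ((\<lambda>k. lam k + of_nat (n k)) ` {..<N})" by simp
    hence "\<forall>\<^sub>F u in at u0. u \<notin> (\<lambda>k. lam k + of_nat (n k)) ` {..<N}" for u0
      using islimpt_finite islimpt_iff_eventually by blast
    hence "\<forall>\<^sub>F u in cosparse UNIV. u \<notin> (\<lambda>k. lam k + of_nat (n k)) ` {..<N}"
      by (simp add: eventually_cosparse_open_eq)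
    thus ?thesis by eventually_elim (auto simp: \<tau>_def diff_diff_eq)
  qed
  have op: "(\<Sum>i\<le>M. \<Sum>j\<le>N. A i j * u ^ j * (shift_op ^^ i) g u) = (\<Sum>i\<le>M. \<beta> i u * g (u + of_nat i))" for g u
    by (simp add: \<beta>_def shift_op_iter sum_distrib_right)
  have diff: "\<tau> u * difference_op M b g u = (\<Sum>i\<le>M. \<beta> i u * g (u + of_nat i))" if "\<tau> u \<noteq> 0" for g u
    unfolding difference_op_def sum_distrib_left
    using that by (intro sum.cong refl) (auto simp: b_def shift_op_iter top)
  have "fundamental_difference_op M U b"
    unfolding fundamental_difference_op_def
  proof (intro conjI allI impI ballI)
    fix k
    have "(\<lambda>u. \<beta> k u) analytic_on UNIV" "\<tau> analytic_on UNIV"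
      unfolding \<beta>_def \<tau>_def[abs_def] by (intro analytic_intros)+
    thus "b k meromorphic_on UNIV"
      by (cases "k = M") (simp_all add: b_def meromorphic_on_divide analytic_on_imp_meromorphic_on)
  next
    fix f assume f: "f \<in> U"
    show "\<forall>\<^sub>F u in cosparse UNIV. difference_op M b f u = 0"
      using nz by eventually_elim (use diff rec[OF f] in \<open>metis mult_eq_0_iff\<close>)
  qed (simp add: b_def)
  moreover have "(\<Prod>i<N. u - (lam i + 1) - of_nat (n i) + 1) = \<tau> u" for u
    by (simp add: \<tau>_def algebra_simps)
  hence "\<forall>\<^sub>F u in cosparse UNIV. \<forall>g. (\<Sum>i\<le>M. \<Sum>j\<le>N. A i j * u ^ j * (shift_op ^^ i) g u)
      = (\<Prod>i<N. u - (lam i + 1) - of_nat (n i) + 1) * difference_op M b g u"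
    using nz by (auto elim!: eventually_mono simp: op diff)
  ultimately show ?thesis unfolding special_fundamental_difference_op_def by blast
qed

end

theorem theorem5p1:
  fixes N M :: nat and n m :: "nat \<Rightarrow> nat" and lam z l :: "nat \<Rightarrow> complex"
    and r :: "nat \<Rightarrow> real" and V U :: "(complex \<Rightarrow> complex) set"
  assumes V: "quasi_polynomial_space N M n lam m z V"
    and l: "\<And>a. a < M \<Longrightarrow> exp (l a) = z a"
    and r: "small_radii M z r"
    and U: "U = transformed_space N M z l r V"
  shows "quasi_exponential_space M N m z l n (\<lambda>i. lam i + 1) U \<and>
    (\<forall>A :: nat \<Rightarrow> nat \<Rightarrow> complex.
       special_fundamental_differential_op N M z V
         (\<lambda>f x. \<Sum>i\<le>M. \<Sum>j\<le>N. A i j * x ^ i * (euler_op ^^ j) f x) \<longrightarrow>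
       special_fundamental_difference_op M N n (\<lambda>i. lam i + 1) U
         (\<lambda>g u. \<Sum>i\<le>M. \<Sum>j\<le>N. A i j * u ^ j * (shift_op ^^ i) g u))"
proof -
  obtain p where p: "\<forall>i<N. degree (p i) = n i \<and> poly (p i) 0 \<noteq> 0"
    "is_basis N (\<lambda>i t. exp (lam i * t) * poly (p i) (exp t)) V"
    using V unfolding quasi_polynomial_space_def by blast
  interpret quasi_polynomial_transform N M n m lam z V p l r U
    using V p l r U unfolding quasi_polynomial_space_def by unfold_locales auto
  show ?thesis using quasi_exponential special_difference_operator by blast
qed

end
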